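(* Suppose the ignorability condition $R\perp\!\!\!\perp Y\mid X$ and the Basic Assumption (stated in the context) hold, and $Na_N\to\infty$ as $N\to\infty$. Suppose the cross-fitted estimators $\hat m(\cdot)$ and $\hat\pi_N(\cdot)$ have (possibly misspecified) limits $\mu(\cdot)$ and $e_N(\cdot)$ such that for every $k\le\mathbb K$: $$\mathbb E_X\Big[\tfrac{a_N}{\pi_N(X)}\{\hat m(X;\mathbb S_{-k})-\mu(X)\}^2\Big]=O_p(c_{\mu,N}^2),\qquad \mathbb E_X\Big[\tfrac{a_N}{\pi_N(X)}\Big\{1-\tfrac{e_N(X)}{\hat\pi_N(X;\mathbb S_{-k})}\Big\}^2\Big]=O_p(c_{e,N}^2),$$ $$\mathbb E_X\{\hat m(X;\mathbb S_{-k})-\mu(X)\}^2=O_p(r_{\mu,N}^2),\qquad \mathbb E_X\Big\{1-\tfrac{e_N(X)}{\hat\pi_N(X;\mathbb S_{-k})}\Big\}^2=O_p(r_{e,N}^2),$$ where $c_{\mu,N},c_{e,N},r_{\mu,N},r_{e,N}$ are sequences that are all $o(1)$. Let $$\hat\theta_{\mathrm{DRSS}}=N^{-1}\sum_{i=1}^N\hat m(X_i)+N^{-1}\sum_{i=1}^N\frac{R_i}{\hat\pi_N(X_i)}\{Y_i-\hat m(X_i)\},\qquad \psi_{\mu,e}(Z)=\mu(X)+\frac{R}{e_N(X)}\{Y-\mu(X)\}-\theta_0.$$ (a) Suppose both $\mu(\cdot)=m(\cdot)$ and $e_N(\cdot)=\pi_N(\cdot)$. Then, as $N\to\infty$, $$\hat\theta_{\mathrm{DRSS}}-\theta_0=N^{-1}\sum_{i=1}^N\psi_{\mu,e}(Z_i)+O_p\Big(\frac{c_{\mu,N}}{\sqrt{Na_N}}+\frac{c_{e,N}}{\sqrt{Na_N}}+r_{\mu,N}r_{e,N}\Big),$$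 and $V_N(\mu,e):=\mathrm{Var}\{\psi_{\mu,e}(Z)\}\asymp a_N^{-1}$. Hence, if further $r_{\mu,N}r_{e,N}=o(1/\sqrt{Na_N})$ and the Tail Condition (stated in the context) holds, then $$(Na_N)^{1/2}(\hat\theta_{\mathrm{DRSS}}-\theta_0)=O_p(1)\quad\text{and}\quad N^{1/2}V_N^{-1/2}(\mu,e)(\hat\theta_{\mathrm{DRSS}}-\theta_0)\xrightarrow{d}\mathcal N(0,1).$$ (b) Suppose that at least one of $\mu(\cdot)=m(\cdot)$, $e_N(\cdot)=\pi_N(\cdot)$ holds. If $e_N(\cdot)\ne\pi_N(\cdot)$, assume moreover that $c\le\pi_N(X)/e_N(X)\le C$ a.s. for some constants $c,C>0$. Then, as $N\to\infty$, $$\hat\theta_{\mathrm{DRSS}}-\theta_0=N^{-1}\sum_{i=1}^N\psi_{\mu,e}(Z_i)+O_p\Big(\frac{c_{\mu,N}}{\sqrt{Na_N}}+\frac{c_{e,N}}{\sqrt{Na_N}}+r_{\mu,N}r_{e,N}\Big)+\hat\Delta_N,$$ where $$\hat\Delta_N=N^{-1}\sum_{i=1}^N\Big\{\frac{R_i}{\pi_N(X_i)}-\frac{R_i}{\hat\pi_N(X_i)}\Big\}\{\mu(X_i)-m(X_i)\}\quad\text{if }e_N(\cdot)=\pi_N(\cdot),$$ $$\hat\Delta_N=N^{-1}\sum_{i=1}^N\Big\{\frac{R_i}{\pi_N(X_i)}-\frac{R_i}{e_N(X_i)}\Big\}\{\hat m(X_i)-m(X_i)\}\quad\text{if }\mu(\cdot)=m(\cdot).$$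 Suppose further that, for a constant $C<\infty$, $\|m(\cdot)-\mu(\cdot)\|_{2,\mathbb P_X}<C$ in the first case and $\|1-\pi_N(\cdot)/e_N(\cdot)\|_{2,\mathbb P_X}<C$ in the second case. Then $$\hat\theta_{\mathrm{DRSS}}-\theta_0=O_p\Big(\frac{1+c_{\mu,N}+c_{e,N}}{\sqrt{Na_N}}+r_{\mu,N}r_{e,N}+r_{e,N}\mathbf 1\{\mu(\cdot)\ne m(\cdot)\}+r_{\mu,N}\mathbf 1\{e_N(\cdot)\ne\pi_N(\cdot)\}\Big).$$
   Context: Setting. For each $N$ the data $\mathbb S=\{Z_i=(R_i,R_iY_i,X_i)\}_{i=1}^N$ are i.i.d. copies of $Z=(R,RY,X)$, with $R\in\{0,1\}$ (labeling indicator), $Y\in\mathbb R$, $X\in\mathbb R^p$; $\mathcal X$ is the support of the law $\mathbb P_X$ of $X$. The law of $R$ given $X$ (and $p$) may depend on $N$ (triangular array); this dependence is suppressed. $\theta_0=\mathbb E(Y)$, $m(x)=\mathbb E(Y\mid X=x)$, $\pi_N(x)=\mathbb P(R=1\mid X=x)$. It is assumed that $\mathbb E\{\pi_N^{-1}(X)\}<\infty$ for each $N$, and $a_N:=[\mathbb E\{\pi_N^{-1}(X)\}]^{-1}$ (which may tend to $0$). Cross-fitting. For a fixed integer $\mathbb K\ge2$, $\{\mathcal I_k\}_{k=1}^{\mathbb K}$ is a random partition of $\{1,\dots,N\}$ (independent of the data); $\mathbb S_{-k}=\{Z_i:i\notin\mathcal I_k\}$; $\hat m(\cdot;\mathbb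 S_{-k})$ and $\hat\pi_N(\cdot;\mathbb S_{-k})$ are estimators of $m$ and $\pi_N$ built from $\mathbb S_{-k}$ only; $\hat m(X_i):=\hat m(X_i;\mathbb S_{-k(i)})$ and $\hat\pi_N(X_i):=\hat\pi_N(X_i;\mathbb S_{-k(i)})$, where $k(i)$ is the unique $k$ with $i\in\mathcal I_k$. $\mathbb E_X$ denotes expectation over an independent copy of $X$ with the estimators (training data) held fixed; $\|f\|_{r,\mathbb P_X}=\{\mathbb E_X|f(X)|^r\}^{1/r}$. $\mu(\cdot)$ and $e_N(\cdot)$ are nonrandom functions. Basic Assumption. (a) $Z$ has finite second moments and $\mathrm{Var}(X)$ is positive definite. (b) There are constants $0<\sigma_{\zeta,1}^2$, $\sigma_{\zeta,2}^2<\infty$ (not depending on $N$) with $\mathbb E[\{Y-m(X)\}^2\mid X=x]\ge\sigma_{\zeta,1}^2$ and $\mathbb E[\{Y-\mu(X)\}^2\mid X=x]\le\sigma_{\zeta,2}^2$ for all $x\in\mathcal X$, and $\mathrm{Var}(Y)\le\sigma_{\zeta,2}^2$. Tail Condition. With $\psi_{\mu,\pi}(Z)=\mu(X)+\frac{R}{\pi_N(X)}\{Y-\mu(X)\}-\theta_0$: for every $c>0$, $a_N^{-1}\... $ in the form $a_N^{-1}\,\mathbb E[\psi_{\mu,\pi}^2(Z)\mathbf 1\{|\psi_{\mu,\pi}(Z)|>c\sqrt{N/a_N}\}]\to0$ as $N\to\infty$. $u_N\asymp v_N$ means $cv_N<u_N<Cv_N$ for some constants $c,C>0$ and all large $N$.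 *)

theory Defs
  imports "HOL-Probability.Probability" "HOL-Library.Landau_Symbols"
begin

text \<open>
  The dimension of the covariates may vary with the sample size, so a point of \<open>p\<close>-dimensional
  Euclidean space is an element of the product space over the index set \<open>{..<p}\<close>.  An observation
  is a triple \<open>(R, R * Y, X)\<close>.
\<close>

type_synonym covariate = "nat \<Rightarrow> real"
type_synonym observation = "real \<times> real \<times> covariate"
type_synonym estimator = "nat set \<Rightarrow> (nat \<Rightarrow> observation) \<Rightarrow> covariate \<Rightarrow> real"

abbreviation covariate_space :: "nat \<Rightarrow> covariate measure" where
  "covariate_space p \<equiv> Pi\<^sub>M {..<p} (\<lambda>_. borel)"

abbreviation observation_space :: "nat \<Rightarrow> observation measure" where
  "observation_space p \<equiv> borel \<Otimes>\<^sub>M (borel \<Otimes>\<^sub>M covariate_space p)"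

text \<open>
  Topological support; the boxes below form a neighbourhood base of \<open>x\<close> in the Euclidean topology.
\<close>

definition covariate_support :: "nat \<Rightarrow> covariate measure \<Rightarrow> covariate set" where
  "covariate_support p PX =
     {x \<in> space (covariate_space p).
        \<forall>\<epsilon>>0. 0 < measure PX {y \<in> space (covariate_space p). \<forall>j<p. \<bar>y j - x j\<bar> < \<epsilon>}}"


section \<open>Conditioning on a random variable\<close>

abbreviation sigma_of :: "'a measure \<Rightarrow> 'b measure \<Rightarrow> ('a \<Rightarrow> 'b) \<Rightarrow> 'a measure" where
  "sigma_of M S X \<equiv> vimage_algebra (space M) X S"

text \<open>
  \<open>f x = E(W | X = x)\<close> means that \<open>f\<close> is a version of the regression function.  For nonnegative
  \<open>W\<close> the extended version is used, so that an infinite conditional expectation is not read as 0.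
\<close>

definition cond_exp_version ::
  "'a measure \<Rightarrow> 'b measure \<Rightarrow> ('a \<Rightarrow> 'b) \<Rightarrow> ('a \<Rightarrow> real) \<Rightarrow> ('b \<Rightarrow> real) \<Rightarrow> bool" where
  "cond_exp_version M S X W f \<longleftrightarrow>
     f \<in> borel_measurable S \<and> (AE \<omega> in M. real_cond_exp M (sigma_of M S X) W \<omega> = f (X \<omega>))"

definition nn_cond_exp_version ::
  "'a measure \<Rightarrow> 'b measure \<Rightarrow> ('a \<Rightarrow> 'b) \<Rightarrow> ('a \<Rightarrow> ennreal) \<Rightarrow> ('b \<Rightarrow> ennreal) \<Rightarrow> bool" where
  "nn_cond_exp_version M S X W f \<longleftrightarrow>
     f \<in> borel_measurable S \<and> (AE \<omega> in M. nn_cond_exp M (sigma_of M S X) W \<omega> = f (X \<omega>))"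

definition cond_indep_given ::
  "'a measure \<Rightarrow> 'b measure \<Rightarrow> ('a \<Rightarrow> 'b) \<Rightarrow> ('a \<Rightarrow> real) \<Rightarrow> ('a \<Rightarrow> real) \<Rightarrow> bool" where
  "cond_indep_given M S X U W \<longleftrightarrow>
     (\<forall>A\<in>sets borel. \<forall>B\<in>sets borel. AE \<omega> in M.
        real_cond_exp M (sigma_of M S X) (\<lambda>\<omega>. indicator A (U \<omega>) * indicator B (W \<omega>)) \<omega> =
        real_cond_exp M (sigma_of M S X) (\<lambda>\<omega>. indicator A (U \<omega>)) \<omega> *
        real_cond_exp M (sigma_of M S X) (\<lambda>\<omega>. indicator B (W \<omega>)) \<omega>)"


section \<open>Moments\<close>

definition covariance :: "'a measure \<Rightarrow> ('a \<Rightarrow> real) \<Rightarrow> ('a \<Rightarrow> real) \<Rightarrow> real" where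
  "covariance M U W = (\<integral>\<omega>. (U \<omega> - (\<integral>\<omega>. U \<omega> \<partial>M)) * (W \<omega> - (\<integral>\<omega>. W \<omega> \<partial>M)) \<partial>M)"

definition pos_def_variance :: "'a measure \<Rightarrow> nat \<Rightarrow> ('a \<Rightarrow> covariate) \<Rightarrow> bool" where
  "pos_def_variance M p X \<longleftrightarrow>
     (\<forall>v :: nat \<Rightarrow> real. (\<exists>j<p. v j \<noteq> 0) \<longrightarrow>
        0 < (\<Sum>j<p. \<Sum>l<p. v j * covariance M (\<lambda>\<omega>. X \<omega> j) (\<lambda>\<omega>. X \<omega> l) * v l))"

definition Lr_norm :: "real \<Rightarrow> 'a measure \<Rightarrow> ('a \<Rightarrow> real) \<Rightarrow> ennreal" where
  "Lr_norm r M f =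
     (let I = (\<integral>\<^sup>+x. ennreal (\<bar>f x\<bar> powr r) \<partial>M)
      in if I = \<infinity> then \<infinity> else ennreal (enn2real I powr (1 / r)))"

text \<open>
  The parameters \<open>s1\<close>, \<open>s2\<close> are standard deviations.  Square integrability of \<open>Y\<close> itself is the
  finiteness implicit in a bound on \<open>Var(Y)\<close>.
\<close>

definition basic_assumption ::
  "'a measure \<Rightarrow> nat \<Rightarrow> ('a \<Rightarrow> real) \<Rightarrow> ('a \<Rightarrow> real) \<Rightarrow> ('a \<Rightarrow> covariate) \<Rightarrow>
   (covariate \<Rightarrow> real) \<Rightarrow> (covariate \<Rightarrow> real) \<Rightarrow> real \<Rightarrow> real \<Rightarrow> bool" where
  "basic_assumption M p R Y X m \<mu> s1 s2 \<longleftrightarrow>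
     (let S = covariate_space p; PX = distr M S X in
       integrable M (\<lambda>\<omega>. (R \<omega>)\<^sup>2) \<and> integrable M (\<lambda>\<omega>. (R \<omega> * Y \<omega>)\<^sup>2) \<and>
       (\<forall>j<p. integrable M (\<lambda>\<omega>. (X \<omega> j)\<^sup>2)) \<and>
       pos_def_variance M p X \<and>
       (\<exists>v. nn_cond_exp_version M S X (\<lambda>\<omega>. ennreal ((Y \<omega> - m (X \<omega>))\<^sup>2)) v \<and>
            (\<forall>x\<in>covariate_support p PX. ennreal (s1\<^sup>2) \<le> v x)) \<and>
       (\<exists>v. nn_cond_exp_version M S X (\<lambda>\<omega>. ennreal ((Y \<omega> - \<mu> (X \<omega>))\<^sup>2)) v \<and>
            (\<forall>x\<in>covariate_support p PX. v x \<le> ennreal (s2\<^sup>2))) \<and>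
       integrable M (\<lambda>\<omega>. (Y \<omega>)\<^sup>2) \<and> prob_space.variance M Y \<le> s2\<^sup>2)"


section \<open>Stochastic order and order of magnitude\<close>

definition Op :: "(nat \<Rightarrow> 'w measure) \<Rightarrow> (nat \<Rightarrow> 'w \<Rightarrow> real) \<Rightarrow> (nat \<Rightarrow> real) \<Rightarrow> bool" where
  "Op P V b \<longleftrightarrow>
     (\<forall>\<epsilon>>0. \<exists>C>0. \<forall>\<^sub>F N in sequentially. \<P>(\<omega> in P N. \<bar>V N \<omega>\<bar> > C * b N) < \<epsilon>)"

definition Op_nn :: "(nat \<Rightarrow> 'w measure) \<Rightarrow> (nat \<Rightarrow> 'w \<Rightarrow> ennreal) \<Rightarrow> (nat \<Rightarrow> real) \<Rightarrow> bool" where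
  "Op_nn P V b \<longleftrightarrow>
     (\<forall>\<epsilon>>0. \<exists>C>0. \<forall>\<^sub>F N in sequentially. \<P>(\<omega> in P N. V N \<omega> > ennreal (C * b N)) < \<epsilon>)"

definition same_order :: "(nat \<Rightarrow> real) \<Rightarrow> (nat \<Rightarrow> real) \<Rightarrow> bool" where
  "same_order u v \<longleftrightarrow>
     (\<exists>c>0. \<exists>C>0. \<forall>\<^sub>F N in sequentially. c * v N < u N \<and> u N < C * v N)"


section \<open>Cross-fitting and the doubly robust score\<close>

text \<open>
  A fold assignment \<open>g\<close> encodes the partition with blocks \<open>I_k = {i \<in> {1..N}. g i \<omega> = k}\<close>.  A fitted
  function depends only on the training sample, i.e. on the family \<open>(Z_i)\<close> restricted to
  the indices outside \<open>I_k\<close>.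
\<close>

definition training_indices :: "nat \<Rightarrow> (nat \<Rightarrow> 'w \<Rightarrow> nat) \<Rightarrow> nat \<Rightarrow> 'w \<Rightarrow> nat set" where
  "training_indices N g k \<omega> = {i \<in> {1..N}. g i \<omega> \<noteq> k}"

definition fold_fit ::
  "nat \<Rightarrow> (nat \<Rightarrow> 'w \<Rightarrow> nat) \<Rightarrow> (nat \<Rightarrow> 'w \<Rightarrow> observation) \<Rightarrow> estimator \<Rightarrow>
   nat \<Rightarrow> 'w \<Rightarrow> covariate \<Rightarrow> real" where
  "fold_fit N g Z est k \<omega> =
     est (training_indices N g k \<omega>) (restrict (\<lambda>i. Z i \<omega>) (training_indices N g k \<omega>))"

definition measurable_estimator :: "nat \<Rightarrow> nat \<Rightarrow> estimator \<Rightarrow> bool" where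
  "measurable_estimator N p est \<longleftrightarrow>
     (\<forall>J\<subseteq>{1..N}. (\<lambda>(z, x). est J z x) \<in>
        borel_measurable (Pi\<^sub>M J (\<lambda>_. observation_space p) \<Otimes>\<^sub>M covariate_space p))"

definition iid_sample ::
  "'w measure \<Rightarrow> nat \<Rightarrow> 'a measure \<Rightarrow> (nat \<Rightarrow> 'w \<Rightarrow> 'a) \<Rightarrow> 'a measure \<Rightarrow> bool" where
  "iid_sample P N S Z L \<longleftrightarrow>
     prob_space.indep_vars P (\<lambda>_. S) Z {1..N} \<and> (\<forall>i\<in>{1..N}. distr P S (Z i) = L)"

text \<open>
  The library's \<open>indep_var\<close> needs both variables to take values in the same type, so independence
  of the sample and the fold assignment is stated for the generated sigma-algebras.
\<close>

definition independent_folds ::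
  "'w measure \<Rightarrow> nat \<Rightarrow> nat \<Rightarrow> 'a measure \<Rightarrow> (nat \<Rightarrow> 'w \<Rightarrow> 'a) \<Rightarrow> (nat \<Rightarrow> 'w \<Rightarrow> nat) \<Rightarrow> bool" where
  "independent_folds P N K S Z g \<longleftrightarrow>
     (\<forall>i\<in>{1..N}. g i \<in> P \<rightarrow>\<^sub>M count_space {1..K}) \<and>
     prob_space.indep_set P
       (sets (sigma_of P (Pi\<^sub>M {1..N} (\<lambda>_. S)) (\<lambda>\<omega>. \<lambda>i\<in>{1..N}. Z i \<omega>)))
       (sets (sigma_of P (Pi\<^sub>M {1..N} (\<lambda>_. count_space {1..K})) (\<lambda>\<omega>. \<lambda>i\<in>{1..N}. g i \<omega>)))"

definition dr_score ::
  "(covariate \<Rightarrow> real) \<Rightarrow> (covariate \<Rightarrow> real) \<Rightarrow> real \<Rightarrow> real \<Rightarrow> real \<Rightarrow> covariate \<Rightarrow> real" where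
  "dr_score \<mu> e \<theta> r y x = \<mu> x + r / e x * (y - \<mu> x) - \<theta>"

end

theory Submission
  imports Defs
begin

text \<open>
  With \<open>f = mhat - \<mu>\<close>, each summand of \<open>\<theta>hat - \<theta>0 - \<psi>mean - \<Delta>\<close> equals, as soon as one of the two limits
  is correct,
  \<open>(1 - R / \<pi>) f(X) + (1 / pihat - 1 / e) R (Y - m(X)) - (R / pihat - R / e) f(X)\<close>.
  Given the training data of a fold, the first two terms are centred (the first by definition of
  \<open>\<pi>\<close>, the second by ignorability and the definition of \<open>m\<close>), and their conditional second
  moments are at most constants times \<open>c\<mu>\<^sup>2 / a\<close> and \<open>ce\<^sup>2 / a\<close>; the third has conditional first moment of
  order \<open>r\<mu> re\<close> by the Cauchy--Schwarz inequality.  A conditional Markov inequality turns these bounds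
  into stochastic orders.  The mean of the scores has variance of order \<open>1 / (N a)\<close>, and \<open>\<Delta>\<close> is bounded
  in conditional mean by Cauchy--Schwarz.  Asymptotic normality is Lindeberg's theorem for the scores,
  transferred to the estimator because the scaled remainder vanishes in probability.
\<close>

section \<open>Stochastic order\<close>

text \<open>The rates bound the errors of the fitted functions only in probability, and these errors
  may have no finite mean over the training data, so a remainder cannot simply be integrated. Each
  remainder is therefore split on the event that the training error is small, and Markov's
  inequality is applied with the training data frozen. Freezing is done without conditional
  expectations: the fold map is independent of the data and has finitely many values, and for a
  fixed fold map the sample is a point of a product space, where Fubini's theorem separates training
  from held-out coordinates. The scale \<open>a\<close> comes from one computation. Ignorability
  allows \<open>R\<close> to be replaced by \<open>\<pi>(X)\<close> under the integral against any
  function of \<open>(Y, X)\<close>, so a squared inverse weight \<open>R / \<pi>\<^sup>2\<close>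
  costs \<open>1 / \<pi>\<close>, whose mean is \<open>1 / a\<close>; hence the weight
  \<open>a / \<pi>\<close> in the rates \<open>c\<mu>\<close> and \<open>ce\<close>. In the product
  term the inverse weight occurs only once and cancels, which leaves the unweighted rates
  \<open>r\<mu>\<close> and \<open>re\<close>. Which of the two limits is correct may change with
  \<open>N\<close>.\<close>

locale prob_seq =
  fixes P :: "nat \<Rightarrow> 'w measure"
  assumes prob_P: "\<And>N. prob_space (P N)"
begin

text \<open>Turns almost sure identities, such as the decomposition of the estimator, into
  stochastic orders; failure on null sets or at finitely many \<open>N\<close> is harmless.\<close>

lemma Op_AE_le:
  assumes "Op P V' b" and [measurable]: "\<And>N. V' N \<in> borel_measurable (P N)"
    and le: "\<forall>\<^sub>F N in sequentially. AE \<omega> in P N. \<bar>V N \<omega>\<bar> \<le> \<bar>V' N \<omega>\<bar>"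
  shows "Op P V b"
  unfolding Op_def
proof (intro allI impI)
  fix \<epsilon> :: real assume "\<epsilon> > 0"
  then obtain C where C: "C > 0"
    "\<forall>\<^sub>F N in sequentially. \<P>(\<omega> in P N. \<bar>V' N \<omega>\<bar> > C * b N) < \<epsilon>"
    using assms(1) unfolding Op_def by blast
  from C(2) le have "\<forall>\<^sub>F N in sequentially. \<P>(\<omega> in P N. \<bar>V N \<omega>\<bar> > C * b N) < \<epsilon>"
  proof eventually_elim
    case (elim N)
    interpret prob_space "P N" by (rule prob_P)
    have "\<P>(\<omega> in P N. \<bar>V N \<omega>\<bar> > C * b N) \<le> \<P>(\<omega> in P N. \<bar>V' N \<omega>\<bar> > C * b N)"
      by (rule finite_measure_mono_AE) (use elim in auto)
    with elim show ?case by simp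
  qed
  with C(1) show "\<exists>C>0. \<forall>\<^sub>F N in sequentially. \<P>(\<omega> in P N. \<bar>V N \<omega>\<bar> > C * b N) < \<epsilon>" by blast
qed

lemma Op_rate_mono:
  assumes "Op P V b" and [measurable]: "\<And>N. V N \<in> borel_measurable (P N)"
    and le: "\<forall>\<^sub>F N in sequentially. b N \<le> \<kappa> * b' N" and "\<kappa> > 0"
  shows "Op P V b'"
  unfolding Op_def
proof (intro allI impI)
  fix \<epsilon> :: real assume "\<epsilon> > 0"
  then obtain C where C: "C > 0"
    "\<forall>\<^sub>F N in sequentially. \<P>(\<omega> in P N. \<bar>V N \<omega>\<bar> > C * b N) < \<epsilon>"
    using assms(1) unfolding Op_def by blast
  from C(2) le have "\<forall>\<^sub>F N in sequentially. \<P>(\<omega> in P N. \<bar>V N \<omega>\<bar> > (C * \<kappa>) * b' N) < \<epsilon>"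
  proof eventually_elim
    case (elim N)
    interpret prob_space "P N" by (rule prob_P)
    have *: "C * b N \<le> (C * \<kappa>) * b' N"
      using mult_left_mono[OF elim(2), of C] C(1) by (simp add: mult.assoc)
    have "\<P>(\<omega> in P N. \<bar>V N \<omega>\<bar> > (C * \<kappa>) * b' N) \<le> \<P>(\<omega> in P N. \<bar>V N \<omega>\<bar> > C * b N)"
      by (rule finite_measure_mono) (use * in auto)
    with elim show ?case by simp
  qed
  with C(1) \<open>\<kappa> > 0\<close>
  show "\<exists>C>0. \<forall>\<^sub>F N in sequentially. \<P>(\<omega> in P N. \<bar>V N \<omega>\<bar> > C * b' N) < \<epsilon>"
    by (intro exI[of _ "C * \<kappa>"]) auto
qed

lemma Op_add:
  assumes "Op P V b" "Op P V' b'"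
    and [measurable]: "\<And>N. V N \<in> borel_measurable (P N)" "\<And>N. V' N \<in> borel_measurable (P N)"
    and nn: "\<And>N. 0 \<le> b N" "\<And>N. 0 \<le> b' N"
  shows "Op P (\<lambda>N \<omega>. V N \<omega> + V' N \<omega>) (\<lambda>N. b N + b' N)"
  unfolding Op_def
proof (intro allI impI)
  fix \<epsilon> :: real assume "\<epsilon> > 0"
  then have "\<epsilon> / 2 > 0" by simp
  then obtain C C' where C: "C > 0"
    "\<forall>\<^sub>F N in sequentially. \<P>(\<omega> in P N. \<bar>V N \<omega>\<bar> > C * b N) < \<epsilon> / 2" and C': "C' > 0"
    "\<forall>\<^sub>F N in sequentially. \<P>(\<omega> in P N. \<bar>V' N \<omega>\<bar> > C' * b' N) < \<epsilon> / 2"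
    using assms(1,2) unfolding Op_def by meson
  define D where "D = max C C'"
  from C(2) C'(2)
  have "\<forall>\<^sub>F N in sequentially. \<P>(\<omega> in P N. \<bar>V N \<omega> + V' N \<omega>\<bar> > D * (b N + b' N)) < \<epsilon>"
  proof eventually_elim
    case (elim N)
    interpret prob_space "P N" by (rule prob_P)
    have 1: "C * b N \<le> D * b N" "C' * b' N \<le> D * b' N"
      unfolding D_def by (auto intro!: mult_right_mono nn)
    have "\<P>(\<omega> in P N. \<bar>V N \<omega> + V' N \<omega>\<bar> > D * (b N + b' N))
        \<le> prob ({\<omega>\<in>space (P N). \<bar>V N \<omega>\<bar> > C * b N} \<union> {\<omega>\<in>space (P N). \<bar>V' N \<omega>\<bar> > C' * b' N})"
      by (rule finite_measure_mono) (use 1 in \<open>auto simp: distrib_left\<close>)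
    also have "\<dots> \<le> \<P>(\<omega> in P N. \<bar>V N \<omega>\<bar> > C * b N) + \<P>(\<omega> in P N. \<bar>V' N \<omega>\<bar> > C' * b' N)"
      by (rule measure_Un_le) auto
    finally show ?case using elim by simp
  qed
  moreover have "D > 0" using C(1) by (simp add: D_def)
  ultimately show "\<exists>C>0. \<forall>\<^sub>F N in sequentially.
      \<P>(\<omega> in P N. \<bar>V N \<omega> + V' N \<omega>\<bar> > C * (b N + b' N)) < \<epsilon>" by blast
qed

lemma Op_uminus: "Op P V b \<Longrightarrow> Op P (\<lambda>N \<omega>. - V N \<omega>) b"
  by (simp add: Op_def)

lemma Op_diff:
  assumes "Op P V b" "Op P V' b'"
    and [measurable]: "\<And>N. V N \<in> borel_measurable (P N)" "\<And>N. V' N \<in> borel_measurable (P N)"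
    and "\<And>N. 0 \<le> b N" "\<And>N. 0 \<le> b' N"
  shows "Op P (\<lambda>N \<omega>. V N \<omega> - V' N \<omega>) (\<lambda>N. b N + b' N)"
  using Op_add[OF assms(1) Op_uminus[OF assms(2)]] assms by simp

lemma Op_sum:
  assumes "finite A" "\<And>k. k \<in> A \<Longrightarrow> Op P (V k) b"
    and [measurable]: "\<And>k N. k \<in> A \<Longrightarrow> V k N \<in> borel_measurable (P N)"
    and nn: "\<And>N. 0 \<le> b N"
  shows "Op P (\<lambda>N \<omega>. \<Sum>k\<in>A. V k N \<omega>) b"
proof -
  \<comment> \<open>The induction adds one \<open>b\<close> per summand. The extra 1 keeps the
    factor positive for an empty \<open>A\<close>, as the final change of rate requires.\<close>
  have "Op P (\<lambda>N \<omega>. \<Sum>k\<in>A. V k N \<omega>) (\<lambda>N. (1 + real (card A)) * b N)"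
    using assms(1,2,3)
  proof (induction A)
    case empty
    have "\<not> b N < 0" for N using nn[of N] by simp
    then show ?case unfolding Op_def by (auto intro!: exI[of _ 1])
  next
    case (insert k A)
    have "Op P (\<lambda>N \<omega>. V k N \<omega> + (\<Sum>k\<in>A. V k N \<omega>)) (\<lambda>N. b N + (1 + real (card A)) * b N)"
      using insert by (intro Op_add) (auto simp: nn)
    then show ?case using insert by (simp add: algebra_simps)
  qed
  then show ?thesis
    by (rule Op_rate_mono[where \<kappa> = "1 + real (card A)"]) (use assms(3) in auto)
qed

lemma Op_scale:
  assumes "Op P V b" and s: "\<And>N. 0 \<le> s N"
    and [measurable]: "\<And>N. V N \<in> borel_measurable (P N)"
  shows "Op P (\<lambda>N \<omega>. s N * V N \<omega>) (\<lambda>N. s N * b N)"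
  unfolding Op_def
proof (intro allI impI)
  fix \<epsilon> :: real assume "\<epsilon> > 0"
  then obtain C where C: "C > 0"
    "\<forall>\<^sub>F N in sequentially. \<P>(\<omega> in P N. \<bar>V N \<omega>\<bar> > C * b N) < \<epsilon>"
    using assms(1) unfolding Op_def by blast
  from C(2) have "\<forall>\<^sub>F N in sequentially. \<P>(\<omega> in P N. \<bar>s N * V N \<omega>\<bar> > C * (s N * b N)) < \<epsilon>"
  proof eventually_elim
    case (elim N)
    interpret prob_space "P N" by (rule prob_P)
    have "C * b N < \<bar>v\<bar>" if "C * (s N * b N) < \<bar>s N * v\<bar>" for v
    \<comment> \<open>Contraposition avoids dividing by \<open>s N\<close>, which may vanish, as
      \<open>sqrt (real N * a N)\<close> does at \<open>N = 0\<close>.\<close>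
    proof (rule ccontr)
      assume "\<not> ?thesis"
      then have "s N * \<bar>v\<bar> \<le> s N * (C * b N)" using s by (intro mult_left_mono) auto
      with that s[of N] show False by (simp add: abs_mult mult.left_commute)
    qed
    then have "\<P>(\<omega> in P N. \<bar>s N * V N \<omega>\<bar> > C * (s N * b N)) \<le> \<P>(\<omega> in P N. \<bar>V N \<omega>\<bar> > C * b N)"
      by (intro finite_measure_mono) auto
    with elim show ?case by simp
  qed
  with C(1) show "\<exists>C>0. \<forall>\<^sub>F N in sequentially. \<P>(\<omega> in P N. \<bar>s N * V N \<omega>\<bar> > C * (s N * b N)) < \<epsilon>"
    by blast
qed

text \<open>The constant \<open>C\<close> depends on \<epsilon> alone, so \<open>C * b N\<close>
  eventually drops below any fixed \<delta>.\<close>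

lemma Op_null_rate_tendsto:
  assumes "Op P V b" and [measurable]: "\<And>N. V N \<in> borel_measurable (P N)"
    and b: "b \<longlonglongrightarrow> 0" and \<delta>: "\<delta> > 0"
  shows "(\<lambda>N. \<P>(\<omega> in P N. \<bar>V N \<omega>\<bar> > \<delta>)) \<longlonglongrightarrow> 0"
proof (rule order_tendstoI)
  fix y :: real assume "y < 0"
  then show "\<forall>\<^sub>F N in sequentially. y < \<P>(\<omega> in P N. \<bar>V N \<omega>\<bar> > \<delta>)"
    by (simp add: order.strict_trans2)
next
  fix \<epsilon> :: real assume "0 < \<epsilon>"
  then obtain C where C: "C > 0"
    "\<forall>\<^sub>F N in sequentially. \<P>(\<omega> in P N. \<bar>V N \<omega>\<bar> > C * b N) < \<epsilon>"
    using assms(1) unfolding Op_def by blast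
  have "(\<lambda>N. C * b N) \<longlonglongrightarrow> 0" using b by (rule tendsto_mult_right_zero)
  then have "\<forall>\<^sub>F N in sequentially. C * b N < \<delta>" using \<delta> by (rule order_tendstoD)
  with C(2) show "\<forall>\<^sub>F N in sequentially. \<P>(\<omega> in P N. \<bar>V N \<omega>\<bar> > \<delta>) < \<epsilon>"
  proof eventually_elim
    case (elim N)
    interpret prob_space "P N" by (rule prob_P)
    have "\<P>(\<omega> in P N. \<bar>V N \<omega>\<bar> > \<delta>) \<le> \<P>(\<omega> in P N. \<bar>V N \<omega>\<bar> > C * b N)"
      by (rule finite_measure_mono) (use elim in auto)
    with elim show ?case by simp
  qed
qed

section \<open>Stochastic order of extended nonnegative errors\<close>

lemma Op_nn_const:
  assumes "\<And>N \<omega>. V N \<omega> \<le> ennreal (\<kappa> * b N)" "\<kappa> > 0"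
  shows "Op_nn P V b"
proof -
  have "\<not> ennreal (\<kappa> * b N) < V N \<omega>" for N \<omega> using assms(1)[of N \<omega>] by (simp add: not_less)
  then show ?thesis unfolding Op_nn_def using assms(2) by (auto intro!: exI[of _ \<kappa>])
qed

lemma Op_nn_add:
  assumes "Op_nn P V b" "Op_nn P V' b'"
    and [measurable]: "\<And>N. V N \<in> borel_measurable (P N)" "\<And>N. V' N \<in> borel_measurable (P N)"
    and nn: "\<And>N. 0 \<le> b N" "\<And>N. 0 \<le> b' N"
  shows "Op_nn P (\<lambda>N \<omega>. V N \<omega> + V' N \<omega>) (\<lambda>N. b N + b' N)"
  unfolding Op_nn_def
proof (intro allI impI)
  fix \<epsilon> :: real assume "\<epsilon> > 0"
  then have "\<epsilon> / 2 > 0" by simp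
  then obtain C C' where C: "C > 0"
    "\<forall>\<^sub>F N in sequentially. \<P>(\<omega> in P N. V N \<omega> > ennreal (C * b N)) < \<epsilon> / 2" and C': "C' > 0"
    "\<forall>\<^sub>F N in sequentially. \<P>(\<omega> in P N. V' N \<omega> > ennreal (C' * b' N)) < \<epsilon> / 2"
    using assms(1,2) unfolding Op_nn_def by meson
  define D where "D = max C C'"
  have D: "D > 0" using C(1) by (simp add: D_def)
  from C(2) C'(2)
  have "\<forall>\<^sub>F N in sequentially. \<P>(\<omega> in P N. V N \<omega> + V' N \<omega> > ennreal (D * (b N + b' N))) < \<epsilon>"
  proof eventually_elim
    case (elim N)
    interpret prob_space "P N" by (rule prob_P)
    have 1: "C * b N \<le> D * b N" "C' * b' N \<le> D * b' N"
      unfolding D_def by (auto intro!: mult_right_mono nn)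
    have "v + v' \<le> ennreal (D * (b N + b' N))"
      if "v \<le> ennreal (C * b N)" "v' \<le> ennreal (C' * b' N)" for v v'
    proof -
      have "v + v' \<le> ennreal (D * b N) + ennreal (D * b' N)"
        using that 1 by (intro add_mono) (auto intro: order_trans ennreal_leI)
      also have "\<dots> = ennreal (D * (b N + b' N))"
        using D nn by (simp add: distrib_left flip: ennreal_plus)
      finally show ?thesis .
    qed
    then have "\<P>(\<omega> in P N. V N \<omega> + V' N \<omega> > ennreal (D * (b N + b' N)))
        \<le> prob ({\<omega>\<in>space (P N). V N \<omega> > ennreal (C * b N)} \<union>
                 {\<omega>\<in>space (P N). V' N \<omega> > ennreal (C' * b' N)})"
      by (intro finite_measure_mono) (auto simp: not_less[symmetric])
    also have "\<dots> \<le> \<P>(\<omega> in P N. V N \<omega> > ennreal (C * b N)) + \<P>(\<omega> in P N. V' N \<omega> > ennreal (C' * b' N))"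
      by (rule measure_Un_le) auto
    finally show ?case using elim by simp
  qed
  with D show "\<exists>C>0. \<forall>\<^sub>F N in sequentially.
      \<P>(\<omega> in P N. V N \<omega> + V' N \<omega> > ennreal (C * (b N + b' N))) < \<epsilon>" by blast
qed

lemma Op_nn_scale:
  assumes "Op_nn P V b" and s: "\<And>N. 0 \<le> s N" and b: "\<And>N. 0 \<le> b N"
    and [measurable]: "\<And>N. V N \<in> borel_measurable (P N)"
  shows "Op_nn P (\<lambda>N \<omega>. ennreal (s N) * V N \<omega>) (\<lambda>N. s N * b N)"
  unfolding Op_nn_def
proof (intro allI impI)
  fix \<epsilon> :: real assume "\<epsilon> > 0"
  then obtain C where C: "C > 0"
    "\<forall>\<^sub>F N in sequentially. \<P>(\<omega> in P N. V N \<omega> > ennreal (C * b N)) < \<epsilon>"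
    using assms(1) unfolding Op_nn_def by blast
  from C(2)
  have "\<forall>\<^sub>F N in sequentially. \<P>(\<omega> in P N. ennreal (s N) * V N \<omega> > ennreal (C * (s N * b N))) < \<epsilon>"
  proof eventually_elim
    case (elim N)
    interpret prob_space "P N" by (rule prob_P)
    have "ennreal (s N) * v \<le> ennreal (C * (s N * b N))" if "v \<le> ennreal (C * b N)" for v
    proof -
      have "ennreal (s N) * v \<le> ennreal (s N) * ennreal (C * b N)"
        using that by (rule mult_left_mono) simp
      also have "\<dots> = ennreal (C * (s N * b N))"
        using s b C(1) by (simp add: ac_simps flip: ennreal_mult)
      finally show ?thesis .
    qed
    then have "\<P>(\<omega> in P N. ennreal (s N) * V N \<omega> > ennreal (C * (s N * b N)))
        \<le> \<P>(\<omega> in P N. V N \<omega> > ennreal (C * b N))"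
      by (intro finite_measure_mono) (auto simp: not_less[symmetric])
    with elim show ?case by simp
  qed
  with C(1) show "\<exists>C>0. \<forall>\<^sub>F N in sequentially.
      \<P>(\<omega> in P N. ennreal (s N) * V N \<omega> > ennreal (C * (s N * b N))) < \<epsilon>" by blast
qed

text \<open>The inequality for \<open>W\<close> holds at every outcome, so it is used on the
  intersection of two likely events and nothing is integrated over the training data. With one
  constant \<open>D\<close> for both factors the bound is the perfect square of
  \<open>D * (b N * b' N)\<close>.\<close>

lemma Op_nn_Cauchy_Schwarz:
  assumes "Op_nn P V (\<lambda>N. (b N)\<^sup>2)" "Op_nn P V' (\<lambda>N. (b' N)\<^sup>2)"
    and [measurable]: "\<And>N. V N \<in> borel_measurable (P N)" "\<And>N. V' N \<in> borel_measurable (P N)"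
    and nn: "\<And>N. 0 \<le> b N" "\<And>N. 0 \<le> b' N"
    and le: "\<And>N \<omega>. \<omega> \<in> space (P N) \<Longrightarrow> (W N \<omega>)\<^sup>2 \<le> V N \<omega> * V' N \<omega>"
  shows "Op_nn P W (\<lambda>N. b N * b' N)"
  unfolding Op_nn_def
proof (intro allI impI)
  fix \<epsilon> :: real assume "\<epsilon> > 0"
  then have "\<epsilon> / 2 > 0" by simp
  then obtain C C' where C: "C > 0"
    "\<forall>\<^sub>F N in sequentially. \<P>(\<omega> in P N. V N \<omega> > ennreal (C * (b N)\<^sup>2)) < \<epsilon> / 2" and C': "C' > 0"
    "\<forall>\<^sub>F N in sequentially. \<P>(\<omega> in P N. V' N \<omega> > ennreal (C' * (b' N)\<^sup>2)) < \<epsilon> / 2"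
    using assms(1,2) unfolding Op_nn_def by meson
  define D where "D = max C C'"
  have D: "D > 0" using C(1) by (simp add: D_def)
  from C(2) C'(2)
  have "\<forall>\<^sub>F N in sequentially. \<P>(\<omega> in P N. W N \<omega> > ennreal (D * (b N * b' N))) < \<epsilon>"
  proof eventually_elim
    case (elim N)
    interpret prob_space "P N" by (rule prob_P)
    have 1: "C * (b N)\<^sup>2 \<le> D * (b N)\<^sup>2" "C' * (b' N)\<^sup>2 \<le> D * (b' N)\<^sup>2"
      unfolding D_def by (auto intro!: mult_right_mono nn)
    have "w \<le> ennreal (D * (b N * b' N))"
      if "v \<le> ennreal (C * (b N)\<^sup>2)" "v' \<le> ennreal (C' * (b' N)\<^sup>2)" "w\<^sup>2 \<le> v * v'" for v v' w
    proof (rule ccontr)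
      assume "\<not> w \<le> ennreal (D * (b N * b' N))"
      then have w: "ennreal (D * (b N * b' N)) < w" by simp
      \<comment> \<open>\<open>w\<close> may be infinite. A finite \<open>y\<close> strictly above
        the bound and not above \<open>w\<close> moves the comparison of squares into the
        reals.\<close>
      then obtain y where y: "ennreal (D * (b N * b' N)) < ennreal y" "ennreal y \<le> w" "0 \<le> y"
      proof (cases w)
        case (real r)
        then show ?thesis using that w by auto
      next
        case top
        have "0 \<le> D * (b N * b' N)" using D nn by simp
        then show ?thesis using that[of "D * (b N * b' N) + 1"] top
          by (simp add: ennreal_less_iff)
      qed
      have *: "0 \<le> D * (b N * b' N)" using D nn by simp
      have "ennreal (y\<^sup>2) \<le> w\<^sup>2"
        using y(2,3) by (simp add: ennreal_power[symmetric] power_mono)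
      also have "\<dots> \<le> ennreal (D * (b N)\<^sup>2) * ennreal (D * (b' N)\<^sup>2)"
        using that 1 by (intro order_trans[OF that(3)] mult_mono) (auto intro: order_trans ennreal_leI)
      also have "\<dots> = ennreal ((D * (b N * b' N))\<^sup>2)"
        using D nn by (simp add: power_mult_distrib power2_eq_square ac_simps flip: ennreal_mult)
      finally have "y\<^sup>2 \<le> (D * (b N * b' N))\<^sup>2" by (simp add: ennreal_le_iff)
      then have "y \<le> D * (b N * b' N)" using * by (rule power2_le_imp_le)
      then show False using y(1,3) * by (simp add: ennreal_less_iff)
    qed
    then have "\<P>(\<omega> in P N. W N \<omega> > ennreal (D * (b N * b' N)))
        \<le> prob ({\<omega>\<in>space (P N). V N \<omega> > ennreal (C * (b N)\<^sup>2)} \<union>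
                 {\<omega>\<in>space (P N). V' N \<omega> > ennreal (C' * (b' N)\<^sup>2)})"
      using le[of _ N] by (intro finite_measure_mono) (auto simp: not_less[symmetric])
    also have "\<dots> \<le> \<P>(\<omega> in P N. V N \<omega> > ennreal (C * (b N)\<^sup>2)) +
        \<P>(\<omega> in P N. V' N \<omega> > ennreal (C' * (b' N)\<^sup>2))"
      by (rule measure_Un_le) auto
    finally show ?case using elim by simp
  qed
  with D show "\<exists>C>0. \<forall>\<^sub>F N in sequentially.
      \<P>(\<omega> in P N. W N \<omega> > ennreal (C * (b N * b' N))) < \<epsilon>" by blast
qed

end

section \<open>Characteristic functions and weak convergence\<close>

lemma cmod_iexp_diff_le: "cmod (iexp (t * x) - iexp (t * y)) \<le> \<bar>t\<bar> * \<bar>x - y\<bar>"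
proof -
  have "iexp (t * x) - iexp (t * y) = iexp (t * y) * (iexp (t * (x - y)) - 1)"
    by (simp add: algebra_simps flip: exp_add)
  then have "cmod (iexp (t * x) - iexp (t * y)) = cmod (iexp (t * (x - y)) - 1)"
    by (simp add: norm_mult)
  also have "\<dots> \<le> \<bar>t * (x - y)\<bar>"
    using iexp_approx1[of "t * (x - y)" 0] by simp
  finally show ?thesis by (simp add: abs_mult)
qed

text \<open>Slutsky's lemma by way of Levy's continuity theorem: \<open>iexp (t * x)\<close> is
  bounded by 1 and Lipschitz in \<open>x\<close> with constant \<bar>t\<bar>, so the two
  characteristic functions differ by at most \<bar>t\<bar> * \<delta> plus twice the probability
  that the variables are more than \<delta> apart. The hypothesis on \<open>V\<close> is stated for
  characteristic functions because that is the form in which the limit theorem below supplies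
  it.\<close>

lemma weak_conv_m_perturb:
  fixes P :: "nat \<Rightarrow> 'w measure"
  assumes P: "\<And>N. prob_space (P N)"
    and [measurable]: "\<And>N. V N \<in> borel_measurable (P N)" "\<And>N. W N \<in> borel_measurable (P N)"
    and lim: "real_distribution L" "\<And>t. (\<lambda>N. char (distr (P N) borel (V N)) t) \<longlonglongrightarrow> char L t"
    and small: "\<And>\<delta>. \<delta> > 0 \<Longrightarrow> (\<lambda>N. \<P>(\<omega> in P N. \<bar>W N \<omega> - V N \<omega>\<bar> > \<delta>)) \<longlonglongrightarrow> 0"
  shows "weak_conv_m (\<lambda>N. distr (P N) borel (W N)) L"
proof (rule levy_continuity)
  show "real_distribution (distr (P N) borel (W N))" for N
    by (rule prob_space.real_distribution_distr[OF P]) simp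
next
  fix t :: real
  have bound: "cmod (char (distr (P N) borel (W N)) t - char (distr (P N) borel (V N)) t)
      \<le> \<bar>t\<bar> * \<delta> + 2 * \<P>(\<omega> in P N. \<bar>W N \<omega> - V N \<omega>\<bar> > \<delta>)" if "\<delta> > 0" for N \<delta>
  proof -
    interpret prob_space "P N" by (rule P)
    have int: "integrable (P N) (\<lambda>\<omega>. iexp (t * V N \<omega>))" "integrable (P N) (\<lambda>\<omega>. iexp (t * W N \<omega>))"
      by (intro integrable_const_bound[where B = 1]; simp)+
    have "char (distr (P N) borel (W N)) t - char (distr (P N) borel (V N)) t
        = (\<integral>\<omega>. iexp (t * W N \<omega>) - iexp (t * V N \<omega>) \<partial>P N)"
      unfolding char_def using int by (simp add: integral_distr)
    also have "cmod \<dots> \<le> (\<integral>\<omega>. cmod (iexp (t * W N \<omega>) - iexp (t * V N \<omega>)) \<partial>P N)"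
      by (rule integral_norm_bound)
    also have "\<dots> \<le> (\<integral>\<omega>. \<bar>t\<bar> * \<delta> + 2 * indicator {\<omega>\<in>space (P N). \<bar>W N \<omega> - V N \<omega>\<bar> > \<delta>} \<omega> \<partial>P N)"
    proof (rule integral_mono)
      show "integrable (P N) (\<lambda>\<omega>. cmod (iexp (t * W N \<omega>) - iexp (t * V N \<omega>)))"
        using int by auto
      show "integrable (P N) (\<lambda>\<omega>. \<bar>t\<bar> * \<delta> + 2 * indicator {\<omega>\<in>space (P N). \<bar>W N \<omega> - V N \<omega>\<bar> > \<delta>} \<omega>)"
        by (auto intro!: integrable_real_indicator simp: emeasure_eq_measure)
      fix \<omega> assume \<omega>: "\<omega> \<in> space (P N)"
      show "cmod (iexp (t * W N \<omega>) - iexp (t * V N \<omega>))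
          \<le> \<bar>t\<bar> * \<delta> + 2 * indicator {\<omega>\<in>space (P N). \<bar>W N \<omega> - V N \<omega>\<bar> > \<delta>} \<omega>"
      proof (cases "\<bar>W N \<omega> - V N \<omega>\<bar> > \<delta>")
        case True
        have "cmod (iexp (t * W N \<omega>) - iexp (t * V N \<omega>))
            \<le> cmod (iexp (t * W N \<omega>)) + cmod (iexp (t * V N \<omega>))"
          by (rule norm_triangle_ineq4)
        then have "cmod (iexp (t * W N \<omega>) - iexp (t * V N \<omega>)) \<le> 2" by simp
        then show ?thesis using True \<omega> that by (simp add: add_increasing)
      next
        case False
        then have "\<bar>t\<bar> * \<bar>W N \<omega> - V N \<omega>\<bar> \<le> \<bar>t\<bar> * \<delta>" by (intro mult_left_mono) auto
        then show ?thesis using cmod_iexp_diff_le[of t "W N \<omega>" "V N \<omega>"] False by simp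
      qed
    qed
    also have "\<dots> = \<bar>t\<bar> * \<delta> + 2 * \<P>(\<omega> in P N. \<bar>W N \<omega> - V N \<omega>\<bar> > \<delta>)"
      by (subst Bochner_Integration.integral_add)
         (auto intro!: integrable_real_indicator simp: emeasure_eq_measure prob_space Int_def conj_commute)
    finally show ?thesis .
  qed
  have "(\<lambda>N. char (distr (P N) borel (W N)) t - char (distr (P N) borel (V N)) t) \<longlonglongrightarrow> 0"
  proof (rule tendstoI)
    fix r :: real assume r: "r > 0"
    \<comment> \<open>Makes \<bar>t\<bar> * \<delta> at most r / 2, the summand 1 covering t = 0.
      The probability, below r / 4 and counted twice, supplies the other half.\<close>
    define \<delta> where "\<delta> = r / (2 * (\<bar>t\<bar> + 1))"
    have \<delta>: "\<delta> > 0" using r by (simp add: \<delta>_def)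
    have t\<delta>: "\<bar>t\<bar> * \<delta> \<le> r / 2"
    proof -
      have "\<bar>t\<bar> * \<delta> \<le> (\<bar>t\<bar> + 1) * \<delta>" using \<delta> by simp
      also have "\<dots> = r / 2" by (simp add: \<delta>_def field_simps add_nonneg_pos)
      finally show ?thesis .
    qed
    have "\<forall>\<^sub>F N in sequentially. \<P>(\<omega> in P N. \<bar>W N \<omega> - V N \<omega>\<bar> > \<delta>) < r / 4"
      using small[OF \<delta>] r by (intro order_tendstoD) auto
    then show "\<forall>\<^sub>F N in sequentially.
        dist (char (distr (P N) borel (W N)) t - char (distr (P N) borel (V N)) t) 0 < r"
    proof eventually_elim
      case (elim N)
      then show ?case using bound[OF \<delta>, of N] t\<delta> by simp
    qed
  qed
  from tendsto_add[OF this lim(2)[of t]]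
  show "(\<lambda>N. char (distr (P N) borel (W N)) t) \<longlonglongrightarrow> char L t" by simp
qed (use lim(1) in auto)

text \<open>
  The characteristic function of a summand is compared with \<open>1 - t\<^sup>2 / (2 N)\<close>; the Lindeberg
  condition controls the error of the quadratic approximation.
\<close>

lemma char_row_iid_tendsto:
  fixes P :: "nat \<Rightarrow> 'w measure" and \<xi> :: "nat \<Rightarrow> nat \<Rightarrow> 'w \<Rightarrow> real" and \<nu> :: "nat \<Rightarrow> real measure"
  assumes P: "\<And>N. prob_space (P N)"
    and indep: "\<And>N. prob_space.indep_vars (P N) (\<lambda>_. borel) (\<xi> N) {1..N}"
    and distr: "\<And>N i. i \<in> {1..N} \<Longrightarrow> distr (P N) borel (\<xi> N i) = \<nu> N"
    and \<nu>: "\<And>N. real_distribution (\<nu> N)"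
    and sq: "\<And>N. integrable (\<nu> N) (\<lambda>x. x\<^sup>2)" and mean: "\<And>N. (\<integral>x. x \<partial>\<nu> N) = 0"
    and var: "\<And>N. V N = (\<integral>x. x\<^sup>2 \<partial>\<nu> N)" and V: "\<forall>\<^sub>F N in sequentially. V N > 0"
    and lind: "\<And>c. c > 0 \<Longrightarrow>
      (\<lambda>N. (1 / V N) * (\<integral>x. x\<^sup>2 * of_bool (\<bar>x\<bar> > c * sqrt (real N * V N)) \<partial>\<nu> N)) \<longlonglongrightarrow> 0"
  shows "(\<lambda>N. char (distr (P N) borel (\<lambda>\<omega>. (\<Sum>i=1..N. \<xi> N i \<omega>) / sqrt (real N * V N))) t)
           \<longlonglongrightarrow> char std_normal_distribution t"
proof -
  define \<phi> where "\<phi> N = char (distr (P N) borel (\<lambda>\<omega>. (\<Sum>i=1..N. \<xi> N i \<omega>) / sqrt (real N * V N))) t" for N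
  define s where "s N = sqrt (real N * V N)" for N
  \<comment> \<open>The remainder of \<open>char_approx3\<close> relative to the variance. The
    minimum allows the cubic bound for small \<open>x\<close> and the quadratic one for large
    \<open>x\<close>.\<close>
  define rem where "rem N = (1 / V N) * (\<integral>x. min (6 * x\<^sup>2) (\<bar>t / s N\<bar> * \<bar>x\<bar> ^ 3) \<partial>\<nu> N)" for N
  have main: "\<forall>\<^sub>F N in sequentially.
      cmod (\<phi> N - complex_of_real ((1 + (- (t\<^sup>2) / 2) / N) ^ N)) \<le> t\<^sup>2 / 6 * rem N"
    using V eventually_ge_at_top[of "nat \<lceil>t\<^sup>2 / 4\<rceil>"] eventually_gt_at_top[of 0]
  proof eventually_elim
    case (elim N)
    interpret prob_space "P N" by (rule P)
    interpret \<nu>: real_distribution "\<nu> N" by (rule \<nu>)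
    \<comment> \<open>Exactly the size of \<open>N\<close> for which 1 - t^2 / (2 N) is at least -1;
      the comparison of N-th powers needs both bases in the unit disc.\<close>
    have n: "t\<^sup>2 / 4 \<le> real N" using elim(2) by (subst nat_ceiling_le_eq [symmetric])
    have s: "s N > 0" "(s N)\<^sup>2 = N * V N" using elim by (auto simp: s_def)
    have rv[measurable]: "\<xi> N i \<in> borel_measurable (P N)" if "i \<in> {1..N}" for i
      using indep[of N] that unfolding indep_vars_def2 by simp
    have int1: "integrable (\<nu> N) (\<lambda>x. x)"
      by (rule \<nu>.square_integrable_imp_integrable[OF _ sq]) simp
    have "\<phi> N = char (distr (P N) borel (\<lambda>\<omega>. \<Sum>i=1..N. \<xi> N i \<omega> / s N)) t"
      by (simp add: \<phi>_def s_def sum_divide_distrib)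
    also have "\<dots> = (\<Prod>i=1..N. char (distr (P N) borel (\<lambda>\<omega>. \<xi> N i \<omega> / s N)) t)"
      by (rule char_distr_sum, rule indep_vars_compose2[OF indep]) auto
    also have "\<dots> = (\<Prod>i=1..N. char (\<nu> N) (t / s N))"
    proof (rule prod.cong[OF refl])
      fix i assume i: "i \<in> {1..N}"
      have "char (distr (P N) borel (\<lambda>\<omega>. \<xi> N i \<omega> / s N)) t = char (distr (P N) borel (\<xi> N i)) (t / s N)"
        using rv[OF i] by (simp add: char_def integral_distr)
      then show "char (distr (P N) borel (\<lambda>\<omega>. \<xi> N i \<omega> / s N)) t = char (\<nu> N) (t / s N)"
        using distr[OF i] by simp
    qed
    finally have \<phi>: "\<phi> N = (char (\<nu> N) (t / s N)) ^ N" by simp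
    have "cmod (char (\<nu> N) (t / s N) - (1 - (t / s N)\<^sup>2 * V N / 2))
        \<le> (t / s N)\<^sup>2 / 6 * (\<integral>x. min (6 * x\<^sup>2) (\<bar>t / s N\<bar> * \<bar>x\<bar> ^ 3) \<partial>\<nu> N)"
      by (rule \<nu>.char_approx3[OF int1 _ sq]) (auto simp: mean var)
    also have "(t / s N)\<^sup>2 * V N / 2 = t\<^sup>2 / 2 / N"
      using elim s by (simp add: power_divide)
    also have "(t / s N)\<^sup>2 / 6 * (\<integral>x. min (6 * x\<^sup>2) (\<bar>t / s N\<bar> * \<bar>x\<bar> ^ 3) \<partial>\<nu> N) = t\<^sup>2 / 6 * rem N / N"
      using s elim by (simp add: power_divide rem_def)
    finally have **: "cmod (char (\<nu> N) (t / s N) - complex_of_real (1 + (- (t\<^sup>2) / 2) / N)) \<le> t\<^sup>2 / 6 * rem N / N"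
      by simp
    have "cmod (\<phi> N - complex_of_real ((1 + (- (t\<^sup>2) / 2) / N) ^ N))
        = cmod ((char (\<nu> N) (t / s N)) ^ N - (complex_of_real (1 + (- (t\<^sup>2) / 2) / N)) ^ N)"
      by (simp add: \<phi> del: of_real_add)
    also have "\<dots> \<le> N * cmod (char (\<nu> N) (t / s N) - complex_of_real (1 + (- (t\<^sup>2) / 2) / N))"
    proof (rule norm_power_diff[OF \<nu>.cmod_char_le_1])
      have "\<bar>1 + (- (t\<^sup>2) / 2) / N\<bar> \<le> 1"
        using n elim by (intro abs_leI) (auto simp: divide_le_eq)
      then show "cmod (complex_of_real (1 + (- (t\<^sup>2) / 2) / N)) \<le> 1"
        by (simp only: norm_of_real)
    qed
    also have "\<dots> \<le> N * (t\<^sup>2 / 6 * rem N / N)"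
      by (rule mult_left_mono[OF **]) simp
    finally show ?case using elim by simp
  qed
  have "rem \<longlonglongrightarrow> 0"
  proof (rule tendstoI)
    fix r :: real assume r: "r > 0"
    \<comment> \<open>The truncation level relative to \<open>s N\<close>. Values below it
      contribute at most \<bar>t\<bar> * c, hence at most r / 2, and values above it 6 times
      something below r / 24, so \<open>rem N\<close> stays below \<open>r\<close>.\<close>
    define c where "c = r / (2 * (\<bar>t\<bar> + 1))"
    have c: "c > 0" using r by (simp add: c_def)
    have tc: "\<bar>t\<bar> * c < r / 2 + r / 4"
    proof -
      have "\<bar>t\<bar> * c \<le> (\<bar>t\<bar> + 1) * c" using c by simp
      also have "\<dots> = r / 2" by (simp add: c_def field_simps add_nonneg_pos)
      finally show ?thesis using r by simp
    qed
    have "\<forall>\<^sub>F N in sequentially.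
        (1 / V N) * (\<integral>x. x\<^sup>2 * of_bool (\<bar>x\<bar> > c * sqrt (real N * V N)) \<partial>\<nu> N) < r / 24"
      using lind[OF c] r by (intro order_tendstoD) auto
    then show "\<forall>\<^sub>F N in sequentially. dist (rem N) 0 < r"
      using V eventually_gt_at_top[of 0]
    proof eventually_elim
      case (elim N)
      interpret \<nu>: real_distribution "\<nu> N" by (rule \<nu>)
      have s: "s N > 0" using elim by (auto simp: s_def)
      let ?B = "\<lambda>x. x\<^sup>2 * of_bool (\<bar>x\<bar> > c * s N)"
      have intB: "integrable (\<nu> N) ?B"
        by (rule Bochner_Integration.integrable_bound[OF sq[of N]]) auto
      \<comment> \<open>Above the truncation level the quadratic branch of the minimum is kept;
        below it one factor \<bar>x\<bar> / s of the cubic branch is at most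
        \<open>c\<close>.\<close>
      have pw: "min (6 * x\<^sup>2) (\<bar>t / s N\<bar> * \<bar>x\<bar> ^ 3) \<le> 6 * ?B x + \<bar>t\<bar> * c * x\<^sup>2" for x
      proof (cases "\<bar>x\<bar> > c * s N")
        case True
        then show ?thesis using c by (auto intro!: min.coboundedI1)
      next
        case False
        have "\<bar>t / s N\<bar> * \<bar>x\<bar> ^ 3 = \<bar>t\<bar> * (\<bar>x\<bar> / s N) * x\<^sup>2"
          using s by (simp add: abs_divide power3_eq_cube power2_eq_square)
        also have "\<dots> \<le> \<bar>t\<bar> * c * x\<^sup>2"
          using False s by (intro mult_right_mono mult_left_mono) (auto simp: divide_le_eq)
        finally show ?thesis using False by (auto intro: min.coboundedI2)
      qed
      have int_min: "integrable (\<nu> N) (\<lambda>x. min (6 * x\<^sup>2) (\<bar>t / s N\<bar> * \<bar>x\<bar> ^ 3))"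
        by (rule Bochner_Integration.integrable_bound[where f = "\<lambda>x. 6 * x\<^sup>2"])
           (use sq[of N] in \<open>auto simp: abs_mult\<close>)
      have "(\<integral>x. min (6 * x\<^sup>2) (\<bar>t / s N\<bar> * \<bar>x\<bar> ^ 3) \<partial>\<nu> N)
          \<le> (\<integral>x. 6 * ?B x + \<bar>t\<bar> * c * x\<^sup>2 \<partial>\<nu> N)"
        using intB sq[of N] by (intro integral_mono int_min pw) auto
      also have "\<dots> = 6 * (\<integral>x. ?B x \<partial>\<nu> N) + \<bar>t\<bar> * c * V N"
        using intB sq[of N] by (simp add: var)
      finally have "rem N \<le> (1 / V N) * (6 * (\<integral>x. ?B x \<partial>\<nu> N) + \<bar>t\<bar> * c * V N)"
        unfolding rem_def using elim by (intro mult_left_mono) auto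
      also have "\<dots> = 6 * ((1 / V N) * (\<integral>x. ?B x \<partial>\<nu> N)) + \<bar>t\<bar> * c"
        using elim by (simp add: field_simps)
      also have "\<dots> < r" using elim(1) tc unfolding s_def by linarith
      finally have "rem N < r" .
      moreover have "0 \<le> rem N" unfolding rem_def using elim
        by (intro mult_nonneg_nonneg Bochner_Integration.integral_nonneg) auto
      ultimately show ?case by simp
    qed
  qed
  then have *: "(\<lambda>N. t\<^sup>2 / 6 * rem N) \<longlonglongrightarrow> 0" by (rule tendsto_mult_right_zero)
  have "(\<lambda>N. complex_of_real ((1 + (- (t\<^sup>2) / 2) / N) ^ N)) \<longlonglongrightarrow> complex_of_real (exp (- (t\<^sup>2) / 2))"
    by (rule isCont_tendsto_compose [OF _ tendsto_exp_limit_sequentially]) auto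
  then have "\<phi> \<longlonglongrightarrow> complex_of_real (exp (- (t\<^sup>2) / 2))"
    by (rule Lim_transform) (rule Lim_null_comparison [OF main *])
  then show ?thesis unfolding \<phi>_def[abs_def] char_std_normal_distribution by simp
qed

section \<open>Cross-fitting\<close>

text \<open>Rates may be zero, so \<open>B = 0\<close> must be allowed. Division by
  \<open>D * B\<close> is then impossible, but the integral vanishes and the event that
  \<open>u\<close> is positive is null.\<close>

lemma nn_integral_indicator_Markov:
  assumes [measurable]: "u \<in> borel_measurable M" and B: "0 \<le> B" and D: "0 < D"
    and le: "(\<integral>\<^sup>+y. u y \<partial>M) \<le> ennreal B"
  shows "(\<integral>\<^sup>+y. indicator {y. ennreal (D * B) < u y} y \<partial>M) \<le> ennreal (1 / D)"
proof (cases "B = 0")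
  case True
  then have "(\<integral>\<^sup>+y. u y \<partial>M) = 0" using le by simp
  then have "AE y in M. u y = 0" by (simp add: nn_integral_0_iff_AE)
  then have "(\<integral>\<^sup>+y. indicator {y. ennreal (D * B) < u y} y \<partial>M) = (\<integral>\<^sup>+y. 0 \<partial>M)"
    by (intro nn_integral_cong_AE) (auto simp: True)
  then show ?thesis by simp
next
  case False
  with B have B: "0 < B" by simp
  have pw: "(indicator {y. ennreal (D * B) < u y} y :: ennreal) \<le> ennreal (1 / (D * B)) * u y" for y
  proof (cases "ennreal (D * B) < u y")
    case True
    have "1 = ennreal (1 / (D * B)) * ennreal (D * B)"
      using B D by (simp flip: ennreal_mult)
    also have "\<dots> \<le> ennreal (1 / (D * B)) * u y"
      using True by (intro mult_left_mono) auto
    finally show ?thesis using True by simp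
  qed simp
  have "(\<integral>\<^sup>+y. indicator {y. ennreal (D * B) < u y} y \<partial>M) \<le> (\<integral>\<^sup>+y. ennreal (1 / (D * B)) * u y \<partial>M)"
    by (intro nn_integral_mono pw)
  also have "\<dots> = ennreal (1 / (D * B)) * (\<integral>\<^sup>+y. u y \<partial>M)" by (rule nn_integral_cmult) simp
  also have "\<dots> \<le> ennreal (1 / (D * B)) * ennreal B" by (intro mult_left_mono le) simp
  also have "\<dots> = ennreal (1 / D)" using B D by (simp flip: ennreal_mult)
  finally show ?thesis .
qed

text \<open>A conditional Markov inequality with \<open>J\<close> as training and \<open>I\<close>
  as held-out coordinates, Fubini's theorem replacing the conditional expectation given
  \<open>J\<close>. The event \<open>E\<close> keeps only outcomes with \<open>w\<close> at most
  \<open>B\<close>: for each frozen \<open>x\<close> its section is either empty or controlled by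
  Markov's inequality, so \<open>w\<close> itself never has to be integrated.\<close>

lemma product_conditional_Markov:
  fixes L :: "'s measure" and I J :: "nat set"
  assumes L: "prob_space L" and IJ: "J \<inter> I = {}" "finite J" "finite I"
    and [measurable]: "u \<in> borel_measurable (Pi\<^sub>M (J \<union> I) (\<lambda>_. L))"
    and w[measurable]: "w \<in> borel_measurable (Pi\<^sub>M J (\<lambda>_. L))"
    and B: "0 \<le> B" and D: "0 < D"
    and le: "\<And>x. x \<in> space (Pi\<^sub>M J (\<lambda>_. L)) \<Longrightarrow>
      (\<integral>\<^sup>+y. u (merge J I (x, y)) \<partial>Pi\<^sub>M I (\<lambda>_. L)) \<le> w x"
  shows "measure (Pi\<^sub>M (J \<union> I) (\<lambda>_. L)) {z \<in> space (Pi\<^sub>M (J \<union> I) (\<lambda>_. L)). ennreal (D * B) < u z}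
    \<le> measure (Pi\<^sub>M (J \<union> I) (\<lambda>_. L))
        {z \<in> space (Pi\<^sub>M (J \<union> I) (\<lambda>_. L)). ennreal B < w (restrict z J)} + 1 / D"
proof -
  interpret L: prob_space L by (rule L)
  interpret product_prob_space "\<lambda>_. L" UNIV ..
  let ?M = "Pi\<^sub>M (J \<union> I) (\<lambda>_. L)"
  interpret M: prob_space ?M by (intro prob_space_PiM L)
  interpret MJ: prob_space "Pi\<^sub>M J (\<lambda>_. L)" by (intro prob_space_PiM L)
  have [measurable]: "(\<lambda>z. restrict z J) \<in> ?M \<rightarrow>\<^sub>M Pi\<^sub>M J (\<lambda>_. L)"
    by (rule measurable_restrict_subset) auto
  have [measurable]: "(\<lambda>z. w (restrict z J)) \<in> borel_measurable ?M" by simp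
  define E where "E = {z \<in> space ?M. ennreal (D * B) < u z \<and> w (restrict z J) \<le> ennreal B}"
  have [measurable]: "E \<in> sets ?M" unfolding E_def by measurable
  have "emeasure ?M E = (\<integral>\<^sup>+z. indicator E z \<partial>?M)" by simp
  also have "\<dots> = (\<integral>\<^sup>+x. (\<integral>\<^sup>+y. indicator E (merge J I (x, y)) \<partial>Pi\<^sub>M I (\<lambda>_. L)) \<partial>Pi\<^sub>M J (\<lambda>_. L))"
    by (rule product_nn_integral_fold[OF IJ]) simp
  also have "\<dots> \<le> (\<integral>\<^sup>+x. ennreal (1 / D) \<partial>Pi\<^sub>M J (\<lambda>_. L))"
  proof (rule nn_integral_mono)
    fix x assume x: "x \<in> space (Pi\<^sub>M J (\<lambda>_. L))"
    have rx: "restrict (merge J I (x, y)) J = x" for y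
      using x by (auto simp: space_PiM PiE_def extensional_def fun_eq_iff restrict_def merge_def)
    have [measurable]: "(\<lambda>y. u (merge J I (x, y))) \<in> borel_measurable (Pi\<^sub>M I (\<lambda>_. L))"
      using x by measurable
    show "(\<integral>\<^sup>+y. indicator E (merge J I (x, y)) \<partial>Pi\<^sub>M I (\<lambda>_. L)) \<le> ennreal (1 / D)"
    proof (cases "w x \<le> ennreal B")
      case True
      have "(\<integral>\<^sup>+y. indicator E (merge J I (x, y)) \<partial>Pi\<^sub>M I (\<lambda>_. L))
          \<le> (\<integral>\<^sup>+y. indicator {y. ennreal (D * B) < u (merge J I (x, y))} y \<partial>Pi\<^sub>M I (\<lambda>_. L))"
        by (intro nn_integral_mono) (auto simp: E_def indicator_def)
      also have "\<dots> \<le> ennreal (1 / D)"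
        using order_trans[OF le[OF x] True] by (intro nn_integral_indicator_Markov B D) auto
      finally show ?thesis .
    next
      case False
      then have "(\<integral>\<^sup>+y. indicator E (merge J I (x, y)) \<partial>Pi\<^sub>M I (\<lambda>_. L)) = 0"
        by (intro nn_integral_zero') (auto simp: E_def rx)
      then show ?thesis by simp
    qed
  qed
  also have "\<dots> = ennreal (1 / D)" by (simp add: MJ.emeasure_space_1)
  finally have E: "measure ?M E \<le> 1 / D"
    using D by (simp add: M.emeasure_eq_measure)
  have "measure ?M {z \<in> space ?M. ennreal (D * B) < u z}
      \<le> measure ?M ({z \<in> space ?M. ennreal B < w (restrict z J)} \<union> E)"
    by (rule M.finite_measure_mono) (auto simp: E_def)
  also have "\<dots> \<le> measure ?M {z \<in> space ?M. ennreal B < w (restrict z J)} + measure ?M E"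
    by (rule measure_Un_le) auto
  finally show ?thesis using E by simp
qed

text \<open>Variances of independent centred terms add: integrating out the newly inserted
  coordinate first removes the cross term, twice the old sum times the mean of
  \<open>h\<close>.\<close>

lemma nn_integral_square_sum_centred:
  fixes L :: "'s measure" and h :: "'s \<Rightarrow> real"
  assumes L: "prob_space L" and [measurable]: "h \<in> borel_measurable L"
    and sq: "integrable L (\<lambda>x. (h x)\<^sup>2)" and mean: "(\<integral>x. h x \<partial>L) = 0" and "finite I"
  shows "(\<integral>\<^sup>+y. ennreal ((\<Sum>i\<in>I. h (y i))\<^sup>2) \<partial>Pi\<^sub>M I (\<lambda>_. L))
    = of_nat (card I) * (\<integral>\<^sup>+x. ennreal ((h x)\<^sup>2) \<partial>L)"
  using \<open>finite I\<close>
proof (induction I)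
  case empty
  show ?case by simp
next
  case (insert i I)
  interpret L: prob_space L by (rule L)
  interpret product_prob_space "\<lambda>_. L" UNIV ..
  interpret MI: prob_space "Pi\<^sub>M I (\<lambda>_. L)" by (intro prob_space_PiM L)
  have int: "integrable L h" by (rule L.square_integrable_imp_integrable[OF _ sq]) simp
  have sqe: "(\<integral>\<^sup>+x. ennreal ((h x)\<^sup>2) \<partial>L) = ennreal (\<integral>x. (h x)\<^sup>2 \<partial>L)"
    by (rule nn_integral_eq_integral[OF sq]) simp
  have [measurable]: "(\<lambda>y. h (y j)) \<in> borel_measurable (Pi\<^sub>M A (\<lambda>_. L))" if "j \<in> A" for j A
    using that by measurable
  have inner: "(\<integral>\<^sup>+x. ennreal ((s + h x)\<^sup>2) \<partial>L) = ennreal (s\<^sup>2) + ennreal (\<integral>x. (h x)\<^sup>2 \<partial>L)" for s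
  proof -
    have eq: "(s + h x)\<^sup>2 = s\<^sup>2 + (2 * s) * h x + (h x)\<^sup>2" for x
      by (simp add: power2_eq_square algebra_simps)
    have i: "integrable L (\<lambda>x. (s + h x)\<^sup>2)" unfolding eq using int sq by simp
    have "(\<integral>\<^sup>+x. ennreal ((s + h x)\<^sup>2) \<partial>L) = ennreal (\<integral>x. (s + h x)\<^sup>2 \<partial>L)"
      by (rule nn_integral_eq_integral[OF i]) simp
    also have "(\<integral>x. (s + h x)\<^sup>2 \<partial>L) = s\<^sup>2 + (\<integral>x. (h x)\<^sup>2 \<partial>L)"
      unfolding eq using int sq mean by (simp add: L.prob_space)
    finally show ?thesis by (simp add: ennreal_plus)
  qed
  have "(\<integral>\<^sup>+y. ennreal ((\<Sum>j\<in>insert i I. h (y j))\<^sup>2) \<partial>Pi\<^sub>M (insert i I) (\<lambda>_. L))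
      = (\<integral>\<^sup>+y. (\<integral>\<^sup>+x. ennreal ((\<Sum>j\<in>insert i I. h ((y(i := x)) j))\<^sup>2) \<partial>L) \<partial>Pi\<^sub>M I (\<lambda>_. L))"
    using insert by (intro product_nn_integral_insert) auto
  also have "\<dots> = (\<integral>\<^sup>+y. (\<integral>\<^sup>+x. ennreal (((\<Sum>j\<in>I. h (y j)) + h x)\<^sup>2) \<partial>L) \<partial>Pi\<^sub>M I (\<lambda>_. L))"
  proof -
    have "(\<Sum>j\<in>insert i I. h ((y(i := x)) j)) = (\<Sum>j\<in>I. h (y j)) + h x" for y x
    proof -
      have "(\<Sum>j\<in>I. h ((y(i := x)) j)) = (\<Sum>j\<in>I. h (y j))"
        using insert by (intro sum.cong) auto
      then show ?thesis using insert by simp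
    qed
    then show ?thesis by simp
  qed
  also have "\<dots> = (\<integral>\<^sup>+y. ennreal ((\<Sum>j\<in>I. h (y j))\<^sup>2) \<partial>Pi\<^sub>M I (\<lambda>_. L)) + ennreal (\<integral>x. (h x)\<^sup>2 \<partial>L)"
    unfolding inner by (subst nn_integral_add) (auto simp: MI.emeasure_space_1)
  also have "\<dots> = of_nat (card (insert i I)) * (\<integral>\<^sup>+x. ennreal ((h x)\<^sup>2) \<partial>L)"
    using insert by (simp add: sqe distrib_right add.commute)
  finally show ?case .
qed

lemma nn_integral_sum_components:
  fixes L :: "'s measure" and h :: "'s \<Rightarrow> ennreal"
  assumes L: "prob_space L" and [measurable]: "h \<in> borel_measurable L" and "finite I"
  shows "(\<integral>\<^sup>+y. (\<Sum>i\<in>I. h (y i)) \<partial>Pi\<^sub>M I (\<lambda>_. L)) = of_nat (card I) * (\<integral>\<^sup>+x. h x \<partial>L)"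
proof -
  have [measurable]: "(\<lambda>y. h (y j)) \<in> borel_measurable (Pi\<^sub>M I (\<lambda>_. L))" if "j \<in> I" for j
    using that by measurable
  have "(\<integral>\<^sup>+y. (\<Sum>i\<in>I. h (y i)) \<partial>Pi\<^sub>M I (\<lambda>_. L)) = (\<Sum>i\<in>I. (\<integral>\<^sup>+y. h (y i) \<partial>Pi\<^sub>M I (\<lambda>_. L)))"
    by (rule nn_integral_sum) simp
  also have "\<dots> = (\<Sum>i\<in>I. (\<integral>\<^sup>+x. h x \<partial>L))"
  proof (rule sum.cong[OF refl])
    fix i assume i: "i \<in> I"
    have "(\<integral>\<^sup>+y. h (y i) \<partial>Pi\<^sub>M I (\<lambda>_. L)) = (\<integral>\<^sup>+x. h x \<partial>distr (Pi\<^sub>M I (\<lambda>_. L)) L (\<lambda>y. y i))"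
      using i by (subst nn_integral_distr) auto
    also have "distr (Pi\<^sub>M I (\<lambda>_. L)) L (\<lambda>y. y i) = L"
      using distr_PiM_component[of I "\<lambda>_. L" i] L i by simp
    finally show "(\<integral>\<^sup>+y. h (y i) \<partial>Pi\<^sub>M I (\<lambda>_. L)) = (\<integral>\<^sup>+x. h x \<partial>L)" .
  qed
  finally show ?thesis by simp
qed

section \<open>Sample splitting at one sample size\<close>

locale crossfit = prob_space P for P :: "'w measure" +
  fixes N K :: nat and S L :: "'s measure" and Z :: "nat \<Rightarrow> 'w \<Rightarrow> 's" and g :: "nat \<Rightarrow> 'w \<Rightarrow> nat"
  assumes prob_L: "prob_space L" and sets_L[measurable_cong]: "sets L = sets S"
    and iid: "iid_sample P N S Z L" and folds: "independent_folds P N K S Z g"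
begin

definition sample :: "'w \<Rightarrow> nat \<Rightarrow> 's" where "sample \<omega> = (\<lambda>i\<in>{1..N}. Z i \<omega>)"

definition fold_map :: "'w \<Rightarrow> nat \<Rightarrow> nat" where "fold_map \<omega> = (\<lambda>i\<in>{1..N}. g i \<omega>)"

definition fold_maps :: "(nat \<Rightarrow> nat) set" where "fold_maps = {1..N} \<rightarrow>\<^sub>E {1..K}"

text \<open>The deterministic counterpart of \<open>training\<close>, for a frozen fold map.\<close>

definition outside :: "(nat \<Rightarrow> nat) \<Rightarrow> nat \<Rightarrow> nat set" where
  "outside \<gamma> k = {i \<in> {1..N}. \<gamma> i \<noteq> k}"

abbreviation training :: "nat \<Rightarrow> 'w \<Rightarrow> nat set" where "training \<equiv> training_indices N g"

definition training_data :: "nat \<Rightarrow> 'w \<Rightarrow> nat \<Rightarrow> 's" where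
  "training_data k \<omega> = restrict (\<lambda>i. Z i \<omega>) (training k \<omega>)"

text \<open>Divided by the full sample size and not by the size of the fold, so that the fold means
  add up to the average over the sample and an empty fold causes no exception.\<close>

definition fold_mean :: "nat \<Rightarrow> (nat set \<Rightarrow> (nat \<Rightarrow> 's) \<Rightarrow> 's \<Rightarrow> real) \<Rightarrow> 'w \<Rightarrow> real" where
  "fold_mean k H \<omega> = (1 / real N) *
     (\<Sum>i\<in>{i\<in>{1..N}. g i \<omega> = k}. H (training k \<omega>) (training_data k \<omega>) (Z i \<omega>))"

lemma Z_measurable[measurable]: "i \<in> {1..N} \<Longrightarrow> Z i \<in> P \<rightarrow>\<^sub>M S"
  using iid unfolding iid_sample_def indep_vars_def2 by blast

lemma g_measurable: "i \<in> {1..N} \<Longrightarrow> g i \<in> P \<rightarrow>\<^sub>M count_space {1..K}"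
  using folds unfolding independent_folds_def by blast

lemma finite_fold_maps: "finite fold_maps"
  unfolding fold_maps_def by (intro finite_PiE) auto

lemma fold_map_in: "\<omega> \<in> space P \<Longrightarrow> fold_map \<omega> \<in> fold_maps"
  using measurable_space[OF g_measurable] unfolding fold_map_def fold_maps_def by auto

lemma fold_map_measurable_PiM:
  "fold_map \<in> P \<rightarrow>\<^sub>M Pi\<^sub>M {1..N} (\<lambda>_. count_space {1..K})"
  unfolding fold_map_def by (intro measurable_restrict g_measurable)

lemma singleton_fold_map_sets:
  "\<gamma> \<in> fold_maps \<Longrightarrow> {\<gamma>} \<in> sets (Pi\<^sub>M {1..N} (\<lambda>_. count_space {1..K}))"
proof -
  assume \<gamma>: "\<gamma> \<in> fold_maps"
  then have "{\<gamma>} = Pi\<^sub>E {1..N} (\<lambda>i. {\<gamma> i})"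
    by (subst PiE_singleton) (auto simp: fold_maps_def PiE_def)
  also have "\<dots> \<in> sets (Pi\<^sub>M {1..N} (\<lambda>_. count_space {1..K}))"
    using \<gamma> by (intro sets_PiM_I_finite) (auto simp: fold_maps_def)
  finally show ?thesis .
qed

lemma fold_map_measurable[measurable]: "fold_map \<in> P \<rightarrow>\<^sub>M count_space fold_maps"
proof (rule measurable_count_space_eq2[THEN iffD2, OF finite_fold_maps], intro conjI ballI)
  show "fold_map \<in> space P \<rightarrow> fold_maps" using fold_map_in by auto
  fix \<gamma> assume "\<gamma> \<in> fold_maps"
  from measurable_sets[OF fold_map_measurable_PiM singleton_fold_map_sets[OF this]]
  show "fold_map -` {\<gamma>} \<inter> space P \<in> sets P" .
qed

lemma sample_measurable_S: "sample \<in> P \<rightarrow>\<^sub>M Pi\<^sub>M {1..N} (\<lambda>_. S)"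
  unfolding sample_def by (intro measurable_restrict Z_measurable)

lemma sample_measurable[measurable]: "sample \<in> P \<rightarrow>\<^sub>M Pi\<^sub>M {1..N} (\<lambda>_. L)"
  unfolding sample_def using Z_measurable measurable_cong_sets[OF refl sets_L]
  by (intro measurable_restrict) auto

lemma sets_PiM_L: "sets (Pi\<^sub>M J (\<lambda>_. L)) = sets (Pi\<^sub>M J (\<lambda>_. S))"
  by (intro sets_PiM_cong) (auto simp: sets_L)

text \<open>The fold map has finitely many values, so joint measurability reduces to measurability
  for each frozen value.\<close>

lemma sample_fold_measurable:
  assumes "\<And>\<gamma>. \<gamma> \<in> fold_maps \<Longrightarrow> F \<gamma> \<in> Pi\<^sub>M {1..N} (\<lambda>_. L) \<rightarrow>\<^sub>M M'"
  shows "(\<lambda>\<omega>. F (fold_map \<omega>) (sample \<omega>)) \<in> P \<rightarrow>\<^sub>M M'"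
  by (rule measurable_compose_countable'[where I = fold_maps and g = fold_map])
     (use assms finite_fold_maps in \<open>auto intro: countable_finite measurable_compose[OF sample_measurable]\<close>)

lemma distr_sample:
  assumes "N > 0"
  shows "distr P (Pi\<^sub>M {1..N} (\<lambda>_. S)) sample = Pi\<^sub>M {1..N} (\<lambda>_. L)"
proof -
  have "indep_vars (\<lambda>_. S) Z {1..N}" using iid by (simp add: iid_sample_def)
  then have "distr P (Pi\<^sub>M {1..N} (\<lambda>_. S)) sample = (\<Pi>\<^sub>M i\<in>{1..N}. distr P S (Z i))"
    using assms unfolding sample_def
    by (subst indep_vars_iff_distr_eq_PiM'[symmetric]) (auto intro: Z_measurable)
  also have "\<dots> = Pi\<^sub>M {1..N} (\<lambda>_. L)"
    using iid by (intro PiM_cong) (auto simp: iid_sample_def)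
  finally show ?thesis .
qed

text \<open>The event is a disjoint union over the finitely many fold maps; on each piece
  independence of folds and data factors the probability, and the sample has the product
  law.\<close>

lemma prob_sample_fold:
  assumes N: "N > 0"
    and A: "\<And>\<gamma>. \<gamma> \<in> fold_maps \<Longrightarrow> A \<gamma> \<in> sets (Pi\<^sub>M {1..N} (\<lambda>_. L))"
  shows "\<P>(\<omega> in P. sample \<omega> \<in> A (fold_map \<omega>))
    = (\<Sum>\<gamma>\<in>fold_maps. \<P>(\<omega> in P. fold_map \<omega> = \<gamma>) * measure (Pi\<^sub>M {1..N} (\<lambda>_. L)) (A \<gamma>))"
proof -
  define E where "E \<gamma> = (sample -` A \<gamma> \<inter> space P) \<inter> (fold_map -` {\<gamma>} \<inter> space P)" for \<gamma>
  have E1: "sample -` A \<gamma> \<inter> space P \<in> sets P" if "\<gamma> \<in> fold_maps" for \<gamma>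
    using A[OF that] by measurable
  have E2: "fold_map -` {\<gamma>} \<inter> space P \<in> sets P" if "\<gamma> \<in> fold_maps" for \<gamma>
    using that by measurable
  have "{\<omega> \<in> space P. sample \<omega> \<in> A (fold_map \<omega>)} = (\<Union>\<gamma>\<in>fold_maps. E \<gamma>)"
    using fold_map_in by (auto simp: E_def)
  then have "\<P>(\<omega> in P. sample \<omega> \<in> A (fold_map \<omega>)) = (\<Sum>\<gamma>\<in>fold_maps. prob (E \<gamma>))"
    using E1 E2 finite_fold_maps
    by (simp only:) (intro finite_measure_finite_Union, auto simp: E_def disjoint_family_on_def)
  also have "\<dots> = (\<Sum>\<gamma>\<in>fold_maps. \<P>(\<omega> in P. fold_map \<omega> = \<gamma>) * measure (Pi\<^sub>M {1..N} (\<lambda>_. L)) (A \<gamma>))"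
  proof (rule sum.cong[OF refl])
    fix \<gamma> assume \<gamma>: "\<gamma> \<in> fold_maps"
    have A': "A \<gamma> \<in> sets (Pi\<^sub>M {1..N} (\<lambda>_. S))" using A[OF \<gamma>] by (simp add: sets_PiM_L)
    have "prob (E \<gamma>) = prob (sample -` A \<gamma> \<inter> space P) * prob (fold_map -` {\<gamma>} \<inter> space P)"
      unfolding E_def
    proof (rule indep_setD)
      show "indep_set (sets (sigma_of P (Pi\<^sub>M {1..N} (\<lambda>_. S)) sample))
          (sets (sigma_of P (Pi\<^sub>M {1..N} (\<lambda>_. count_space {1..K})) fold_map))"
        using folds unfolding independent_folds_def sample_def fold_map_def by blast
    qed (use A' singleton_fold_map_sets[OF \<gamma>] in \<open>auto intro: in_vimage_algebra\<close>)
    also have "prob (sample -` A \<gamma> \<inter> space P) = measure (distr P (Pi\<^sub>M {1..N} (\<lambda>_. S)) sample) (A \<gamma>)"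
      by (rule measure_distr[OF sample_measurable_S A', symmetric])
    also have "distr P (Pi\<^sub>M {1..N} (\<lambda>_. S)) sample = Pi\<^sub>M {1..N} (\<lambda>_. L)" by (rule distr_sample[OF N])
    also have "fold_map -` {\<gamma>} \<inter> space P = {\<omega> \<in> space P. fold_map \<omega> = \<gamma>}" by auto
    finally show "prob (E \<gamma>) = \<P>(\<omega> in P. fold_map \<omega> = \<gamma>) * measure (Pi\<^sub>M {1..N} (\<lambda>_. L)) (A \<gamma>)"
      by simp
  qed
  finally show ?thesis .
qed

text \<open>Independence of folds and data reduces a probability bound to a bound for each frozen fold map.\<close>

lemma prob_sample_fold_le:
  assumes N: "N > 0"
    and A: "\<And>\<gamma>. \<gamma> \<in> fold_maps \<Longrightarrow> A \<gamma> \<in> sets (Pi\<^sub>M {1..N} (\<lambda>_. L))"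
    and G: "\<And>\<gamma>. \<gamma> \<in> fold_maps \<Longrightarrow> G \<gamma> \<in> sets (Pi\<^sub>M {1..N} (\<lambda>_. L))"
    and le: "\<And>\<gamma>. \<gamma> \<in> fold_maps \<Longrightarrow>
      measure (Pi\<^sub>M {1..N} (\<lambda>_. L)) (A \<gamma>) \<le> measure (Pi\<^sub>M {1..N} (\<lambda>_. L)) (G \<gamma>) + \<delta>"
  shows "\<P>(\<omega> in P. sample \<omega> \<in> A (fold_map \<omega>)) \<le> \<P>(\<omega> in P. sample \<omega> \<in> G (fold_map \<omega>)) + \<delta>"
proof -
  let ?M = "Pi\<^sub>M {1..N} (\<lambda>_. L)"
  interpret M: prob_space ?M by (intro prob_space_PiM prob_L)
  \<comment> \<open>That the fold maps carry total probability 1 is read off from the same formula,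
    applied to the whole space.\<close>
  have "(\<Sum>\<gamma>\<in>fold_maps. \<P>(\<omega> in P. fold_map \<omega> = \<gamma>) * measure ?M (space ?M))
      = \<P>(\<omega> in P. sample \<omega> \<in> space ?M)"
    by (rule prob_sample_fold[OF N, symmetric]) (rule sets.top)
  also have "\<dots> = prob (space P)"
    using measurable_space[OF sample_measurable] by (intro arg_cong[where f = prob]) auto
  finally have sum1: "(\<Sum>\<gamma>\<in>fold_maps. \<P>(\<omega> in P. fold_map \<omega> = \<gamma>)) = 1"
    by (simp only: M.prob_space prob_space mult_1_right)
  have "\<P>(\<omega> in P. sample \<omega> \<in> A (fold_map \<omega>))
      = (\<Sum>\<gamma>\<in>fold_maps. \<P>(\<omega> in P. fold_map \<omega> = \<gamma>) * measure ?M (A \<gamma>))"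
    by (rule prob_sample_fold[OF N A])
  also have "\<dots> \<le> (\<Sum>\<gamma>\<in>fold_maps. \<P>(\<omega> in P. fold_map \<omega> = \<gamma>) * (measure ?M (G \<gamma>) + \<delta>))"
    by (intro sum_mono mult_left_mono le) auto
  also have "\<dots> = (\<Sum>\<gamma>\<in>fold_maps. \<P>(\<omega> in P. fold_map \<omega> = \<gamma>) * measure ?M (G \<gamma>)) + \<delta>"
    using sum1 by (simp add: distrib_left sum.distrib flip: sum_distrib_right)
  also have "(\<Sum>\<gamma>\<in>fold_maps. \<P>(\<omega> in P. fold_map \<omega> = \<gamma>) * measure ?M (G \<gamma>))
      = \<P>(\<omega> in P. sample \<omega> \<in> G (fold_map \<omega>))"
    by (rule prob_sample_fold[OF N G, symmetric])
  finally show ?thesis .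
qed

lemma outside_fold_map: "outside (fold_map \<omega>) k = training k \<omega>"
  unfolding outside_def fold_map_def training_indices_def by auto

lemma restrict_sample: "restrict (sample \<omega>) (training k \<omega>) = training_data k \<omega>"
  unfolding sample_def training_data_def training_indices_def by (auto simp: fun_eq_iff)

lemma training_data_measurable:
  assumes "\<And>J. J \<subseteq> {1..N} \<Longrightarrow> W J \<in> Pi\<^sub>M J (\<lambda>_. S) \<rightarrow>\<^sub>M M'"
  shows "(\<lambda>\<omega>. W (training k \<omega>) (training_data k \<omega>)) \<in> P \<rightarrow>\<^sub>M M'"
proof -
  have "(\<lambda>\<omega>. W (outside (fold_map \<omega>) k) (restrict (sample \<omega>) (outside (fold_map \<omega>) k))) \<in> P \<rightarrow>\<^sub>M M'"
  proof (rule sample_fold_measurable)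
    fix \<gamma>
    have J: "outside \<gamma> k \<subseteq> {1..N}" by (auto simp: outside_def)
    have "W (outside \<gamma> k) \<in> Pi\<^sub>M (outside \<gamma> k) (\<lambda>_. L) \<rightarrow>\<^sub>M M'"
      using assms[OF J] measurable_cong_sets[OF sets_PiM_L refl] by blast
    then show "(\<lambda>z. W (outside \<gamma> k) (restrict z (outside \<gamma> k))) \<in> Pi\<^sub>M {1..N} (\<lambda>_. L) \<rightarrow>\<^sub>M M'"
      by (rule measurable_compose[OF measurable_restrict_subset[OF J]])
  qed
  then show ?thesis by (simp add: outside_fold_map restrict_sample)
qed

text \<open>For a frozen fold map the training coordinates are those outside fold \<open>k\<close>,
  and the product-space inequality applies. Its excess \<open>1 / D\<close> is the same for every
  fold map, so it survives averaging over them.\<close>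

lemma crossfit_Markov:
  assumes N: "N > 0"
    and u: "\<And>\<gamma>. \<gamma> \<in> fold_maps \<Longrightarrow> u \<gamma> \<in> borel_measurable (Pi\<^sub>M {1..N} (\<lambda>_. L))"
    and W: "\<And>J. J \<subseteq> {1..N} \<Longrightarrow> W J \<in> borel_measurable (Pi\<^sub>M J (\<lambda>_. S))"
    and B: "0 \<le> B" and D: "0 < D"
    and le: "\<And>\<gamma> x. \<gamma> \<in> fold_maps \<Longrightarrow> x \<in> space (Pi\<^sub>M (outside \<gamma> k) (\<lambda>_. L)) \<Longrightarrow>
      (\<integral>\<^sup>+y. u \<gamma> (merge (outside \<gamma> k) {i\<in>{1..N}. \<gamma> i = k} (x, y)) \<partial>Pi\<^sub>M {i\<in>{1..N}. \<gamma> i = k} (\<lambda>_. L))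
        \<le> W (outside \<gamma> k) x"
  shows "\<P>(\<omega> in P. ennreal (D * B) < u (fold_map \<omega>) (sample \<omega>))
    \<le> \<P>(\<omega> in P. ennreal B < W (training k \<omega>) (training_data k \<omega>)) + 1 / D"
proof -
  let ?M = "Pi\<^sub>M {1..N} (\<lambda>_. L)"
  define A where "A \<gamma> = {z \<in> space ?M. ennreal (D * B) < u \<gamma> z}" for \<gamma>
  define G where "G \<gamma> = {z \<in> space ?M. ennreal B < W (outside \<gamma> k) (restrict z (outside \<gamma> k))}" for \<gamma>
  have J: "outside \<gamma> k \<subseteq> {1..N}" for \<gamma> by (auto simp: outside_def)
  have W': "W (outside \<gamma> k) \<in> borel_measurable (Pi\<^sub>M (outside \<gamma> k) (\<lambda>_. L))" for \<gamma>
    using W[OF J] measurable_cong_sets[OF sets_PiM_L refl] by blast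
  have [measurable]: "(\<lambda>z. W (outside \<gamma> k) (restrict z (outside \<gamma> k))) \<in> borel_measurable ?M" for \<gamma>
    by (rule measurable_compose[OF measurable_restrict_subset[OF J] W'])
  have "\<P>(\<omega> in P. sample \<omega> \<in> A (fold_map \<omega>)) \<le> \<P>(\<omega> in P. sample \<omega> \<in> G (fold_map \<omega>)) + 1 / D"
  proof (rule prob_sample_fold_le[OF N])
    fix \<gamma> assume \<gamma>: "\<gamma> \<in> fold_maps"
    show "A \<gamma> \<in> sets ?M" unfolding A_def using u[OF \<gamma>] by measurable
    show "G \<gamma> \<in> sets ?M" unfolding G_def by measurable
    have eq: "{1..N} = outside \<gamma> k \<union> {i\<in>{1..N}. \<gamma> i = k}" by (auto simp: outside_def)
    have u': "u \<gamma> \<in> borel_measurable (Pi\<^sub>M (outside \<gamma> k \<union> {i\<in>{1..N}. \<gamma> i = k}) (\<lambda>_. L))"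
      using u[OF \<gamma>] unfolding eq[symmetric] .
    have fin: "outside \<gamma> k \<inter> {i\<in>{1..N}. \<gamma> i = k} = {}" "finite (outside \<gamma> k)" "finite {i\<in>{1..N}. \<gamma> i = k}"
      by (auto simp: outside_def)
    show "measure ?M (A \<gamma>) \<le> measure ?M (G \<gamma>) + 1 / D"
      using product_conditional_Markov[OF prob_L fin u' W' B D le[OF \<gamma>]]
      unfolding A_def G_def eq[symmetric] .
  qed
  moreover have "{\<omega> \<in> space P. sample \<omega> \<in> A (fold_map \<omega>)}
      = {\<omega> \<in> space P. ennreal (D * B) < u (fold_map \<omega>) (sample \<omega>)}"
    using measurable_space[OF sample_measurable] by (auto simp: A_def)
  moreover have "{\<omega> \<in> space P. sample \<omega> \<in> G (fold_map \<omega>)}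
      = {\<omega> \<in> space P. ennreal B < W (training k \<omega>) (training_data k \<omega>)}"
    using measurable_space[OF sample_measurable] by (auto simp: G_def outside_fold_map restrict_sample)
  ultimately show ?thesis by simp
qed

text \<open>\<open>fold_mean\<close> with the fold map and the sample as free arguments: a function
  on the product space, to which Fubini's theorem applies.\<close>

definition fold_mean_at :: "nat \<Rightarrow> (nat set \<Rightarrow> (nat \<Rightarrow> 's) \<Rightarrow> 's \<Rightarrow> real) \<Rightarrow> (nat \<Rightarrow> nat) \<Rightarrow> (nat \<Rightarrow> 's) \<Rightarrow> real" where
  "fold_mean_at k H \<gamma> z = (1 / real N) *
     (\<Sum>i\<in>{i\<in>{1..N}. \<gamma> i = k}. H (outside \<gamma> k) (restrict z (outside \<gamma> k)) (z i))"

lemma fold_mean_at_fold_map: "fold_mean_at k H (fold_map \<omega>) (sample \<omega>) = fold_mean k H \<omega>"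
proof -
  have "{i\<in>{1..N}. fold_map \<omega> i = k} = {i\<in>{1..N}. g i \<omega> = k}" by (auto simp: fold_map_def)
  then show ?thesis
    unfolding fold_mean_at_def fold_mean_def outside_fold_map restrict_sample
    by (auto simp: sample_def intro!: sum.cong)
qed

text \<open>The gain from cross-fitting: with the training part \<open>x\<close> frozen, the fold
  mean is a sum of one fixed function over the independent held-out coordinates
  \<open>y\<close>.\<close>

lemma fold_mean_at_merge:
  assumes "x \<in> space (Pi\<^sub>M (outside \<gamma> k) (\<lambda>_. L))"
  shows "fold_mean_at k H \<gamma> (merge (outside \<gamma> k) {i\<in>{1..N}. \<gamma> i = k} (x, y))
    = (1 / real N) * (\<Sum>i\<in>{i\<in>{1..N}. \<gamma> i = k}. H (outside \<gamma> k) x (y i))"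
proof -
  have "restrict (merge (outside \<gamma> k) {i\<in>{1..N}. \<gamma> i = k} (x, y)) (outside \<gamma> k) = x"
    using assms by (auto simp: space_PiM PiE_def extensional_def fun_eq_iff restrict_def merge_def)
  moreover have "merge (outside \<gamma> k) {i\<in>{1..N}. \<gamma> i = k} (x, y) i = y i"
    if "i \<in> {i\<in>{1..N}. \<gamma> i = k}" for i
    using that by (auto simp: merge_def outside_def)
  ultimately show ?thesis unfolding fold_mean_at_def by simp
qed

context
  fixes H :: "nat set \<Rightarrow> (nat \<Rightarrow> 's) \<Rightarrow> 's \<Rightarrow> real"
  assumes H: "\<And>J. J \<subseteq> {1..N} \<Longrightarrow> (\<lambda>(z, x). H J z x) \<in> borel_measurable (Pi\<^sub>M J (\<lambda>_. S) \<Otimes>\<^sub>M S)"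
begin

lemma fold_mean_at_measurable:
  "fold_mean_at k H \<gamma> \<in> borel_measurable (Pi\<^sub>M {1..N} (\<lambda>_. L))"
proof -
  have J: "outside \<gamma> k \<subseteq> {1..N}" by (auto simp: outside_def)
  have "sets (Pi\<^sub>M (outside \<gamma> k) (\<lambda>_. L) \<Otimes>\<^sub>M L) = sets (Pi\<^sub>M (outside \<gamma> k) (\<lambda>_. S) \<Otimes>\<^sub>M S)"
    by (intro sets_pair_measure_cong sets_PiM_L sets_L)
  then have H': "(\<lambda>(z, x). H (outside \<gamma> k) z x) \<in> borel_measurable (Pi\<^sub>M (outside \<gamma> k) (\<lambda>_. L) \<Otimes>\<^sub>M L)"
    using H[OF J] measurable_cong_sets[OF _ refl] by blast
  have "(\<lambda>z. H (outside \<gamma> k) (restrict z (outside \<gamma> k)) (z i)) \<in> borel_measurable (Pi\<^sub>M {1..N} (\<lambda>_. L))"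
    if "i \<in> {1..N}" for i
  proof -
    have "(\<lambda>z. (restrict z (outside \<gamma> k), z i)) \<in> Pi\<^sub>M {1..N} (\<lambda>_. L) \<rightarrow>\<^sub>M Pi\<^sub>M (outside \<gamma> k) (\<lambda>_. L) \<Otimes>\<^sub>M L"
      using that by (intro measurable_Pair measurable_restrict_subset[OF J] measurable_component_singleton)
    from measurable_compose[OF this H'] show ?thesis by simp
  qed
  then show ?thesis unfolding fold_mean_at_def by (intro borel_measurable_times borel_measurable_sum) auto
qed

lemma fold_mean_measurable: "fold_mean k H \<in> borel_measurable P"
  using sample_fold_measurable[of "fold_mean_at k H" borel] fold_mean_at_measurable
  by (simp add: fold_mean_at_fold_map)

lemma H_section_measurable:
  assumes "J \<subseteq> {1..N}" "x \<in> space (Pi\<^sub>M J (\<lambda>_. L))"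
  shows "H J x \<in> borel_measurable L"
proof -
  have "x \<in> space (Pi\<^sub>M J (\<lambda>_. S))" using assms(2) sets_eq_imp_space_eq[OF sets_PiM_L] by blast
  from measurable_compose[OF measurable_Pair1'[OF this] H[OF assms(1)]]
  have "H J x \<in> borel_measurable S" by simp
  then show ?thesis using measurable_cong_sets[OF sets_L refl] by blast
qed

text \<open>A conditional Chebyshev inequality. Centredness is asked only where \<open>W\<close> is
  finite, since the applications derive it from a finite second moment; where \<open>W\<close> is
  infinite the conditional bound is trivial.\<close>

lemma fold_mean_centred_bound:
  assumes N: "N > 0"
    and W: "\<And>J. J \<subseteq> {1..N} \<Longrightarrow> W J \<in> borel_measurable (Pi\<^sub>M J (\<lambda>_. S))"
    and le: "\<And>J z. J \<subseteq> {1..N} \<Longrightarrow> z \<in> space (Pi\<^sub>M J (\<lambda>_. S)) \<Longrightarrow>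
      (\<integral>\<^sup>+x. ennreal ((H J z x)\<^sup>2) \<partial>L) \<le> W J z"
    and mean: "\<And>J z. J \<subseteq> {1..N} \<Longrightarrow> z \<in> space (Pi\<^sub>M J (\<lambda>_. S)) \<Longrightarrow> W J z < \<infinity> \<Longrightarrow> (\<integral>x. H J z x \<partial>L) = 0"
    and B: "0 \<le> B" and D: "0 < D"
  shows "\<P>(\<omega> in P. sqrt (D * B / real N) < \<bar>fold_mean k H \<omega>\<bar>)
    \<le> \<P>(\<omega> in P. ennreal B < W (training k \<omega>) (training_data k \<omega>)) + 1 / D"
proof -
  \<comment> \<open>With the factor \<open>N\<close>, the conditional mean of the squared fold mean
    is the second moment of \<open>H\<close> times the share of the fold in the sample, hence at
    most \<open>W\<close>.\<close>
  define u where "u \<gamma> z = ennreal (real N * (fold_mean_at k H \<gamma> z)\<^sup>2)" for \<gamma> z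
  have "\<P>(\<omega> in P. ennreal (D * B) < u (fold_map \<omega>) (sample \<omega>))
    \<le> \<P>(\<omega> in P. ennreal B < W (training k \<omega>) (training_data k \<omega>)) + 1 / D"
  proof (rule crossfit_Markov[OF N _ W B D])
    fix \<gamma> show "u \<gamma> \<in> borel_measurable (Pi\<^sub>M {1..N} (\<lambda>_. L))"
      unfolding u_def using fold_mean_at_measurable[of k \<gamma>] by measurable
  next
    fix \<gamma> x assume x: "x \<in> space (Pi\<^sub>M (outside \<gamma> k) (\<lambda>_. L))"
    let ?J = "outside \<gamma> k" and ?I = "{i\<in>{1..N}. \<gamma> i = k}"
    have J: "?J \<subseteq> {1..N}" by (auto simp: outside_def)
    have xS: "x \<in> space (Pi\<^sub>M ?J (\<lambda>_. S))" using x sets_eq_imp_space_eq[OF sets_PiM_L] by blast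
    note [measurable] = H_section_measurable[OF J x]
    show "(\<integral>\<^sup>+y. u \<gamma> (merge ?J ?I (x, y)) \<partial>Pi\<^sub>M ?I (\<lambda>_. L)) \<le> W ?J x"
    proof (cases "W ?J x < \<infinity>")
      case True
      have fin: "(\<integral>\<^sup>+z. ennreal ((H ?J x z)\<^sup>2) \<partial>L) < \<infinity>"
        using le[OF J xS] True by (rule le_less_trans)
      have sq: "integrable L (\<lambda>z. (H ?J x z)\<^sup>2)"
        using fin by (intro integrableI_nonneg) auto
      have [measurable]: "(\<lambda>y. H ?J x (y i)) \<in> borel_measurable (Pi\<^sub>M ?I (\<lambda>_. L))" if "i \<in> ?I" for i
        using that by measurable
      have "(\<integral>\<^sup>+y. u \<gamma> (merge ?J ?I (x, y)) \<partial>Pi\<^sub>M ?I (\<lambda>_. L))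
          = (\<integral>\<^sup>+y. ennreal (1 / real N) * ennreal ((\<Sum>i\<in>?I. H ?J x (y i))\<^sup>2) \<partial>Pi\<^sub>M ?I (\<lambda>_. L))"
        unfolding u_def fold_mean_at_merge[OF x] using N
        by (intro nn_integral_cong) (simp add: power_mult_distrib power2_eq_square flip: ennreal_mult)
      also have "\<dots> = ennreal (1 / real N) * (of_nat (card ?I) * (\<integral>\<^sup>+z. ennreal ((H ?J x z)\<^sup>2) \<partial>L))"
        by (subst nn_integral_cmult, measurable)
           (subst nn_integral_square_sum_centred[OF prob_L _ sq mean[OF J xS True]], auto)
      also have "\<dots> = ennreal (card ?I / real N) * (\<integral>\<^sup>+z. ennreal ((H ?J x z)\<^sup>2) \<partial>L)"
        by (simp add: ennreal_of_nat_eq_real_of_nat mult.assoc[symmetric] flip: ennreal_mult)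
      also have "\<dots> \<le> 1 * W ?J x"
      proof (rule mult_mono)
        have "card ?I \<le> card {1..N}" by (intro card_mono) auto
        then show "ennreal (card ?I / real N) \<le> 1" using N by simp
      qed (use le[OF J xS] in auto)
      finally show ?thesis by simp
    next
      case False
      then have "W ?J x = \<top>" by (simp add: not_less top_unique)
      then show ?thesis by simp
    qed
  qed
  moreover have "sqrt (D * B / real N) < \<bar>t\<bar> \<longleftrightarrow> ennreal (D * B) < ennreal (real N * t\<^sup>2)" for t
  proof -
    have "sqrt (D * B / real N) < \<bar>t\<bar> \<longleftrightarrow> D * B / real N < t\<^sup>2"
      by (metis real_sqrt_abs real_sqrt_less_iff)
    also have "\<dots> \<longleftrightarrow> D * B < real N * t\<^sup>2" using N by (simp add: divide_less_eq mult.commute)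
    finally show ?thesis using B D by (simp add: ennreal_less_iff)
  qed
  ultimately show ?thesis by (simp add: u_def fold_mean_at_fold_map)
qed

text \<open>Only the triangle inequality is used, so averaging gains no factor depending on
  \<open>N\<close>. This serves the terms that are not centred: the product of the two errors and
  \<Delta>.\<close>

lemma fold_mean_L1_bound:
  assumes N: "N > 0"
    and W: "\<And>J. J \<subseteq> {1..N} \<Longrightarrow> W J \<in> borel_measurable (Pi\<^sub>M J (\<lambda>_. S))"
    and le: "\<And>J z. J \<subseteq> {1..N} \<Longrightarrow> z \<in> space (Pi\<^sub>M J (\<lambda>_. S)) \<Longrightarrow>
      (\<integral>\<^sup>+x. ennreal \<bar>H J z x\<bar> \<partial>L) \<le> W J z"
    and B: "0 \<le> B" and D: "0 < D"
  shows "\<P>(\<omega> in P. D * B < \<bar>fold_mean k H \<omega>\<bar>)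
    \<le> \<P>(\<omega> in P. ennreal B < W (training k \<omega>) (training_data k \<omega>)) + 1 / D"
proof -
  define u where "u \<gamma> z = ennreal \<bar>fold_mean_at k H \<gamma> z\<bar>" for \<gamma> z
  have "\<P>(\<omega> in P. ennreal (D * B) < u (fold_map \<omega>) (sample \<omega>))
    \<le> \<P>(\<omega> in P. ennreal B < W (training k \<omega>) (training_data k \<omega>)) + 1 / D"
  proof (rule crossfit_Markov[OF N _ W B D])
    fix \<gamma> show "u \<gamma> \<in> borel_measurable (Pi\<^sub>M {1..N} (\<lambda>_. L))"
      unfolding u_def using fold_mean_at_measurable[of k \<gamma>] by measurable
  next
    fix \<gamma> x assume x: "x \<in> space (Pi\<^sub>M (outside \<gamma> k) (\<lambda>_. L))"
    let ?J = "outside \<gamma> k" and ?I = "{i\<in>{1..N}. \<gamma> i = k}"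
    have J: "?J \<subseteq> {1..N}" by (auto simp: outside_def)
    have xS: "x \<in> space (Pi\<^sub>M ?J (\<lambda>_. S))" using x sets_eq_imp_space_eq[OF sets_PiM_L] by blast
    note [measurable] = H_section_measurable[OF J x]
    have [measurable]: "(\<lambda>y. H ?J x (y i)) \<in> borel_measurable (Pi\<^sub>M ?I (\<lambda>_. L))" if "i \<in> ?I" for i
      using that by measurable
    have "(\<integral>\<^sup>+y. u \<gamma> (merge ?J ?I (x, y)) \<partial>Pi\<^sub>M ?I (\<lambda>_. L))
        \<le> (\<integral>\<^sup>+y. ennreal (1 / real N) * (\<Sum>i\<in>?I. ennreal \<bar>H ?J x (y i)\<bar>) \<partial>Pi\<^sub>M ?I (\<lambda>_. L))"
    proof (rule nn_integral_mono)
      fix y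
      have "\<bar>(1 / real N) * (\<Sum>i\<in>?I. H ?J x (y i))\<bar> \<le> (1 / real N) * (\<Sum>i\<in>?I. \<bar>H ?J x (y i)\<bar>)"
        unfolding abs_mult by (intro mult_mono sum_abs) auto
      then have "u \<gamma> (merge ?J ?I (x, y)) \<le> ennreal ((1 / real N) * (\<Sum>i\<in>?I. \<bar>H ?J x (y i)\<bar>))"
        unfolding u_def fold_mean_at_merge[OF x] by (rule ennreal_leI)
      also have "\<dots> = ennreal (1 / real N) * (\<Sum>i\<in>?I. ennreal \<bar>H ?J x (y i)\<bar>)"
        by (subst ennreal_mult) (auto intro!: sum_nonneg simp: sum_ennreal)
      finally show "u \<gamma> (merge ?J ?I (x, y)) \<le> ennreal (1 / real N) * (\<Sum>i\<in>?I. ennreal \<bar>H ?J x (y i)\<bar>)" .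
    qed
    also have "\<dots> = ennreal (1 / real N) * (of_nat (card ?I) * (\<integral>\<^sup>+z. ennreal \<bar>H ?J x z\<bar> \<partial>L))"
      by (subst nn_integral_cmult, measurable)
         (subst nn_integral_sum_components[OF prob_L, where h = "\<lambda>z. ennreal \<bar>H ?J x z\<bar>"], auto)
    also have "\<dots> = ennreal (card ?I / real N) * (\<integral>\<^sup>+z. ennreal \<bar>H ?J x z\<bar> \<partial>L)"
      by (simp add: ennreal_of_nat_eq_real_of_nat mult.assoc[symmetric] flip: ennreal_mult)
    also have "\<dots> \<le> 1 * W ?J x"
    proof (rule mult_mono)
      have "card ?I \<le> card {1..N}" by (intro card_mono) auto
      then show "ennreal (card ?I / real N) \<le> 1" using N by simp
    qed (use le[OF J xS] in auto)
    finally show "(\<integral>\<^sup>+y. u \<gamma> (merge ?J ?I (x, y)) \<partial>Pi\<^sub>M ?I (\<lambda>_. L)) \<le> W ?J x" by simp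
  qed
  moreover have "D * B < \<bar>t\<bar> \<longleftrightarrow> ennreal (D * B) < ennreal \<bar>t\<bar>" for t :: real
    using B D by (simp add: ennreal_less_iff)
  ultimately show ?thesis by (simp add: u_def fold_mean_at_fold_map)
qed

end

definition total_mean :: "(nat set \<Rightarrow> (nat \<Rightarrow> 's) \<Rightarrow> 's \<Rightarrow> real) \<Rightarrow> 'w \<Rightarrow> real" where
  "total_mean H \<omega> = (1 / real N) *
     (\<Sum>i=1..N. H (training (g i \<omega>) \<omega>) (training_data (g i \<omega>) \<omega>) (Z i \<omega>))"

lemma total_mean_eq_sum_fold_mean:
  assumes "\<omega> \<in> space P"
  shows "total_mean H \<omega> = (\<Sum>k=1..K. fold_mean k H \<omega>)"
proof -
  have g: "(\<lambda>i. g i \<omega>) ` {1..N} \<subseteq> {1..K}"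
    using measurable_space[OF g_measurable assms] by auto
  have "(\<Sum>i=1..N. H (training (g i \<omega>) \<omega>) (training_data (g i \<omega>) \<omega>) (Z i \<omega>))
      = (\<Sum>k=1..K. \<Sum>i\<in>{i\<in>{1..N}. g i \<omega> = k}. H (training (g i \<omega>) \<omega>) (training_data (g i \<omega>) \<omega>) (Z i \<omega>))"
    by (rule sum.group[OF _ _ g, symmetric]) auto
  also have "\<dots> = (\<Sum>k=1..K. \<Sum>i\<in>{i\<in>{1..N}. g i \<omega> = k}. H (training k \<omega>) (training_data k \<omega>) (Z i \<omega>))"
    by (intro sum.cong) auto
  finally show ?thesis by (simp add: total_mean_def fold_mean_def sum_distrib_left)
qed

lemma total_mean_measurable:
  assumes "\<And>J. J \<subseteq> {1..N} \<Longrightarrow> (\<lambda>(z, x). H J z x) \<in> borel_measurable (Pi\<^sub>M J (\<lambda>_. S) \<Otimes>\<^sub>M S)"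
  shows "total_mean H \<in> borel_measurable P"
proof -
  have "(\<lambda>\<omega>. \<Sum>k=1..K. fold_mean k H \<omega>) \<in> borel_measurable P"
    by (intro borel_measurable_sum fold_mean_measurable assms)
  then show ?thesis
    by (rule measurable_cong[THEN iffD1, rotated]) (rule total_mean_eq_sum_fold_mean[symmetric])
qed

end

section \<open>Stochastic order of cross-fitted averages\<close>

locale crossfit_seq = prob_seq P for P :: "nat \<Rightarrow> 'w measure" +
  fixes K :: nat and S L :: "nat \<Rightarrow> 's measure" and Z :: "nat \<Rightarrow> nat \<Rightarrow> 'w \<Rightarrow> 's"
    and g :: "nat \<Rightarrow> nat \<Rightarrow> 'w \<Rightarrow> nat"
  assumes crossfit: "\<And>N. crossfit (P N) N K (S N) (L N) (Z N) (g N)"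
begin

sublocale CF: crossfit "P N" N K "S N" "L N" "Z N" "g N" for N
  by (rule crossfit)

lemma Op_total_mean:
  assumes fold: "\<And>k. k \<in> {1..K} \<Longrightarrow> Op P (\<lambda>N. CF.fold_mean N k (H N)) b"
    and H: "\<And>N J. J \<subseteq> {1..N} \<Longrightarrow> (\<lambda>(z, x). H N J z x) \<in> borel_measurable (Pi\<^sub>M J (\<lambda>_. S N) \<Otimes>\<^sub>M S N)"
    and b: "\<And>N. 0 \<le> b N"
  shows "Op P (\<lambda>N. CF.total_mean N (H N)) b"
proof (rule Op_AE_le)
  show "Op P (\<lambda>N \<omega>. \<Sum>k=1..K. CF.fold_mean N k (H N) \<omega>) b"
    by (rule Op_sum) (use fold b CF.fold_mean_measurable[OF H] in auto)
  show "(\<lambda>\<omega>. \<Sum>k=1..K. CF.fold_mean N k (H N) \<omega>) \<in> borel_measurable (P N)" for N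
    by (intro borel_measurable_sum CF.fold_mean_measurable H)
  show "\<forall>\<^sub>F N in sequentially. AE \<omega> in P N.
      \<bar>CF.total_mean N (H N) \<omega>\<bar> \<le> \<bar>\<Sum>k=1..K. CF.fold_mean N k (H N) \<omega>\<bar>"
    by (intro always_eventually allI AE_I2) (simp only: CF.total_mean_eq_sum_fold_mean order_refl)
qed

text \<open>A conditional second moment of order \<open>b\<close> turns into an average of order
  \<open>sqrt (b / N)\<close>, fold by fold; the number \<open>K\<close> of folds is fixed, so
  adding the folds keeps the order.\<close>

lemma Op_total_mean_centred:
  assumes H: "\<And>N J. J \<subseteq> {1..N} \<Longrightarrow> (\<lambda>(z, x). H N J z x) \<in> borel_measurable (Pi\<^sub>M J (\<lambda>_. S N) \<Otimes>\<^sub>M S N)"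
    and W: "\<And>N J. J \<subseteq> {1..N} \<Longrightarrow> W N J \<in> borel_measurable (Pi\<^sub>M J (\<lambda>_. S N))"
    and le: "\<And>N J z. J \<subseteq> {1..N} \<Longrightarrow> z \<in> space (Pi\<^sub>M J (\<lambda>_. S N)) \<Longrightarrow>
      (\<integral>\<^sup>+x. ennreal ((H N J z x)\<^sup>2) \<partial>L N) \<le> W N J z"
    and mean: "\<And>N J z. J \<subseteq> {1..N} \<Longrightarrow> z \<in> space (Pi\<^sub>M J (\<lambda>_. S N)) \<Longrightarrow> W N J z < \<infinity> \<Longrightarrow>
      (\<integral>x. H N J z x \<partial>L N) = 0"
    and rate: "\<And>k. k \<in> {1..K} \<Longrightarrow>
      Op_nn P (\<lambda>N \<omega>. W N (CF.training N k \<omega>) (CF.training_data N k \<omega>)) b"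
    and b: "\<And>N. 0 \<le> b N"
  shows "Op P (\<lambda>N. CF.total_mean N (H N)) (\<lambda>N. sqrt (b N / real N))"
proof (rule Op_total_mean[OF _ H])
  fix k assume k: "k \<in> {1..K}"
  show "Op P (\<lambda>N. CF.fold_mean N k (H N)) (\<lambda>N. sqrt (b N / real N))"
    unfolding Op_def
  proof (intro allI impI)
    fix \<epsilon> :: real assume \<epsilon>: "\<epsilon> > 0"
    then obtain C where C: "C > 0" "\<forall>\<^sub>F N in sequentially.
        \<P>(\<omega> in P N. W N (CF.training N k \<omega>) (CF.training_data N k \<omega>) > ennreal (C * b N)) < \<epsilon> / 2"
      using rate[OF k] unfolding Op_nn_def by (meson half_gt_zero)
    \<comment> \<open>Half of \<epsilon> is spent on a large training error and half,
      \<open>1 / D\<close>, on the conditional Markov inequality.\<close>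
    define D where "D = 2 / \<epsilon>"
    have D: "D > 0" "1 / D = \<epsilon> / 2" using \<epsilon> by (auto simp: D_def)
    from C(2) eventually_gt_at_top[of 0]
    have "\<forall>\<^sub>F N in sequentially.
        \<P>(\<omega> in P N. \<bar>CF.fold_mean N k (H N) \<omega>\<bar> > sqrt (D * C) * sqrt (b N / real N)) < \<epsilon>"
    proof eventually_elim
      case (elim N)
      have "sqrt (D * C) * sqrt (b N / real N) = sqrt (D * (C * b N) / real N)"
        by (simp add: mult.assoc flip: real_sqrt_mult)
      then show ?case
        using CF.fold_mean_centred_bound[OF H elim(2) W le mean, of "C * b N" D k] elim(1) D C(1) b[of N]
        by simp
    qed
    with D C(1) show "\<exists>C>0. \<forall>\<^sub>F N in sequentially.
        \<P>(\<omega> in P N. \<bar>CF.fold_mean N k (H N) \<omega>\<bar> > C * sqrt (b N / real N)) < \<epsilon>"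
      by (intro exI[of _ "sqrt (D * C)"]) auto
  qed
qed (use b in auto)

lemma Op_total_mean_L1:
  assumes H: "\<And>N J. J \<subseteq> {1..N} \<Longrightarrow> (\<lambda>(z, x). H N J z x) \<in> borel_measurable (Pi\<^sub>M J (\<lambda>_. S N) \<Otimes>\<^sub>M S N)"
    and W: "\<And>N J. J \<subseteq> {1..N} \<Longrightarrow> W N J \<in> borel_measurable (Pi\<^sub>M J (\<lambda>_. S N))"
    and le: "\<And>N J z. J \<subseteq> {1..N} \<Longrightarrow> z \<in> space (Pi\<^sub>M J (\<lambda>_. S N)) \<Longrightarrow>
      (\<integral>\<^sup>+x. ennreal \<bar>H N J z x\<bar> \<partial>L N) \<le> W N J z"
    and rate: "\<And>k. k \<in> {1..K} \<Longrightarrow>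
      Op_nn P (\<lambda>N \<omega>. W N (CF.training N k \<omega>) (CF.training_data N k \<omega>)) b"
    and b: "\<And>N. 0 \<le> b N"
  shows "Op P (\<lambda>N. CF.total_mean N (H N)) b"
proof (rule Op_total_mean[OF _ H])
  fix k assume k: "k \<in> {1..K}"
  show "Op P (\<lambda>N. CF.fold_mean N k (H N)) b"
    unfolding Op_def
  proof (intro allI impI)
    fix \<epsilon> :: real assume \<epsilon>: "\<epsilon> > 0"
    then obtain C where C: "C > 0" "\<forall>\<^sub>F N in sequentially.
        \<P>(\<omega> in P N. W N (CF.training N k \<omega>) (CF.training_data N k \<omega>) > ennreal (C * b N)) < \<epsilon> / 2"
      using rate[OF k] unfolding Op_nn_def by (meson half_gt_zero)
    define D where "D = 2 / \<epsilon>"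
    have D: "D > 0" "1 / D = \<epsilon> / 2" using \<epsilon> by (auto simp: D_def)
    from C(2) eventually_gt_at_top[of 0]
    have "\<forall>\<^sub>F N in sequentially.
        \<P>(\<omega> in P N. \<bar>CF.fold_mean N k (H N) \<omega>\<bar> > (D * C) * b N) < \<epsilon>"
    proof eventually_elim
      case (elim N)
      show ?case
        using CF.fold_mean_L1_bound[OF H elim(2) W le, of "C * b N" D k] elim(1) D C(1) b[of N]
        by (simp add: mult.assoc)
    qed
    with D C(1) show "\<exists>C>0. \<forall>\<^sub>F N in sequentially.
        \<P>(\<omega> in P N. \<bar>CF.fold_mean N k (H N) \<omega>\<bar> > C * b N) < \<epsilon>"
      by (intro exI[of _ "D * C"]) auto
  qed
qed (use b in auto)

end

section \<open>Moments under ignorability\<close>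

text \<open>Only countably many boxes have rational centre and radius, and every point outside the
  support lies in one of measure zero. Bounds assumed on the support thereby become almost sure
  bounds.\<close>

lemma AE_covariate_support:
  assumes PX: "prob_space PX" and sets[measurable_cong]: "sets PX = sets (covariate_space p)"
  shows "AE x in PX. x \<in> covariate_support p PX"
proof -
  interpret prob_space PX by (rule PX)
  let ?S = "covariate_space p"
  define box where "box c r = {y \<in> space ?S. \<forall>j<p. \<bar>y j - c j\<bar> < r}" for c :: covariate and r :: real
  have box[measurable]: "box c r \<in> sets PX" for c r
  proof -
    have "box c r = {y \<in> space ?S. \<forall>j\<in>{..<p}. \<bar>y j - c j\<bar> < r}" by (auto simp: box_def)
    also have "\<dots> \<in> sets ?S" by measurable
    finally show ?thesis using sets by simp
  qed
  define \<N> where "\<N> = {(c, r). c \<in> {..<p} \<rightarrow>\<^sub>E \<rat> \<and> r \<in> \<rat> \<and> measure PX (box c r) = 0}"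
  have "countable \<N>"
  proof (rule countable_subset)
    show "\<N> \<subseteq> ({..<p} \<rightarrow>\<^sub>E \<rat>) \<times> \<rat>" by (auto simp: \<N>_def)
    show "countable (({..<p} \<rightarrow>\<^sub>E (\<rat> :: real set)) \<times> (\<rat> :: real set))"
      by (intro countable_SIGMA countable_PiE countable_rat) auto
  qed
  then have null: "(\<Union>i\<in>\<N>. box (fst i) (snd i)) \<in> null_sets PX"
  proof (rule null_sets_UN')
    fix i assume "i \<in> \<N>"
    then have "measure PX (box (fst i) (snd i)) = 0" by (simp add: \<N>_def split_beta)
    then show "box (fst i) (snd i) \<in> null_sets PX"
      by (intro null_setsI box) (simp add: emeasure_eq_measure)
  qed
  have "x \<in> (\<Union>i\<in>\<N>. box (fst i) (snd i))" if x: "x \<in> space PX" "x \<notin> covariate_support p PX" for x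
  proof -
    have xS: "x \<in> space ?S" using x(1) sets_eq_imp_space_eq[OF sets] by simp
    then obtain \<epsilon> where \<epsilon>: "\<epsilon> > 0" "measure PX (box x \<epsilon>) = 0"
      using x(2) by (force simp: covariate_support_def box_def zero_less_measure_iff)
    \<comment> \<open>Half of \<epsilon>, because the rational box is centred near \<open>x\<close>
      and not at \<open>x\<close>: with centre and radius both within \<open>r\<close>, it stays
      inside the \<epsilon>-box around \<open>x\<close>.\<close>
    obtain r where r: "r \<in> \<rat>" "0 < r" "r < \<epsilon> / 2"
      using Rats_dense_in_real[of 0 "\<epsilon> / 2"] \<epsilon>(1) by auto
    have "\<exists>q\<in>\<rat>. \<bar>x j - q\<bar> < r" for j
      using Rats_dense_in_real[of "x j" "x j + r"] r(2) by force
    then obtain q where q: "\<And>j. q j \<in> \<rat>" "\<And>j. \<bar>x j - q j\<bar> < r" by metis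
    \<comment> \<open>Restricting to \<open>{..<p}\<close> makes the centre an element of the
      countable product of rationals.\<close>
    define c where "c = restrict q {..<p}"
    have "box c r \<subseteq> box x \<epsilon>"
    proof
      fix y assume y: "y \<in> box c r"
      have "\<bar>y j - x j\<bar> < \<epsilon>" if "j < p" for j
      proof -
        have "\<bar>y j - q j\<bar> < r" using y that by (auto simp: box_def c_def)
        then show ?thesis using q(2)[of j] r(3) by linarith
      qed
      then show "y \<in> box x \<epsilon>" using y by (auto simp: box_def)
    qed
    then have "measure PX (box c r) \<le> measure PX (box x \<epsilon>)" by (intro finite_measure_mono) auto
    then have "measure PX (box c r) = 0" using \<epsilon>(2) by (simp add: antisym)
    moreover have "c \<in> {..<p} \<rightarrow>\<^sub>E \<rat>" unfolding c_def by (intro restrict_PiE[THEN iffD2]) (simp add: q(1))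
    ultimately have "(c, r) \<in> \<N>" using r(1) by (simp add: \<N>_def)
    moreover have "x \<in> box c r" using xS q(2) by (auto simp: box_def c_def)
    ultimately show ?thesis by force
  qed
  then show ?thesis by (intro AE_I'[OF null]) auto
qed

lemma integrable_mult_square:
  fixes f h :: "'a \<Rightarrow> real"
  assumes [measurable]: "f \<in> borel_measurable M" "h \<in> borel_measurable M"
    and "integrable M (\<lambda>\<omega>. (f \<omega>)\<^sup>2)" "integrable M (\<lambda>\<omega>. (h \<omega>)\<^sup>2)"
  shows "integrable M (\<lambda>\<omega>. f \<omega> * h \<omega>)"
proof (rule Bochner_Integration.integrable_bound)
  show "integrable M (\<lambda>\<omega>. (f \<omega>)\<^sup>2 + (h \<omega>)\<^sup>2)" using assms by simp
  show "AE \<omega> in M. norm (f \<omega> * h \<omega>) \<le> norm ((f \<omega>)\<^sup>2 + (h \<omega>)\<^sup>2)"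
  proof (rule AE_I2)
    fix \<omega>
    have "2 * (\<bar>f \<omega>\<bar> * \<bar>h \<omega>\<bar>) \<le> (f \<omega>)\<^sup>2 + (h \<omega>)\<^sup>2"
      using sum_squares_bound[of "\<bar>f \<omega>\<bar>" "\<bar>h \<omega>\<bar>"] by simp
    then have "\<bar>f \<omega>\<bar> * \<bar>h \<omega>\<bar> \<le> (f \<omega>)\<^sup>2 + (h \<omega>)\<^sup>2"
      by (smt (verit) abs_ge_zero mult_nonneg_nonneg)
    then show "norm (f \<omega> * h \<omega>) \<le> norm ((f \<omega>)\<^sup>2 + (h \<omega>)\<^sup>2)" by (simp add: abs_mult)
  qed
qed simp

lemma integrable_diff_square:
  fixes f h :: "'a \<Rightarrow> real"
  assumes [measurable]: "f \<in> borel_measurable M" "h \<in> borel_measurable M"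
    and "integrable M (\<lambda>\<omega>. (f \<omega>)\<^sup>2)" "integrable M (\<lambda>\<omega>. (h \<omega>)\<^sup>2)"
  shows "integrable M (\<lambda>\<omega>. (f \<omega> - h \<omega>)\<^sup>2)"
  using assms integrable_mult_square[OF assms] by (simp add: power2_diff mult.assoc)

text \<open>Used with the propensity limit as \<open>x\<close> and the true propensity as
  \<open>y\<close>: the weight \<open>\<pi> / e\<^sup>2\<close> becomes a multiple of
  \<open>1 / \<pi>\<close>, whose mean defines \<open>a\<close>.\<close>

lemma ratio_sq:
  fixes x y C :: real
  assumes "0 < x" "0 < y" "y / x \<le> C"
  shows "y / x\<^sup>2 \<le> C\<^sup>2 / y"
proof -
  have "y / x\<^sup>2 = (y / x)\<^sup>2 / y" using assms by (simp add: power2_eq_square)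
  also have "\<dots> \<le> C\<^sup>2 / y" using assms by (intro divide_right_mono power_mono) auto
  finally show ?thesis .
qed

text \<open>For \<open>t = 0\<close> both sides are \<open>- 1 / x\<close>, so a vanishing estimate of the propensity needs no care.\<close>

lemma inverse_diff_eq: "x \<noteq> 0 \<Longrightarrow> 1 / t - 1 / x = - (1 - x / t) / x" for x t :: real
  by (cases "t = 0") (auto simp: field_simps)

section \<open>One observation under ignorability\<close>

locale dr_model = prob_space Q for Q :: "'q measure" +
  fixes p :: nat and R Y :: "'q \<Rightarrow> real" and X :: "'q \<Rightarrow> covariate" and PX :: "covariate measure"
    and m \<pi> \<mu> :: "covariate \<Rightarrow> real" and \<theta>0 a s1 s2 :: real
  assumes R_rv[measurable]: "R \<in> borel_measurable Q"
    and R_01: "\<And>\<omega>. \<omega> \<in> space Q \<Longrightarrow> R \<omega> \<in> {0, 1}"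
    and Y_rv[measurable]: "Y \<in> borel_measurable Q"
    and X_rv[measurable]: "X \<in> Q \<rightarrow>\<^sub>M covariate_space p"
    and PX: "PX = distr Q (covariate_space p) X"
    and \<theta>0: "\<theta>0 = (\<integral>\<omega>. Y \<omega> \<partial>Q)"
    and m: "cond_exp_version Q (covariate_space p) X Y m"
    and \<pi>: "cond_exp_version Q (covariate_space p) X (\<lambda>\<omega>. indicator {1} (R \<omega>)) \<pi>"
    and \<pi>_inv: "(\<integral>\<^sup>+x. 1 / ennreal (\<pi> x) \<partial>PX) < \<infinity>"
    and a: "a = 1 / (\<integral>x. 1 / \<pi> x \<partial>PX)"
    and \<mu>_meas[measurable]: "\<mu> \<in> borel_measurable (covariate_space p)"
    and ignorability: "cond_indep_given Q (covariate_space p) X R Y"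
    and s_pos: "s1 > 0" "s2 > 0"
    and basic: "basic_assumption Q p R Y X m \<mu> s1 s2"
begin

abbreviation "S \<equiv> covariate_space p"
abbreviation "F \<equiv> sigma_of Q S X"

definition law :: "observation measure" where
  "law = distr Q (observation_space p) (\<lambda>\<omega>. (R \<omega>, R \<omega> * Y \<omega>, X \<omega>))"

lemma m_meas[measurable]: "m \<in> borel_measurable S"
  using m by (simp add: cond_exp_version_def)

lemma \<pi>_meas[measurable]: "\<pi> \<in> borel_measurable S"
  using \<pi> by (simp add: cond_exp_version_def)

lemma sets_PX[measurable_cong]: "sets PX = sets S"
  by (simp add: PX)

lemma prob_PX: "prob_space PX"
  unfolding PX by (rule prob_space_distr) simp

lemma subalg: "subalgebra Q F"
proof -
  have "X \<in> space Q \<rightarrow> space S" by (auto intro: measurable_space[OF X_rv])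
  then show ?thesis
    by (auto simp: subalgebra_def sets_vimage_algebra2 intro: measurable_sets[OF X_rv])
qed

sublocale F: sigma_finite_subalgebra Q F
  by (rule finite_measure_subalgebra_is_sigma_finite) (unfold_locales, rule subalg)

lemma X_F: "X \<in> F \<rightarrow>\<^sub>M S"
  by (rule measurable_vimage_algebra1) (auto intro: measurable_space[OF X_rv])

lemma comp_X_F: "h \<in> S \<rightarrow>\<^sub>M M' \<Longrightarrow> (\<lambda>\<omega>. h (X \<omega>)) \<in> F \<rightarrow>\<^sub>M M'"
  by (rule measurable_compose[OF X_F])

lemma nn_integral_PX: "h \<in> borel_measurable S \<Longrightarrow> (\<integral>\<^sup>+x. h x \<partial>PX) = (\<integral>\<^sup>+\<omega>. h (X \<omega>) \<partial>Q)"
  unfolding PX by (rule nn_integral_distr) auto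

lemma AE_PX_X: "AE x in PX. T x \<Longrightarrow> AE \<omega> in Q. T (X \<omega>)"
  unfolding PX by (rule AE_distrD[OF X_rv])

text \<open>\<open>ennreal\<close> sends nonpositive reals to 0, and 1 / 0 is infinite there, so the
  finite mean of the inverse propensity excludes nonpositive values almost everywhere.\<close>

lemma \<pi>_pos: "AE x in PX. 0 < \<pi> x"
proof -
  have "AE x in PX. 1 / ennreal (\<pi> x) \<noteq> \<infinity>"
    using \<pi>_inv by (intro nn_integral_PInf_AE) auto
  then show ?thesis
  proof eventually_elim
    case (elim x)
    then show ?case by (auto simp: ennreal_divide_eq_top_iff ennreal_eq_0_iff not_le)
  qed
qed

lemma AE_\<pi>_01: "AE \<omega> in Q. 0 < \<pi> (X \<omega>) \<and> \<pi> (X \<omega>) \<le> 1"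
proof -
  have int: "integrable Q (\<lambda>\<omega>. indicator {1} (R \<omega>) :: real)"
    by (rule integrable_const_bound[where B = 1]) (auto simp: indicator_def)
  have "AE \<omega> in Q. real_cond_exp Q F (\<lambda>\<omega>. indicator {1} (R \<omega>)) \<omega> \<le> 1"
    by (rule F.real_cond_exp_le_c[OF int]) (auto simp: indicator_def)
  moreover have "AE \<omega> in Q. real_cond_exp Q F (\<lambda>\<omega>. indicator {1} (R \<omega>)) \<omega> = \<pi> (X \<omega>)"
    using \<pi> by (simp add: cond_exp_version_def)
  moreover note AE_PX_X[OF \<pi>_pos]
  ultimately show ?thesis by eventually_elim auto
qed

lemma AE_PX_\<pi>_01: "AE x in PX. 0 < \<pi> x \<and> \<pi> x \<le> 1"
  unfolding PX by (subst AE_distr_iff) (use AE_\<pi>_01 in auto)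

text \<open>The integrability hypothesis lives in \<open>ennreal\<close> and \<open>a\<close> in the
  reals; almost sure positivity of \<pi> identifies the two integrals. As \<pi> is at most 1, the
  mean of its inverse is at least 1.\<close>

lemma a_inverse: "(\<integral>\<^sup>+x. ennreal (1 / \<pi> x) \<partial>PX) = ennreal (1 / a)" "0 < a" "a \<le> 1"
proof -
  interpret PX: prob_space PX by (rule prob_PX)
  have eq: "(\<integral>\<^sup>+x. ennreal (1 / \<pi> x) \<partial>PX) = (\<integral>\<^sup>+x. 1 / ennreal (\<pi> x) \<partial>PX)"
    using \<pi>_pos by (intro nn_integral_cong_AE) (auto simp: divide_ennreal[symmetric])
  then have fin: "(\<integral>\<^sup>+x. ennreal (1 / \<pi> x) \<partial>PX) < \<infinity>" using \<pi>_inv by simp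
  have nn: "AE x in PX. 0 \<le> 1 / \<pi> x" using \<pi>_pos by eventually_elim simp
  have int: "integrable PX (\<lambda>x. 1 / \<pi> x)" using nn fin by (intro integrableI_nonneg) auto
  have 1: "(\<integral>\<^sup>+x. ennreal (1 / \<pi> x) \<partial>PX) = ennreal (\<integral>x. 1 / \<pi> x \<partial>PX)"
    by (rule nn_integral_eq_integral[OF int nn])
  have "(\<integral>x. 1 \<partial>PX) \<le> (\<integral>x. 1 / \<pi> x \<partial>PX)"
  proof (rule integral_mono_AE[OF _ int])
    show "AE x in PX. 1 \<le> 1 / \<pi> x" using AE_PX_\<pi>_01 by eventually_elim simp
  qed simp
  then have ge: "1 \<le> (\<integral>x. 1 / \<pi> x \<partial>PX)" by (simp add: PX.prob_space)
  then show "0 < a" "a \<le> 1" "(\<integral>\<^sup>+x. ennreal (1 / \<pi> x) \<partial>PX) = ennreal (1 / a)"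
    by (auto simp: a 1)
qed

text \<open>The indicator of \<open>B\<close> is a function of \<open>X\<close> and passes through
  the conditional expectation. Ignorability then factors the two remaining indicators, the first
  factor is \<open>\<pi>(X)\<close>, and the conditioning on the second is undone.\<close>

lemma nn_integral_R_rectangle:
  assumes [measurable]: "A \<in> sets borel" "B \<in> sets S"
  shows "(\<integral>\<^sup>+\<omega>. ennreal (R \<omega>) * indicator (A \<times> B) (Y \<omega>, X \<omega>) \<partial>Q)
    = (\<integral>\<^sup>+\<omega>. ennreal (\<pi> (X \<omega>)) * indicator (A \<times> B) (Y \<omega>, X \<omega>) \<partial>Q)"
proof -
  define I1 where "I1 = (\<lambda>\<omega>. indicator {1} (R \<omega>) :: real)"
  define I2 where "I2 = (\<lambda>\<omega>. indicator A (Y \<omega>) :: real)"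
  define f where "f = (\<lambda>\<omega>. indicator B (X \<omega>) :: real)"
  have [measurable]: "I1 \<in> borel_measurable Q" "I2 \<in> borel_measurable Q" "f \<in> borel_measurable Q"
    unfolding I1_def I2_def f_def by measurable
  have fF[measurable]: "f \<in> borel_measurable F" unfolding f_def by (rule comp_X_F) simp
  have f\<pi>F[measurable]: "(\<lambda>\<omega>. f \<omega> * \<pi> (X \<omega>)) \<in> borel_measurable F"
    by (intro borel_measurable_times fF comp_X_F \<pi>_meas)
  have b: "\<bar>I1 \<omega>\<bar> \<le> 1" "\<bar>I2 \<omega>\<bar> \<le> 1" "\<bar>f \<omega>\<bar> \<le> 1" for \<omega>
    by (auto simp: I1_def I2_def f_def indicator_def)
  have i1: "integrable Q (\<lambda>\<omega>. f \<omega> * (I1 \<omega> * I2 \<omega>))"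
    by (rule integrable_const_bound[where B = 1])
       (auto simp: I1_def I2_def f_def indicator_def)
  have i2: "integrable Q (\<lambda>\<omega>. (f \<omega> * \<pi> (X \<omega>)) * I2 \<omega>)"
  proof (rule integrable_const_bound[where B = 1])
    show "AE \<omega> in Q. norm ((f \<omega> * \<pi> (X \<omega>)) * I2 \<omega>) \<le> 1"
      using AE_\<pi>_01 by eventually_elim (auto simp: I2_def f_def indicator_def)
  qed simp
  have "(\<integral>\<omega>. f \<omega> * (I1 \<omega> * I2 \<omega>) \<partial>Q) = (\<integral>\<omega>. f \<omega> * real_cond_exp Q F (\<lambda>\<omega>. I1 \<omega> * I2 \<omega>) \<omega> \<partial>Q)"
    by (rule F.real_cond_exp_intg(2)[OF i1, symmetric]) auto
  also have "\<dots> = (\<integral>\<omega>. (f \<omega> * \<pi> (X \<omega>)) * real_cond_exp Q F I2 \<omega> \<partial>Q)"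
  proof (rule integral_cong_AE)
    have "{1} \<in> sets (borel :: real measure)" by simp
    with ignorability assms(1)
    have "AE \<omega> in Q. real_cond_exp Q F (\<lambda>\<omega>. I1 \<omega> * I2 \<omega>) \<omega>
        = real_cond_exp Q F I1 \<omega> * real_cond_exp Q F I2 \<omega>"
      unfolding cond_indep_given_def I1_def I2_def by blast
    moreover have "AE \<omega> in Q. real_cond_exp Q F I1 \<omega> = \<pi> (X \<omega>)"
      using \<pi> by (simp add: cond_exp_version_def I1_def)
    ultimately show "AE \<omega> in Q. f \<omega> * real_cond_exp Q F (\<lambda>\<omega>. I1 \<omega> * I2 \<omega>) \<omega>
        = (f \<omega> * \<pi> (X \<omega>)) * real_cond_exp Q F I2 \<omega>"
      by eventually_elim (simp add: ac_simps)
  qed auto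
  also have "\<dots> = (\<integral>\<omega>. (f \<omega> * \<pi> (X \<omega>)) * I2 \<omega> \<partial>Q)"
    by (rule F.real_cond_exp_intg(2)[OF i2]) auto
  finally have eq: "(\<integral>\<omega>. f \<omega> * (I1 \<omega> * I2 \<omega>) \<partial>Q) = (\<integral>\<omega>. (f \<omega> * \<pi> (X \<omega>)) * I2 \<omega> \<partial>Q)" .
  have "(\<integral>\<^sup>+\<omega>. ennreal (R \<omega>) * indicator (A \<times> B) (Y \<omega>, X \<omega>) \<partial>Q)
      = (\<integral>\<^sup>+\<omega>. ennreal (f \<omega> * (I1 \<omega> * I2 \<omega>)) \<partial>Q)"
    using R_01 by (intro nn_integral_cong) (fastforce simp: f_def I1_def I2_def indicator_def)
  also have "\<dots> = ennreal (\<integral>\<omega>. f \<omega> * (I1 \<omega> * I2 \<omega>) \<partial>Q)"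
    by (rule nn_integral_eq_integral[OF i1]) (auto simp: f_def I1_def I2_def)
  also have "\<dots> = (\<integral>\<^sup>+\<omega>. ennreal ((f \<omega> * \<pi> (X \<omega>)) * I2 \<omega>) \<partial>Q)"
    unfolding eq
  proof (rule nn_integral_eq_integral[OF i2, symmetric])
    show "AE \<omega> in Q. 0 \<le> (f \<omega> * \<pi> (X \<omega>)) * I2 \<omega>"
      using AE_\<pi>_01 by eventually_elim (auto simp: f_def I2_def)
  qed
  also have "\<dots> = (\<integral>\<^sup>+\<omega>. ennreal (\<pi> (X \<omega>)) * indicator (A \<times> B) (Y \<omega>, X \<omega>) \<partial>Q)"
    by (intro nn_integral_cong) (auto simp: f_def I2_def indicator_def)
  finally show ?thesis .
qed

text \<open>Ignorability as an equality of measures for \<open>(Y, X)\<close>, extended from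
  rectangles, which are stable under intersection. From here on the weights \<open>R\<close> and
  \<open>\<pi>(X)\<close> are interchangeable against any function of \<open>(Y, X)\<close>.\<close>

lemma weighted_law_eq:
  "distr (density Q (\<lambda>\<omega>. ennreal (R \<omega>))) (borel \<Otimes>\<^sub>M S) (\<lambda>\<omega>. (Y \<omega>, X \<omega>))
    = distr (density Q (\<lambda>\<omega>. ennreal (\<pi> (X \<omega>)))) (borel \<Otimes>\<^sub>M S) (\<lambda>\<omega>. (Y \<omega>, X \<omega>))"
  (is "distr ?D1 _ _ = distr ?D2 _ _")
proof (rule measure_eqI_generator_eq[OF Int_stable_pair_measure_generator[of borel S]])
  let ?E = "{a \<times> b |a b. a \<in> sets borel \<and> b \<in> sets S}"
  show "?E \<subseteq> Pow (space (borel :: real measure) \<times> space S)"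
    using sets.space_closed[of S] by auto
  have em: "emeasure (distr (density Q w) (borel \<Otimes>\<^sub>M S) (\<lambda>\<omega>. (Y \<omega>, X \<omega>))) (A \<times> B)
      = (\<integral>\<^sup>+\<omega>. w \<omega> * indicator (A \<times> B) (Y \<omega>, X \<omega>) \<partial>Q)"
    if [measurable]: "A \<in> sets borel" "B \<in> sets S" "w \<in> borel_measurable Q" for A B w
    by (subst emeasure_distr, simp, simp, subst emeasure_density, simp, measurable)
       (intro nn_integral_cong, auto simp: indicator_def)
  show "emeasure (distr ?D1 (borel \<Otimes>\<^sub>M S) (\<lambda>\<omega>. (Y \<omega>, X \<omega>))) E
      = emeasure (distr ?D2 (borel \<Otimes>\<^sub>M S) (\<lambda>\<omega>. (Y \<omega>, X \<omega>))) E" if "E \<in> ?E" for E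
    using that by (auto simp: em nn_integral_R_rectangle)
  show "sets (distr ?D1 (borel \<Otimes>\<^sub>M S) (\<lambda>\<omega>. (Y \<omega>, X \<omega>))) = sigma_sets (space borel \<times> space S) ?E"
    "sets (distr ?D2 (borel \<Otimes>\<^sub>M S) (\<lambda>\<omega>. (Y \<omega>, X \<omega>))) = sigma_sets (space borel \<times> space S) ?E"
    by (simp_all add: sets_pair_measure)
  have "UNIV \<times> space S \<in> ?E" by (intro CollectI exI conjI, rule refl) auto
  then show "range (\<lambda>_::nat. UNIV \<times> space S) \<subseteq> ?E" by blast
  show "(\<Union>i::nat. UNIV \<times> space S) = space (borel :: real measure) \<times> space S" by simp
  have "emeasure (distr ?D1 (borel \<Otimes>\<^sub>M S) (\<lambda>\<omega>. (Y \<omega>, X \<omega>))) (UNIV \<times> space S) \<le> (\<integral>\<^sup>+\<omega>. 1 \<partial>Q)"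
  proof (subst em)
    show "(\<integral>\<^sup>+\<omega>. ennreal (R \<omega>) * indicator (UNIV \<times> space S) (Y \<omega>, X \<omega>) \<partial>Q) \<le> (\<integral>\<^sup>+\<omega>. 1 \<partial>Q)"
    proof (rule nn_integral_mono)
      fix \<omega> assume "\<omega> \<in> space Q"
      from R_01[OF this] show "ennreal (R \<omega>) * indicator (UNIV \<times> space S) (Y \<omega>, X \<omega>) \<le> 1"
        by (auto simp: indicator_def)
    qed
  qed auto
  then show "emeasure (distr ?D1 (borel \<Otimes>\<^sub>M S) (\<lambda>\<omega>. (Y \<omega>, X \<omega>))) (UNIV \<times> space S) \<noteq> \<infinity>"
    by (auto simp: emeasure_space_1 top_unique)
qed

lemma nn_integral_R:
  assumes [measurable]: "G \<in> borel_measurable (borel \<Otimes>\<^sub>M S)"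
  shows "(\<integral>\<^sup>+\<omega>. ennreal (R \<omega>) * G (Y \<omega>, X \<omega>) \<partial>Q) = (\<integral>\<^sup>+\<omega>. ennreal (\<pi> (X \<omega>)) * G (Y \<omega>, X \<omega>) \<partial>Q)"
  using arg_cong[OF weighted_law_eq, of "\<lambda>M. \<integral>\<^sup>+x. G x \<partial>M"]
  by (simp add: nn_integral_distr nn_integral_density)

text \<open>Since the measures agree, integrability transfers as well; if it fails, both Bochner
  integrals take the default value 0.\<close>

lemma integral_R:
  fixes G :: "real \<times> covariate \<Rightarrow> real"
  assumes [measurable]: "G \<in> borel_measurable (borel \<Otimes>\<^sub>M S)"
  shows "integrable Q (\<lambda>\<omega>. R \<omega> * G (Y \<omega>, X \<omega>)) \<longleftrightarrow> integrable Q (\<lambda>\<omega>. \<pi> (X \<omega>) * G (Y \<omega>, X \<omega>))"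
    and "(\<integral>\<omega>. R \<omega> * G (Y \<omega>, X \<omega>) \<partial>Q) = (\<integral>\<omega>. \<pi> (X \<omega>) * G (Y \<omega>, X \<omega>) \<partial>Q)"
proof -
  have R: "AE \<omega> in Q. 0 \<le> R \<omega>" using R_01 by (intro AE_I2) force
  have \<pi>: "AE \<omega> in Q. 0 \<le> \<pi> (X \<omega>)" using AE_\<pi>_01 by eventually_elim auto
  show "integrable Q (\<lambda>\<omega>. R \<omega> * G (Y \<omega>, X \<omega>)) \<longleftrightarrow> integrable Q (\<lambda>\<omega>. \<pi> (X \<omega>) * G (Y \<omega>, X \<omega>))"
    using arg_cong[OF weighted_law_eq, of "\<lambda>M. integrable M G"] R \<pi>
    by (simp add: integrable_distr_eq integrable_density)
  show "(\<integral>\<omega>. R \<omega> * G (Y \<omega>, X \<omega>) \<partial>Q) = (\<integral>\<omega>. \<pi> (X \<omega>) * G (Y \<omega>, X \<omega>) \<partial>Q)"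
    using arg_cong[OF weighted_law_eq, of "\<lambda>M. \<integral>x. G x \<partial>M"] R \<pi>
    by (simp add: integral_distr integral_density)
qed

lemma AE_support_X: "AE \<omega> in Q. X \<omega> \<in> covariate_support p PX"
  by (rule AE_PX_X, rule AE_covariate_support[OF prob_PX sets_PX])

text \<open>The weight is a function of \<open>X\<close>, so the squared residual may be replaced by
  its conditional mean, which is bounded on the support, where \<open>X\<close> lies almost
  surely.\<close>

lemma second_moment_\<mu>:
  assumes [measurable]: "h \<in> borel_measurable S"
  shows "(\<integral>\<^sup>+\<omega>. h (X \<omega>) * ennreal ((Y \<omega> - \<mu> (X \<omega>))\<^sup>2) \<partial>Q) \<le> ennreal (s2\<^sup>2) * (\<integral>\<^sup>+\<omega>. h (X \<omega>) \<partial>Q)"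
proof -
  obtain v where v: "nn_cond_exp_version Q S X (\<lambda>\<omega>. ennreal ((Y \<omega> - \<mu> (X \<omega>))\<^sup>2)) v"
    "\<And>x. x \<in> covariate_support p PX \<Longrightarrow> v x \<le> ennreal (s2\<^sup>2)"
    using basic unfolding basic_assumption_def Let_def PX by blast
  then have [measurable]: "v \<in> borel_measurable S"
    and ae: "AE \<omega> in Q. nn_cond_exp Q F (\<lambda>\<omega>. ennreal ((Y \<omega> - \<mu> (X \<omega>))\<^sup>2)) \<omega> = v (X \<omega>)"
    by (auto simp: nn_cond_exp_version_def)
  have "(\<integral>\<^sup>+\<omega>. h (X \<omega>) * ennreal ((Y \<omega> - \<mu> (X \<omega>))\<^sup>2) \<partial>Q)
      = (\<integral>\<^sup>+\<omega>. h (X \<omega>) * nn_cond_exp Q F (\<lambda>\<omega>. ennreal ((Y \<omega> - \<mu> (X \<omega>))\<^sup>2)) \<omega> \<partial>Q)"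
    by (rule F.nn_cond_exp_intg[symmetric]) (auto intro: comp_X_F)
  also have "\<dots> \<le> (\<integral>\<^sup>+\<omega>. ennreal (s2\<^sup>2) * h (X \<omega>) \<partial>Q)"
    using ae AE_support_X
    by (intro nn_integral_mono_AE, eventually_elim) (auto simp: mult.commute intro!: mult_left_mono v(2))
  also have "\<dots> = ennreal (s2\<^sup>2) * (\<integral>\<^sup>+\<omega>. h (X \<omega>) \<partial>Q)" by (rule nn_integral_cmult) simp
  finally show ?thesis .
qed

lemma second_moment_m_lower:
  assumes [measurable]: "h \<in> borel_measurable S"
  shows "ennreal (s1\<^sup>2) * (\<integral>\<^sup>+\<omega>. h (X \<omega>) \<partial>Q) \<le> (\<integral>\<^sup>+\<omega>. h (X \<omega>) * ennreal ((Y \<omega> - m (X \<omega>))\<^sup>2) \<partial>Q)"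
proof -
  obtain v where v: "nn_cond_exp_version Q S X (\<lambda>\<omega>. ennreal ((Y \<omega> - m (X \<omega>))\<^sup>2)) v"
    "\<And>x. x \<in> covariate_support p PX \<Longrightarrow> ennreal (s1\<^sup>2) \<le> v x"
    using basic unfolding basic_assumption_def Let_def PX by blast
  then have [measurable]: "v \<in> borel_measurable S"
    and ae: "AE \<omega> in Q. nn_cond_exp Q F (\<lambda>\<omega>. ennreal ((Y \<omega> - m (X \<omega>))\<^sup>2)) \<omega> = v (X \<omega>)"
    by (auto simp: nn_cond_exp_version_def)
  have "ennreal (s1\<^sup>2) * (\<integral>\<^sup>+\<omega>. h (X \<omega>) \<partial>Q) = (\<integral>\<^sup>+\<omega>. ennreal (s1\<^sup>2) * h (X \<omega>) \<partial>Q)"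
    by (rule nn_integral_cmult[symmetric]) simp
  also have "\<dots> \<le> (\<integral>\<^sup>+\<omega>. h (X \<omega>) * nn_cond_exp Q F (\<lambda>\<omega>. ennreal ((Y \<omega> - m (X \<omega>))\<^sup>2)) \<omega> \<partial>Q)"
    using ae AE_support_X
    by (intro nn_integral_mono_AE, eventually_elim) (auto simp: mult.commute intro!: mult_left_mono v(2))
  also have "\<dots> = (\<integral>\<^sup>+\<omega>. h (X \<omega>) * ennreal ((Y \<omega> - m (X \<omega>))\<^sup>2) \<partial>Q)"
    by (rule F.nn_cond_exp_intg) (auto intro: comp_X_F)
  finally show ?thesis .
qed

lemma Y_sq: "integrable Q (\<lambda>\<omega>. (Y \<omega>)\<^sup>2)"
  using basic by (auto simp: basic_assumption_def Let_def)

lemma Y_int: "integrable Q Y"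
  by (rule square_integrable_imp_integrable[OF _ Y_sq]) simp

lemma m_AE: "AE \<omega> in Q. real_cond_exp Q F Y \<omega> = m (X \<omega>)"
  using m by (simp add: cond_exp_version_def)

text \<open>Conditional Jensen: the square of the conditional mean of \<open>Y\<close> is at most
  the conditional mean of the square.\<close>

lemma m_sq: "integrable Q (\<lambda>\<omega>. (m (X \<omega>))\<^sup>2)"
proof (rule Bochner_Integration.integrable_bound)
  show "integrable Q (real_cond_exp Q F (\<lambda>\<omega>. (Y \<omega>)\<^sup>2))"
    by (rule F.real_cond_exp_int(1)[OF Y_sq])
  have "AE \<omega> in Q. (real_cond_exp Q F Y \<omega>)\<^sup>2 \<le> real_cond_exp Q F (\<lambda>\<omega>. (Y \<omega>)\<^sup>2) \<omega>"
    by (rule F.real_cond_exp_jensens_inequality(2)[where I = UNIV])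
       (use Y_int Y_sq convex_power2 in auto)
  with m_AE show "AE \<omega> in Q. norm ((m (X \<omega>))\<^sup>2) \<le> norm (real_cond_exp Q F (\<lambda>\<omega>. (Y \<omega>)\<^sup>2) \<omega>)"
    by eventually_elim auto
qed simp

lemma regression_orthogonal:
  assumes [measurable]: "h \<in> borel_measurable S" and h: "integrable Q (\<lambda>\<omega>. (h (X \<omega>))\<^sup>2)"
  shows "integrable Q (\<lambda>\<omega>. h (X \<omega>) * (Y \<omega> - m (X \<omega>)))"
    and "(\<integral>\<omega>. h (X \<omega>) * (Y \<omega> - m (X \<omega>)) \<partial>Q) = 0"
proof -
  have i1: "integrable Q (\<lambda>\<omega>. h (X \<omega>) * Y \<omega>)" by (rule integrable_mult_square[OF _ _ h Y_sq]) auto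
  have i2: "integrable Q (\<lambda>\<omega>. h (X \<omega>) * m (X \<omega>))" by (rule integrable_mult_square[OF _ _ h m_sq]) auto
  have "(\<integral>\<omega>. h (X \<omega>) * Y \<omega> \<partial>Q) = (\<integral>\<omega>. h (X \<omega>) * real_cond_exp Q F Y \<omega> \<partial>Q)"
    by (rule F.real_cond_exp_intg(2)[OF i1, symmetric]) (auto intro: comp_X_F)
  also have "\<dots> = (\<integral>\<omega>. h (X \<omega>) * m (X \<omega>) \<partial>Q)"
    by (rule integral_cong_AE) (use m_AE in \<open>auto elim!: eventually_mono\<close>)
  finally show "(\<integral>\<omega>. h (X \<omega>) * (Y \<omega> - m (X \<omega>)) \<partial>Q) = 0"
    using i1 i2 by (simp add: right_diff_distrib)
  show "integrable Q (\<lambda>\<omega>. h (X \<omega>) * (Y \<omega> - m (X \<omega>)))"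
    using i1 i2 by (simp add: right_diff_distrib)
qed

lemma residual_\<mu>_bound: "(\<integral>\<^sup>+\<omega>. ennreal ((Y \<omega> - \<mu> (X \<omega>))\<^sup>2) \<partial>Q) \<le> ennreal (s2\<^sup>2)"
  using second_moment_\<mu>[of "\<lambda>_. 1"] by (simp add: emeasure_space_1)

lemma residual_\<mu>_sq: "integrable Q (\<lambda>\<omega>. (Y \<omega> - \<mu> (X \<omega>))\<^sup>2)"
  using residual_\<mu>_bound by (intro integrableI_nonneg) (auto intro: le_less_trans)

text \<open>\<open>\<mu>(X)\<close> is the difference of \<open>Y\<close> and its residual, both
  square integrable.\<close>

lemma \<mu>_sq: "integrable Q (\<lambda>\<omega>. (\<mu> (X \<omega>))\<^sup>2)"
  using integrable_diff_square[OF _ _ Y_sq residual_\<mu>_sq] by simp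

text \<open>
  \<open>m(X)\<close> is the projection of \<open>Y\<close>, so its residual inherits the bound assumed for \<open>\<mu>\<close>.  For bounded
  \<open>h\<close> the cross term is integrable, with integral 0; truncation extends the bound to all \<open>h \<ge> 0\<close>.
\<close>

lemma second_moment_m_bounded:
  assumes [measurable]: "h \<in> borel_measurable S" and h: "\<And>x. 0 \<le> h x" "\<And>x. h x \<le> (c :: real)"
  shows "(\<integral>\<^sup>+\<omega>. ennreal (h (X \<omega>)) * ennreal ((Y \<omega> - m (X \<omega>))\<^sup>2) \<partial>Q)
    \<le> ennreal (s2\<^sup>2) * (\<integral>\<^sup>+\<omega>. ennreal (h (X \<omega>)) \<partial>Q)"
proof -
  have c: "0 \<le> c" using h[of undefined] by linarith
  have bd: "integrable Q (\<lambda>\<omega>. h (X \<omega>) * u \<omega>)" if "integrable Q u" for u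
  proof (rule Bochner_Integration.integrable_bound)
    show "integrable Q (\<lambda>\<omega>. c * u \<omega>)" using that by simp
    show "AE \<omega> in Q. norm (h (X \<omega>) * u \<omega>) \<le> norm (c * u \<omega>)"
      using h c by (auto simp: abs_mult intro!: mult_right_mono)
  qed (use that in measurable)
  have sqm: "integrable Q (\<lambda>\<omega>. (Y \<omega> - m (X \<omega>))\<^sup>2)"
    by (rule integrable_diff_square[OF _ _ Y_sq m_sq]) auto
  have sqd: "integrable Q (\<lambda>\<omega>. (m (X \<omega>) - \<mu> (X \<omega>))\<^sup>2)"
    by (rule integrable_diff_square[OF _ _ m_sq \<mu>_sq]) auto
  let ?k = "\<lambda>x. h x * (m x - \<mu> x)"
  have k: "integrable Q (\<lambda>\<omega>. (?k (X \<omega>))\<^sup>2)"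
  proof (rule Bochner_Integration.integrable_bound)
    show "integrable Q (\<lambda>\<omega>. c\<^sup>2 * (m (X \<omega>) - \<mu> (X \<omega>))\<^sup>2)" using sqd by simp
    show "AE \<omega> in Q. norm ((?k (X \<omega>))\<^sup>2) \<le> norm (c\<^sup>2 * (m (X \<omega>) - \<mu> (X \<omega>))\<^sup>2)"
      using h c by (auto simp: power_mult_distrib intro!: mult_right_mono power_mono)
  qed simp
  have orth: "integrable Q (\<lambda>\<omega>. ?k (X \<omega>) * (Y \<omega> - m (X \<omega>)))" "(\<integral>\<omega>. ?k (X \<omega>) * (Y \<omega> - m (X \<omega>)) \<partial>Q) = 0"
    by (rule regression_orthogonal[OF _ k], simp)+
  have "h (X \<omega>) * (Y \<omega> - \<mu> (X \<omega>))\<^sup>2 = h (X \<omega>) * (Y \<omega> - m (X \<omega>))\<^sup>2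
      + 2 * (?k (X \<omega>) * (Y \<omega> - m (X \<omega>))) + h (X \<omega>) * (m (X \<omega>) - \<mu> (X \<omega>))\<^sup>2" for \<omega>
    by (simp add: power2_eq_square algebra_simps)
  then have "(\<integral>\<omega>. h (X \<omega>) * (Y \<omega> - \<mu> (X \<omega>))\<^sup>2 \<partial>Q)
      = (\<integral>\<omega>. h (X \<omega>) * (Y \<omega> - m (X \<omega>))\<^sup>2 \<partial>Q) + (\<integral>\<omega>. h (X \<omega>) * (m (X \<omega>) - \<mu> (X \<omega>))\<^sup>2 \<partial>Q)"
    using bd[OF sqm] bd[OF sqd] orth by simp
  moreover have "0 \<le> (\<integral>\<omega>. h (X \<omega>) * (m (X \<omega>) - \<mu> (X \<omega>))\<^sup>2 \<partial>Q)"
    using h by (intro Bochner_Integration.integral_nonneg) auto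
  ultimately have le: "(\<integral>\<omega>. h (X \<omega>) * (Y \<omega> - m (X \<omega>))\<^sup>2 \<partial>Q) \<le> (\<integral>\<omega>. h (X \<omega>) * (Y \<omega> - \<mu> (X \<omega>))\<^sup>2 \<partial>Q)"
    by simp
  have "(\<integral>\<^sup>+\<omega>. ennreal (h (X \<omega>)) * ennreal ((Y \<omega> - m (X \<omega>))\<^sup>2) \<partial>Q)
      = (\<integral>\<^sup>+\<omega>. ennreal (h (X \<omega>) * (Y \<omega> - m (X \<omega>))\<^sup>2) \<partial>Q)"
    using h by (simp add: ennreal_mult)
  also have "\<dots> = ennreal (\<integral>\<omega>. h (X \<omega>) * (Y \<omega> - m (X \<omega>))\<^sup>2 \<partial>Q)"
    by (rule nn_integral_eq_integral[OF bd[OF sqm]]) (use h in auto)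
  also have "\<dots> \<le> ennreal (\<integral>\<omega>. h (X \<omega>) * (Y \<omega> - \<mu> (X \<omega>))\<^sup>2 \<partial>Q)" by (rule ennreal_leI[OF le])
  also have "\<dots> = (\<integral>\<^sup>+\<omega>. ennreal (h (X \<omega>) * (Y \<omega> - \<mu> (X \<omega>))\<^sup>2) \<partial>Q)"
    by (rule nn_integral_eq_integral[OF bd[OF residual_\<mu>_sq], symmetric]) (use h in auto)
  also have "\<dots> = (\<integral>\<^sup>+\<omega>. ennreal (h (X \<omega>)) * ennreal ((Y \<omega> - \<mu> (X \<omega>))\<^sup>2) \<partial>Q)"
    using h by (simp add: ennreal_mult)
  also have "\<dots> \<le> ennreal (s2\<^sup>2) * (\<integral>\<^sup>+\<omega>. ennreal (h (X \<omega>)) \<partial>Q)"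
    by (rule second_moment_\<mu>) simp
  finally show ?thesis .
qed

lemma second_moment_m:
  fixes h :: "covariate \<Rightarrow> real"
  assumes [measurable]: "h \<in> borel_measurable S" and h: "\<And>x. 0 \<le> h x"
  shows "(\<integral>\<^sup>+\<omega>. ennreal (h (X \<omega>)) * ennreal ((Y \<omega> - m (X \<omega>))\<^sup>2) \<partial>Q)
    \<le> ennreal (s2\<^sup>2) * (\<integral>\<^sup>+\<omega>. ennreal (h (X \<omega>)) \<partial>Q)"
proof -
  let ?f = "\<lambda>n \<omega>. ennreal (min (h (X \<omega>)) (real n)) * ennreal ((Y \<omega> - m (X \<omega>))\<^sup>2)"
  have sup: "ennreal (h (X \<omega>)) * ennreal ((Y \<omega> - m (X \<omega>))\<^sup>2) = (SUP n. ?f n \<omega>)" for \<omega>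
  proof (rule antisym)
    obtain n where "h (X \<omega>) \<le> real n" using real_arch_simple by blast
    then have "ennreal (h (X \<omega>)) * ennreal ((Y \<omega> - m (X \<omega>))\<^sup>2) = ?f n \<omega>" by (simp add: min_absorb1)
    also have "\<dots> \<le> (SUP n. ?f n \<omega>)" by (rule SUP_upper) simp
    finally show "ennreal (h (X \<omega>)) * ennreal ((Y \<omega> - m (X \<omega>))\<^sup>2) \<le> (SUP n. ?f n \<omega>)" .
    show "(SUP n. ?f n \<omega>) \<le> ennreal (h (X \<omega>)) * ennreal ((Y \<omega> - m (X \<omega>))\<^sup>2)"
      by (intro SUP_least mult_right_mono ennreal_leI) auto
  qed
  have "(\<integral>\<^sup>+\<omega>. ennreal (h (X \<omega>)) * ennreal ((Y \<omega> - m (X \<omega>))\<^sup>2) \<partial>Q) = (SUP n. \<integral>\<^sup>+\<omega>. ?f n \<omega> \<partial>Q)"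
    unfolding sup
    by (rule nn_integral_monotone_convergence_SUP)
       (auto simp: incseq_def le_fun_def intro!: mult_right_mono ennreal_leI min.mono)
  also have "\<dots> \<le> ennreal (s2\<^sup>2) * (\<integral>\<^sup>+\<omega>. ennreal (h (X \<omega>)) \<partial>Q)"
  proof (rule SUP_least)
    fix n :: nat
    have "(\<integral>\<^sup>+\<omega>. ?f n \<omega> \<partial>Q) \<le> ennreal (s2\<^sup>2) * (\<integral>\<^sup>+\<omega>. ennreal (min (h (X \<omega>)) (real n)) \<partial>Q)"
      by (rule second_moment_m_bounded[where h = "\<lambda>x. min (h x) (real n)" and c = "real n"])
         (use h in auto)
    also have "\<dots> \<le> ennreal (s2\<^sup>2) * (\<integral>\<^sup>+\<omega>. ennreal (h (X \<omega>)) \<partial>Q)"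
      by (intro mult_left_mono nn_integral_mono ennreal_leI) auto
    finally show "(\<integral>\<^sup>+\<omega>. ?f n \<omega> \<partial>Q) \<le> ennreal (s2\<^sup>2) * (\<integral>\<^sup>+\<omega>. ennreal (h (X \<omega>)) \<partial>Q)" .
  qed
  finally show ?thesis .
qed

end

section \<open>Moments of the remainder terms\<close>

context dr_model
begin

lemma observation_measurable[measurable]: "(\<lambda>\<omega>. (R \<omega>, R \<omega> * Y \<omega>, X \<omega>)) \<in> Q \<rightarrow>\<^sub>M observation_space p"
  by measurable

lemma sets_law: "sets law = sets (observation_space p)"
  by (simp add: law_def)

lemma prob_law: "prob_space law"
  unfolding law_def by (rule prob_space_distr) simp

lemma nn_integral_law:
  "G \<in> borel_measurable (observation_space p) \<Longrightarrow>
    (\<integral>\<^sup>+z. G z \<partial>law) = (\<integral>\<^sup>+\<omega>. G (R \<omega>, R \<omega> * Y \<omega>, X \<omega>) \<partial>Q)"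
  unfolding law_def by (rule nn_integral_distr) auto

lemma integral_law:
  fixes G :: "observation \<Rightarrow> real"
  shows "G \<in> borel_measurable (observation_space p) \<Longrightarrow>
    (\<integral>z. G z \<partial>law) = (\<integral>\<omega>. G (R \<omega>, R \<omega> * Y \<omega>, X \<omega>) \<partial>Q)"
  unfolding law_def by (rule integral_distr) auto

text \<open>The weighted mean square in which the rates \<open>c\<mu>\<close> and \<open>ce\<close>
  are expressed.\<close>

definition weighted_sq :: "(covariate \<Rightarrow> real) \<Rightarrow> ennreal" where
  "weighted_sq f = (\<integral>\<^sup>+x. ennreal (a / \<pi> x * (f x)\<^sup>2) \<partial>PX)"

lemma weighted_sq_eq:
  assumes [measurable]: "f \<in> borel_measurable S"
  shows "(\<integral>\<^sup>+\<omega>. ennreal ((f (X \<omega>))\<^sup>2 / \<pi> (X \<omega>)) \<partial>Q) = ennreal (1 / a) * weighted_sq f"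
proof -
  have "ennreal (1 / a) * weighted_sq f = (\<integral>\<^sup>+\<omega>. ennreal (1 / a) * ennreal (a / \<pi> (X \<omega>) * (f (X \<omega>))\<^sup>2) \<partial>Q)"
    unfolding weighted_sq_def by (simp add: nn_integral_PX nn_integral_cmult)
  also have "\<dots> = (\<integral>\<^sup>+\<omega>. ennreal ((f (X \<omega>))\<^sup>2 / \<pi> (X \<omega>)) \<partial>Q)"
    using a_inverse(2) by (intro nn_integral_cong) (simp add: ennreal_mult'[symmetric])
  finally show ?thesis ..
qed

lemma R_cases: "\<omega> \<in> space Q \<Longrightarrow> R \<omega> = 0 \<or> R \<omega> = 1"
  using R_01 by auto

text \<open>As \<open>R\<close> is 0 or 1, the squared factor is at most 1 +
  \<open>R / \<pi>\<^sup>2\<close>. The first part is at most \<open>1 / \<pi>\<close> because \<pi>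
  is at most 1, the second equals it in mean after \<open>R\<close> is exchanged for \<pi>; each
  contributes one \<open>1 / a\<close>.\<close>

lemma imputation_second_moment:
  assumes [measurable]: "f \<in> borel_measurable S"
  shows "(\<integral>\<^sup>+\<omega>. ennreal (((1 - R \<omega> / \<pi> (X \<omega>)) * f (X \<omega>))\<^sup>2) \<partial>Q) \<le> ennreal (2 / a) * weighted_sq f"
proof -
  let ?u = "\<lambda>\<omega>. (f (X \<omega>))\<^sup>2 / \<pi> (X \<omega>)" and ?v = "\<lambda>x. (f x)\<^sup>2 / (\<pi> x)\<^sup>2"
  have "(\<integral>\<^sup>+\<omega>. ennreal (((1 - R \<omega> / \<pi> (X \<omega>)) * f (X \<omega>))\<^sup>2) \<partial>Q)
      \<le> (\<integral>\<^sup>+\<omega>. ennreal (?u \<omega>) + ennreal (R \<omega>) * ennreal (?v (X \<omega>)) \<partial>Q)"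
  proof (rule nn_integral_mono_AE)
    show "AE \<omega> in Q. ennreal (((1 - R \<omega> / \<pi> (X \<omega>)) * f (X \<omega>))\<^sup>2)
        \<le> ennreal (?u \<omega>) + ennreal (R \<omega>) * ennreal (?v (X \<omega>))"
      using AE_\<pi>_01 AE_space
    proof eventually_elim
      case (elim \<omega>)
      define P where "P = \<pi> (X \<omega>)"
      have P: "0 < P" "P \<le> 1" using elim by (auto simp: P_def)
      have 1: "(f (X \<omega>))\<^sup>2 \<le> ?u \<omega>"
        using P mult_left_mono[of P 1 "(f (X \<omega>))\<^sup>2"] by (simp add: le_divide_eq P_def[symmetric])
      have "((1 - R \<omega> / P) * f (X \<omega>))\<^sup>2 \<le> (f (X \<omega>))\<^sup>2 + R \<omega> * ?v (X \<omega>)"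
        using R_cases[OF elim(2)]
      proof
        assume "R \<omega> = 1"
        moreover have "(1 - 1 / P)\<^sup>2 \<le> 1 + 1 / P\<^sup>2" using P by (simp add: power2_diff power_divide)
        then have "(1 - 1 / P)\<^sup>2 * (f (X \<omega>))\<^sup>2 \<le> (1 + 1 / P\<^sup>2) * (f (X \<omega>))\<^sup>2" by (rule mult_right_mono) simp
        ultimately show ?thesis by (simp add: power_mult_distrib distrib_right P_def)
      qed simp
      then have "((1 - R \<omega> / P) * f (X \<omega>))\<^sup>2 \<le> ?u \<omega> + R \<omega> * ?v (X \<omega>)" using 1 by linarith
      then have "ennreal (((1 - R \<omega> / P) * f (X \<omega>))\<^sup>2) \<le> ennreal (?u \<omega> + R \<omega> * ?v (X \<omega>))"
        by (rule ennreal_leI)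
      also have "\<dots> = ennreal (?u \<omega>) + ennreal (R \<omega>) * ennreal (?v (X \<omega>))"
        using R_cases[OF elim(2)] elim by (subst ennreal_plus) (auto simp: ennreal_mult)
      finally show ?case by (simp add: P_def)
    qed
  qed
  also have "\<dots> = (\<integral>\<^sup>+\<omega>. ennreal (?u \<omega>) \<partial>Q) + (\<integral>\<^sup>+\<omega>. ennreal (R \<omega>) * ennreal (?v (X \<omega>)) \<partial>Q)"
    by (rule nn_integral_add) auto
  also have "(\<integral>\<^sup>+\<omega>. ennreal (R \<omega>) * ennreal (?v (X \<omega>)) \<partial>Q) = (\<integral>\<^sup>+\<omega>. ennreal (\<pi> (X \<omega>)) * ennreal (?v (X \<omega>)) \<partial>Q)"
    using nn_integral_R[of "\<lambda>(y, x). ennreal (?v x)"] by simp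
  also have "\<dots> = (\<integral>\<^sup>+\<omega>. ennreal (?u \<omega>) \<partial>Q)"
  proof (rule nn_integral_cong_AE)
    show "AE \<omega> in Q. ennreal (\<pi> (X \<omega>)) * ennreal (?v (X \<omega>)) = ennreal (?u \<omega>)"
      using AE_\<pi>_01 by eventually_elim (simp add: power2_eq_square flip: ennreal_mult)
  qed
  also have "(\<integral>\<^sup>+\<omega>. ennreal (?u \<omega>) \<partial>Q) + (\<integral>\<^sup>+\<omega>. ennreal (?u \<omega>) \<partial>Q)
      = (ennreal (1 / a) + ennreal (1 / a)) * weighted_sq f"
    by (simp add: weighted_sq_eq distrib_right)
  also have "ennreal (1 / a) + ennreal (1 / a) = ennreal (2 / a)"
    using a_inverse(2) by (simp flip: ennreal_plus)
  finally show ?thesis .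
qed

lemma weighted_sq_finite:
  assumes [measurable]: "f \<in> borel_measurable S" and fin: "weighted_sq f < \<infinity>"
  shows "integrable Q (\<lambda>\<omega>. (f (X \<omega>))\<^sup>2 / \<pi> (X \<omega>))" "integrable Q (\<lambda>\<omega>. (f (X \<omega>))\<^sup>2)"
proof -
  have ae: "AE \<omega> in Q. 0 \<le> (f (X \<omega>))\<^sup>2 / \<pi> (X \<omega>)" using AE_\<pi>_01 by eventually_elim auto
  have "ennreal (1 / a) * weighted_sq f < \<infinity>" using fin by (simp add: ennreal_mult_less_top)
  then show i: "integrable Q (\<lambda>\<omega>. (f (X \<omega>))\<^sup>2 / \<pi> (X \<omega>))"
    using ae by (intro integrableI_nonneg) (auto simp: weighted_sq_eq)
  show "integrable Q (\<lambda>\<omega>. (f (X \<omega>))\<^sup>2)"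
  proof (rule Bochner_Integration.integrable_bound[OF i])
    show "AE \<omega> in Q. norm ((f (X \<omega>))\<^sup>2) \<le> norm ((f (X \<omega>))\<^sup>2 / \<pi> (X \<omega>))"
      using AE_\<pi>_01
    proof eventually_elim
      case (elim \<omega>)
      then show ?case
        using mult_left_mono[of "\<pi> (X \<omega>)" 1 "(f (X \<omega>))\<^sup>2"] by (simp add: le_divide_eq)
    qed
  qed simp
qed

text \<open>The finite weighted error makes \<open>f(X)\<close> integrable, so the integral may be
  split, and exchanging \<open>R\<close> for \<pi> shows that the two parts cancel.\<close>

lemma imputation_mean:
  assumes [measurable]: "f \<in> borel_measurable S" and fin: "weighted_sq f < \<infinity>"
  shows "(\<integral>\<omega>. (1 - R \<omega> / \<pi> (X \<omega>)) * f (X \<omega>) \<partial>Q) = 0"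
proof -
  let ?G = "\<lambda>(y::real, x). f x / \<pi> x"
  have f: "integrable Q (\<lambda>\<omega>. f (X \<omega>))"
    by (rule square_integrable_imp_integrable[OF _ weighted_sq_finite(2)[OF assms]]) simp
  have ae: "AE \<omega> in Q. \<pi> (X \<omega>) * ?G (Y \<omega>, X \<omega>) = f (X \<omega>)"
    using AE_\<pi>_01 by eventually_elim auto
  have "integrable Q (\<lambda>\<omega>. \<pi> (X \<omega>) * ?G (Y \<omega>, X \<omega>))"
    using f by (rule integrable_cong_AE_imp) (use ae in auto)
  then have i: "integrable Q (\<lambda>\<omega>. R \<omega> * ?G (Y \<omega>, X \<omega>))"
    by (subst integral_R(1)) auto
  have "(\<integral>\<omega>. R \<omega> * ?G (Y \<omega>, X \<omega>) \<partial>Q) = (\<integral>\<omega>. \<pi> (X \<omega>) * ?G (Y \<omega>, X \<omega>) \<partial>Q)"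
    by (rule integral_R(2)) simp
  also have "\<dots> = (\<integral>\<omega>. f (X \<omega>) \<partial>Q)" by (rule integral_cong_AE) (use ae in auto)
  finally have "(\<integral>\<omega>. f (X \<omega>) - R \<omega> * ?G (Y \<omega>, X \<omega>) \<partial>Q) = 0"
    using f i by simp
  then show ?thesis by (simp add: left_diff_distrib)
qed

lemma Y_variance: "(\<integral>\<omega>. (Y \<omega> - \<theta>0)\<^sup>2 \<partial>Q) \<le> s2\<^sup>2" "integrable Q (\<lambda>\<omega>. (Y \<omega> - \<theta>0)\<^sup>2)"
proof -
  show "(\<integral>\<omega>. (Y \<omega> - \<theta>0)\<^sup>2 \<partial>Q) \<le> s2\<^sup>2"
    using basic by (simp add: basic_assumption_def Let_def \<theta>0)
  show "integrable Q (\<lambda>\<omega>. (Y \<omega> - \<theta>0)\<^sup>2)"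
    by (rule integrable_diff_square[OF _ _ Y_sq]) auto
qed

lemma m_mean: "(\<integral>\<omega>. m (X \<omega>) \<partial>Q) = \<theta>0" "integrable Q (\<lambda>\<omega>. m (X \<omega>))"
proof -
  show i: "integrable Q (\<lambda>\<omega>. m (X \<omega>))"
    by (rule square_integrable_imp_integrable[OF _ m_sq]) simp
  show "(\<integral>\<omega>. m (X \<omega>) \<partial>Q) = \<theta>0"
    using regression_orthogonal(2)[of "\<lambda>_. 1"] i Y_int by (simp add: \<theta>0)
qed

section \<open>Propensity limits of bounded ratio to the truth\<close>

context
  fixes e :: "covariate \<Rightarrow> real" and C :: real
  assumes e_meas[measurable]: "e \<in> borel_measurable S"
    and C: "1 \<le> C" and ratio: "AE x in PX. 0 < e x \<and> \<pi> x / e x \<le> C"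
begin

lemma ratio_X: "AE \<omega> in Q. 0 < e (X \<omega>) \<and> 0 < \<pi> (X \<omega>) \<and> \<pi> (X \<omega>) / e (X \<omega>) \<le> C"
  using AE_PX_X[OF ratio] AE_\<pi>_01 by eventually_elim auto

context
  fixes t :: "covariate \<Rightarrow> real"
  assumes t_meas[measurable]: "t \<in> borel_measurable S"
begin

text \<open>\<pi> is nonnegative only almost everywhere, while \<open>second_moment_m\<close> asks
  for a weight that is nonnegative everywhere; hence the absolute value.\<close>

lemma weighting_AE: "AE \<omega> in Q. \<bar>\<pi> (X \<omega>)\<bar> * (1 / t (X \<omega>) - 1 / e (X \<omega>))\<^sup>2
    \<le> C\<^sup>2 * ((1 - e (X \<omega>) / t (X \<omega>))\<^sup>2 / \<pi> (X \<omega>))"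
  using ratio_X
proof eventually_elim
  case (elim \<omega>)
  have "\<bar>\<pi> (X \<omega>)\<bar> * (1 / t (X \<omega>) - 1 / e (X \<omega>))\<^sup>2
      = \<pi> (X \<omega>) / (e (X \<omega>))\<^sup>2 * (1 - e (X \<omega>) / t (X \<omega>))\<^sup>2"
    using elim by (subst inverse_diff_eq) (auto simp: power_divide power2_commute)
  also have "\<dots> \<le> C\<^sup>2 / \<pi> (X \<omega>) * (1 - e (X \<omega>) / t (X \<omega>))\<^sup>2"
    using elim by (intro mult_right_mono ratio_sq) auto
  finally show ?case by simp
qed

lemma weighting_weight: "(\<integral>\<^sup>+\<omega>. ennreal (\<bar>\<pi> (X \<omega>)\<bar> * (1 / t (X \<omega>) - 1 / e (X \<omega>))\<^sup>2) \<partial>Q)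
    \<le> ennreal (C\<^sup>2 / a) * weighted_sq (\<lambda>x. 1 - e x / t x)"
proof -
  have "(\<integral>\<^sup>+\<omega>. ennreal (\<bar>\<pi> (X \<omega>)\<bar> * (1 / t (X \<omega>) - 1 / e (X \<omega>))\<^sup>2) \<partial>Q)
      \<le> (\<integral>\<^sup>+\<omega>. ennreal (C\<^sup>2) * ennreal ((1 - e (X \<omega>) / t (X \<omega>))\<^sup>2 / \<pi> (X \<omega>)) \<partial>Q)"
  proof (rule nn_integral_mono_AE)
    show "AE \<omega> in Q. ennreal (\<bar>\<pi> (X \<omega>)\<bar> * (1 / t (X \<omega>) - 1 / e (X \<omega>))\<^sup>2)
        \<le> ennreal (C\<^sup>2) * ennreal ((1 - e (X \<omega>) / t (X \<omega>))\<^sup>2 / \<pi> (X \<omega>))"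
      using weighting_AE by eventually_elim (auto simp: ennreal_mult'[symmetric] intro!: ennreal_leI)
  qed
  also have "\<dots> = ennreal (C\<^sup>2) * (ennreal (1 / a) * weighted_sq (\<lambda>x. 1 - e x / t x))"
    by (subst nn_integral_cmult, simp) (subst weighted_sq_eq[symmetric], auto)
  also have "\<dots> = ennreal (C\<^sup>2 / a) * weighted_sq (\<lambda>x. 1 - e x / t x)"
    by (simp add: mult.assoc[symmetric] ennreal_mult'[symmetric])
  finally show ?thesis .
qed

text \<open>\<open>R\<close> equals its own square, so exchanging it for \<pi> leaves a function of
  \<open>X\<close> times the squared residual of \<open>m\<close>, whose weighted mean is bounded by
  that of the weight.\<close>

lemma weighting_second_moment:
  "(\<integral>\<^sup>+\<omega>. ennreal (((1 / t (X \<omega>) - 1 / e (X \<omega>)) * (R \<omega> * Y \<omega> - R \<omega> * m (X \<omega>)))\<^sup>2) \<partial>Q)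
    \<le> ennreal (s2\<^sup>2 * C\<^sup>2 / a) * weighted_sq (\<lambda>x. 1 - e x / t x)"
proof -
  define q where "q = (\<lambda>x. 1 / t x - 1 / e x)"
  have [measurable]: "q \<in> borel_measurable S" unfolding q_def by measurable
  have "(\<integral>\<^sup>+\<omega>. ennreal ((q (X \<omega>) * (R \<omega> * Y \<omega> - R \<omega> * m (X \<omega>)))\<^sup>2) \<partial>Q)
      = (\<integral>\<^sup>+\<omega>. ennreal (R \<omega>) * ennreal ((q (X \<omega>))\<^sup>2 * (Y \<omega> - m (X \<omega>))\<^sup>2) \<partial>Q)"
    by (intro nn_integral_cong) (use R_cases in \<open>fastforce simp: power_mult_distrib\<close>)
  also have "\<dots> = (\<integral>\<^sup>+\<omega>. ennreal (\<pi> (X \<omega>)) * ennreal ((q (X \<omega>))\<^sup>2 * (Y \<omega> - m (X \<omega>))\<^sup>2) \<partial>Q)"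
    using nn_integral_R[of "\<lambda>(y, x). ennreal ((q x)\<^sup>2 * (y - m x)\<^sup>2)"] by simp
  also have "\<dots> = (\<integral>\<^sup>+\<omega>. ennreal (\<bar>\<pi> (X \<omega>)\<bar> * (q (X \<omega>))\<^sup>2) * ennreal ((Y \<omega> - m (X \<omega>))\<^sup>2) \<partial>Q)"
  proof (rule nn_integral_cong_AE)
    show "AE \<omega> in Q. ennreal (\<pi> (X \<omega>)) * ennreal ((q (X \<omega>))\<^sup>2 * (Y \<omega> - m (X \<omega>))\<^sup>2)
        = ennreal (\<bar>\<pi> (X \<omega>)\<bar> * (q (X \<omega>))\<^sup>2) * ennreal ((Y \<omega> - m (X \<omega>))\<^sup>2)"
      using AE_\<pi>_01 by eventually_elim (auto simp: ennreal_mult mult.assoc)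
  qed
  also have "\<dots> \<le> ennreal (s2\<^sup>2) * (\<integral>\<^sup>+\<omega>. ennreal (\<bar>\<pi> (X \<omega>)\<bar> * (q (X \<omega>))\<^sup>2) \<partial>Q)"
    by (rule second_moment_m[where h = "\<lambda>x. \<bar>\<pi> x\<bar> * (q x)\<^sup>2"]) auto
  also have "\<dots> \<le> ennreal (s2\<^sup>2) * (ennreal (C\<^sup>2 / a) * weighted_sq (\<lambda>x. 1 - e x / t x))"
    using weighting_weight by (intro mult_left_mono) (auto simp: q_def)
  also have "\<dots> = ennreal (s2\<^sup>2 * C\<^sup>2 / a) * weighted_sq (\<lambda>x. 1 - e x / t x)"
    by (simp add: mult.assoc[symmetric] ennreal_mult'[symmetric])
  finally show ?thesis by (simp add: q_def)
qed

text \<open>After the exchange of \<open>R\<close> for \<pi> the integrand is \<open>\<pi> q\<close>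
  times the residual of \<open>m\<close>. Orthogonality requires \<open>\<pi> q\<close> to be square
  integrable, which follows from the finite weighted error because
  \<open>\<pi>\<^sup>2 q\<^sup>2\<close> is at most \<open>\<pi> q\<^sup>2\<close>.\<close>

lemma weighting_mean:
  assumes fin: "weighted_sq (\<lambda>x. 1 - e x / t x) < \<infinity>"
  shows "(\<integral>\<omega>. (1 / t (X \<omega>) - 1 / e (X \<omega>)) * (R \<omega> * Y \<omega> - R \<omega> * m (X \<omega>)) \<partial>Q) = 0"
proof -
  define q where "q = (\<lambda>x. 1 / t x - 1 / e x)"
  have [measurable]: "q \<in> borel_measurable S" unfolding q_def by measurable
  have i: "integrable Q (\<lambda>\<omega>. (\<pi> (X \<omega>) * q (X \<omega>))\<^sup>2)"
  proof (rule Bochner_Integration.integrable_bound)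
    show "integrable Q (\<lambda>\<omega>. C\<^sup>2 * ((1 - e (X \<omega>) / t (X \<omega>))\<^sup>2 / \<pi> (X \<omega>)))"
      by (intro integrable_mult_right weighted_sq_finite(1)[OF _ fin]) simp
    show "AE \<omega> in Q. norm ((\<pi> (X \<omega>) * q (X \<omega>))\<^sup>2)
        \<le> norm (C\<^sup>2 * ((1 - e (X \<omega>) / t (X \<omega>))\<^sup>2 / \<pi> (X \<omega>)))"
      using weighting_AE AE_\<pi>_01
    proof eventually_elim
      case (elim \<omega>)
      have "(\<pi> (X \<omega>) * q (X \<omega>))\<^sup>2 = \<pi> (X \<omega>) * (\<bar>\<pi> (X \<omega>)\<bar> * (q (X \<omega>))\<^sup>2)"
        using elim by (simp add: power2_eq_square)
      also have "\<dots> \<le> 1 * (\<bar>\<pi> (X \<omega>)\<bar> * (q (X \<omega>))\<^sup>2)"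
        using elim by (intro mult_right_mono) auto
      also have "\<dots> \<le> C\<^sup>2 * ((1 - e (X \<omega>) / t (X \<omega>))\<^sup>2 / \<pi> (X \<omega>))"
        using elim by (simp add: q_def)
      finally show ?case using elim by simp
    qed
  qed simp
  have "(\<integral>\<omega>. (q (X \<omega>)) * (R \<omega> * Y \<omega> - R \<omega> * m (X \<omega>)) \<partial>Q)
      = (\<integral>\<omega>. R \<omega> * (q (X \<omega>) * (Y \<omega> - m (X \<omega>))) \<partial>Q)"
    by (intro Bochner_Integration.integral_cong) (auto simp: algebra_simps)
  also have "\<dots> = (\<integral>\<omega>. \<pi> (X \<omega>) * (q (X \<omega>) * (Y \<omega> - m (X \<omega>))) \<partial>Q)"
    using integral_R(2)[of "\<lambda>(y, x). q x * (y - m x)"] by simp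
  also have "\<dots> = (\<integral>\<omega>. (\<pi> (X \<omega>) * q (X \<omega>)) * (Y \<omega> - m (X \<omega>)) \<partial>Q)"
    by (simp add: mult.assoc)
  also have "\<dots> = 0"
    using regression_orthogonal(2)[of "\<lambda>x. \<pi> x * q x"] i by simp
  finally show ?thesis by (simp add: q_def)
qed

text \<open>Exchanging \<open>R\<close> for \<pi> produces the ratio \<pi> / e, bounded by
  \<open>C\<close>, times the relative error of the propensity. No inverse weight remains, so the
  unweighted norms suffice.\<close>

lemma product_first_moment:
  assumes [measurable]: "f \<in> borel_measurable S"
  shows "(\<integral>\<^sup>+\<omega>. ennreal \<bar>(R \<omega> / t (X \<omega>) - R \<omega> / e (X \<omega>)) * f (X \<omega>)\<bar> \<partial>Q)
    \<le> ennreal C * (\<integral>\<^sup>+x. ennreal (\<bar>1 - e x / t x\<bar> * \<bar>f x\<bar>) \<partial>PX)"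
proof -
  let ?q = "\<lambda>x. 1 / t x - 1 / e x"
  have "(\<integral>\<^sup>+\<omega>. ennreal \<bar>(R \<omega> / t (X \<omega>) - R \<omega> / e (X \<omega>)) * f (X \<omega>)\<bar> \<partial>Q)
      = (\<integral>\<^sup>+\<omega>. ennreal (R \<omega>) * ennreal \<bar>?q (X \<omega>) * f (X \<omega>)\<bar> \<partial>Q)"
    by (intro nn_integral_cong) (use R_cases in \<open>fastforce\<close>)
  also have "\<dots> = (\<integral>\<^sup>+\<omega>. ennreal (\<pi> (X \<omega>)) * ennreal \<bar>?q (X \<omega>) * f (X \<omega>)\<bar> \<partial>Q)"
    using nn_integral_R[of "\<lambda>(y, x). ennreal \<bar>?q x * f x\<bar>"] by simp
  also have "\<dots> \<le> (\<integral>\<^sup>+\<omega>. ennreal C * ennreal (\<bar>1 - e (X \<omega>) / t (X \<omega>)\<bar> * \<bar>f (X \<omega>)\<bar>) \<partial>Q)"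
  proof (rule nn_integral_mono_AE)
    show "AE \<omega> in Q. ennreal (\<pi> (X \<omega>)) * ennreal \<bar>?q (X \<omega>) * f (X \<omega>)\<bar>
        \<le> ennreal C * ennreal (\<bar>1 - e (X \<omega>) / t (X \<omega>)\<bar> * \<bar>f (X \<omega>)\<bar>)"
      using ratio_X
    proof eventually_elim
      case (elim \<omega>)
      have "\<pi> (X \<omega>) * \<bar>?q (X \<omega>) * f (X \<omega>)\<bar>
          = \<pi> (X \<omega>) / e (X \<omega>) * (\<bar>1 - e (X \<omega>) / t (X \<omega>)\<bar> * \<bar>f (X \<omega>)\<bar>)"
        using elim by (subst inverse_diff_eq) (auto simp: abs_mult)
      also have "\<dots> \<le> C * (\<bar>1 - e (X \<omega>) / t (X \<omega>)\<bar> * \<bar>f (X \<omega>)\<bar>)"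
        using elim by (intro mult_right_mono) auto
      finally show ?case using elim C by (simp add: ennreal_mult'[symmetric] ennreal_leI)
    qed
  qed
  also have "\<dots> = ennreal C * (\<integral>\<^sup>+x. ennreal (\<bar>1 - e x / t x\<bar> * \<bar>f x\<bar>) \<partial>PX)"
    by (subst nn_integral_cmult, simp) (subst nn_integral_PX, auto)
  finally show ?thesis .
qed

end

text \<open>The factor \<pi> obtained from \<open>R\<close> cancels the first inverse weight and
  leaves 1 - \<pi> / e.\<close>

lemma misspecified_first_moment:
  assumes [measurable]: "f \<in> borel_measurable S"
  shows "(\<integral>\<^sup>+\<omega>. ennreal \<bar>(R \<omega> / \<pi> (X \<omega>) - R \<omega> / e (X \<omega>)) * f (X \<omega>)\<bar> \<partial>Q)
    = (\<integral>\<^sup>+x. ennreal (\<bar>1 - \<pi> x / e x\<bar> * \<bar>f x\<bar>) \<partial>PX)"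
proof -
  let ?q = "\<lambda>x. 1 / \<pi> x - 1 / e x"
  have "(\<integral>\<^sup>+\<omega>. ennreal \<bar>(R \<omega> / \<pi> (X \<omega>) - R \<omega> / e (X \<omega>)) * f (X \<omega>)\<bar> \<partial>Q)
      = (\<integral>\<^sup>+\<omega>. ennreal (R \<omega>) * ennreal \<bar>?q (X \<omega>) * f (X \<omega>)\<bar> \<partial>Q)"
    by (intro nn_integral_cong) (use R_cases in \<open>fastforce\<close>)
  also have "\<dots> = (\<integral>\<^sup>+\<omega>. ennreal (\<pi> (X \<omega>)) * ennreal \<bar>?q (X \<omega>) * f (X \<omega>)\<bar> \<partial>Q)"
    using nn_integral_R[of "\<lambda>(y, x). ennreal \<bar>?q x * f x\<bar>"] by simp
  also have "\<dots> = (\<integral>\<^sup>+\<omega>. ennreal (\<bar>1 - \<pi> (X \<omega>) / e (X \<omega>)\<bar> * \<bar>f (X \<omega>)\<bar>) \<partial>Q)"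
  proof (rule nn_integral_cong_AE)
    show "AE \<omega> in Q. ennreal (\<pi> (X \<omega>)) * ennreal \<bar>?q (X \<omega>) * f (X \<omega>)\<bar>
        = ennreal (\<bar>1 - \<pi> (X \<omega>) / e (X \<omega>)\<bar> * \<bar>f (X \<omega>)\<bar>)"
      using AE_\<pi>_01
    proof eventually_elim
      case (elim \<omega>)
      have "\<bar>1 - \<pi> (X \<omega>) / e (X \<omega>)\<bar> = \<bar>\<pi> (X \<omega>) * ?q (X \<omega>)\<bar>"
        using elim by (simp add: right_diff_distrib)
      then show ?case using elim by (simp add: ennreal_mult'[symmetric] abs_mult mult.assoc)
    qed
  qed
  also have "\<dots> = (\<integral>\<^sup>+x. ennreal (\<bar>1 - \<pi> x / e x\<bar> * \<bar>f x\<bar>) \<partial>PX)"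
    by (subst nn_integral_PX) auto
  finally show ?thesis .
qed

section \<open>The doubly robust score\<close>

abbreviation "score \<omega> \<equiv> dr_score \<mu> e \<theta>0 (R \<omega>) (Y \<omega>) (X \<omega>)"

lemma score_measurable[measurable]: "score \<in> borel_measurable Q"
  unfolding dr_score_def by measurable

lemma score_second_moment:
  "(\<integral>\<^sup>+\<omega>. ennreal ((score \<omega>)\<^sup>2) \<partial>Q) \<le> ennreal (s2\<^sup>2 * (8 + 2 * C\<^sup>2) / a)"
proof -
  let ?G = "\<lambda>(y, x). ennreal ((y - \<mu> x)\<^sup>2 / (e x)\<^sup>2)"
  have pw: "ennreal ((score \<omega>)\<^sup>2) \<le> 4 * ennreal ((Y \<omega> - \<theta>0)\<^sup>2) +
      (4 * ennreal ((Y \<omega> - \<mu> (X \<omega>))\<^sup>2) + 2 * (ennreal (R \<omega>) * ?G (Y \<omega>, X \<omega>)))" if \<omega>: "\<omega> \<in> space Q" for \<omega>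
  proof -
    \<comment> \<open>The score is \<open>(u - v) + w\<close>. Splitting the square twice gives
      \<open>4 u\<^sup>2 + 4 v\<^sup>2 + 2 w\<^sup>2\<close>; the first two terms account for the 8
      in the final constant and the last for \<open>2 * C\<^sup>2\<close>.\<close>
    define u v w where "u = Y \<omega> - \<theta>0" and "v = Y \<omega> - \<mu> (X \<omega>)" and "w = R \<omega> / e (X \<omega>) * v"
    have sq: "(x + y)\<^sup>2 \<le> 2 * x\<^sup>2 + 2 * y\<^sup>2" for x y :: real
      using sum_squares_bound[of x y] by (simp add: power2_sum)
    have "score \<omega> = (u - v) + w" by (simp add: dr_score_def u_def v_def w_def)
    then have "(score \<omega>)\<^sup>2 \<le> 2 * (u - v)\<^sup>2 + 2 * w\<^sup>2" using sq by simp
    moreover have "(u - v)\<^sup>2 \<le> 2 * u\<^sup>2 + 2 * v\<^sup>2" using sq[of u "- v"] by simp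
    moreover have "w\<^sup>2 = R \<omega> * (v\<^sup>2 / (e (X \<omega>))\<^sup>2)"
      using R_cases[OF \<omega>] by (auto simp: w_def power_divide)
    ultimately have "(score \<omega>)\<^sup>2 \<le> 4 * u\<^sup>2 + (4 * v\<^sup>2 + 2 * (R \<omega> * (v\<^sup>2 / (e (X \<omega>))\<^sup>2)))"
      by linarith
    then have "ennreal ((score \<omega>)\<^sup>2) \<le> ennreal (4 * u\<^sup>2 + (4 * v\<^sup>2 + 2 * (R \<omega> * (v\<^sup>2 / (e (X \<omega>))\<^sup>2))))"
      by (rule ennreal_leI)
    also have "\<dots> = 4 * ennreal (u\<^sup>2) + (4 * ennreal (v\<^sup>2) + 2 * (ennreal (R \<omega>) * ennreal (v\<^sup>2 / (e (X \<omega>))\<^sup>2)))"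
    proof -
      have [simp]: "(4::ennreal) = ennreal 4" "(2::ennreal) = ennreal 2" by simp_all
      have "0 \<le> R \<omega>" using R_cases[OF \<omega>] by auto
      then show ?thesis
        by (simp add: ennreal_mult'[symmetric] ennreal_plus[symmetric] del: ennreal_plus ennreal_numeral)
    qed
    finally show ?thesis by (simp add: u_def v_def)
  qed
  have Rpart: "(\<integral>\<^sup>+\<omega>. ennreal (R \<omega>) * ?G (Y \<omega>, X \<omega>) \<partial>Q) \<le> ennreal (s2\<^sup>2) * ennreal (C\<^sup>2 / a)"
  proof -
    have "(\<integral>\<^sup>+\<omega>. ennreal (R \<omega>) * ?G (Y \<omega>, X \<omega>) \<partial>Q) = (\<integral>\<^sup>+\<omega>. ennreal (\<pi> (X \<omega>)) * ?G (Y \<omega>, X \<omega>) \<partial>Q)"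
      by (rule nn_integral_R) simp
    also have "\<dots> = (\<integral>\<^sup>+\<omega>. ennreal (\<pi> (X \<omega>) / (e (X \<omega>))\<^sup>2) * ennreal ((Y \<omega> - \<mu> (X \<omega>))\<^sup>2) \<partial>Q)"
    proof (rule nn_integral_cong_AE)
      show "AE \<omega> in Q. ennreal (\<pi> (X \<omega>)) * ?G (Y \<omega>, X \<omega>)
          = ennreal (\<pi> (X \<omega>) / (e (X \<omega>))\<^sup>2) * ennreal ((Y \<omega> - \<mu> (X \<omega>))\<^sup>2)"
        using AE_\<pi>_01 by eventually_elim (auto simp: ennreal_mult'[symmetric])
    qed
    also have "\<dots> \<le> ennreal (s2\<^sup>2) * (\<integral>\<^sup>+\<omega>. ennreal (\<pi> (X \<omega>) / (e (X \<omega>))\<^sup>2) \<partial>Q)"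
      by (rule second_moment_\<mu>) simp
    also have "\<dots> \<le> ennreal (s2\<^sup>2) * (\<integral>\<^sup>+\<omega>. ennreal (C\<^sup>2) * ennreal (1 / \<pi> (X \<omega>)) \<partial>Q)"
    proof (intro mult_left_mono nn_integral_mono_AE)
      show "AE \<omega> in Q. ennreal (\<pi> (X \<omega>) / (e (X \<omega>))\<^sup>2) \<le> ennreal (C\<^sup>2) * ennreal (1 / \<pi> (X \<omega>))"
        using ratio_X
      proof eventually_elim
        case (elim \<omega>)
        then show ?case using ratio_sq[of "e (X \<omega>)" "\<pi> (X \<omega>)"]
          by (auto simp: ennreal_mult'[symmetric] intro!: ennreal_leI)
      qed
    qed simp
    also have "\<dots> = ennreal (s2\<^sup>2) * (ennreal (C\<^sup>2) * (\<integral>\<^sup>+x. ennreal (1 / \<pi> x) \<partial>PX))"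
      by (subst nn_integral_cmult, simp) (subst nn_integral_PX, auto)
    finally show ?thesis using a_inverse by (simp add: ennreal_mult'[symmetric])
  qed
  have Y: "(\<integral>\<^sup>+\<omega>. ennreal ((Y \<omega> - \<theta>0)\<^sup>2) \<partial>Q) \<le> ennreal (s2\<^sup>2)"
    by (subst nn_integral_eq_integral) (use Y_variance in \<open>auto intro: ennreal_leI\<close>)
  have "(\<integral>\<^sup>+\<omega>. ennreal ((score \<omega>)\<^sup>2) \<partial>Q) \<le> (\<integral>\<^sup>+\<omega>. 4 * ennreal ((Y \<omega> - \<theta>0)\<^sup>2) +
      (4 * ennreal ((Y \<omega> - \<mu> (X \<omega>))\<^sup>2) + 2 * (ennreal (R \<omega>) * ?G (Y \<omega>, X \<omega>))) \<partial>Q)"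
    by (rule nn_integral_mono[OF pw])
  also have "\<dots> = 4 * (\<integral>\<^sup>+\<omega>. ennreal ((Y \<omega> - \<theta>0)\<^sup>2) \<partial>Q) +
      (4 * (\<integral>\<^sup>+\<omega>. ennreal ((Y \<omega> - \<mu> (X \<omega>))\<^sup>2) \<partial>Q) + 2 * (\<integral>\<^sup>+\<omega>. ennreal (R \<omega>) * ?G (Y \<omega>, X \<omega>) \<partial>Q))"
    by (simp add: nn_integral_add nn_integral_cmult)
  also have "\<dots> \<le> 4 * ennreal (s2\<^sup>2) + (4 * ennreal (s2\<^sup>2) + 2 * (ennreal (s2\<^sup>2) * ennreal (C\<^sup>2 / a)))"
    by (intro add_mono mult_left_mono Y residual_\<mu>_bound Rpart) auto
  also have "\<dots> = ennreal (8 * s2\<^sup>2 + 2 * (s2\<^sup>2 * C\<^sup>2 / a))"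
  proof -
    have [simp]: "(4::ennreal) = ennreal 4" "(2::ennreal) = ennreal 2" by simp_all
    show ?thesis using a_inverse(2)
      by (simp add: ennreal_mult'[symmetric] ennreal_plus[symmetric] del: ennreal_plus ennreal_numeral)
  qed
  also have "\<dots> \<le> ennreal (s2\<^sup>2 * (8 + 2 * C\<^sup>2) / a)"
  proof (rule ennreal_leI)
    \<comment> \<open>The terms without inverse weight are absorbed into the order
      \<open>1 / a\<close> because \<open>a\<close> is at most 1.\<close>
    have "8 * s2\<^sup>2 * a \<le> 8 * s2\<^sup>2 * 1" using a_inverse by (intro mult_left_mono) auto
    then show "8 * s2\<^sup>2 + 2 * (s2\<^sup>2 * C\<^sup>2 / a) \<le> s2\<^sup>2 * (8 + 2 * C\<^sup>2) / a"
      using a_inverse(2) by (simp add: field_simps)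
  qed
  finally show ?thesis .
qed

lemma score_sq: "integrable Q (\<lambda>\<omega>. (score \<omega>)\<^sup>2)"
  using score_second_moment by (intro integrableI_nonneg) (auto intro: le_less_trans)

lemma score_int: "integrable Q score"
  by (rule square_integrable_imp_integrable[OF _ score_sq]) simp

text \<open>Double robustness. If e = \<pi>, the weighted residual of \<mu> has mean
  \<open>\<theta>0\<close> minus the mean of \<open>\<mu>(X)\<close>, which compensates any error in
  \<mu>. If \<mu> = m, the residual is orthogonal to the bounded function \<pi> / e, and
  \<open>m(X)\<close> already has mean \<open>\<theta>0\<close>.\<close>

lemma score_mean:
  assumes "(AE x in PX. \<mu> x = m x) \<or> (AE x in PX. e x = \<pi> x)"
  shows "(\<integral>\<omega>. score \<omega> \<partial>Q) = 0"
proof -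
  let ?G = "\<lambda>(y, x). (y - \<mu> x) / e x"
  have \<mu>: "integrable Q (\<lambda>\<omega>. \<mu> (X \<omega>))"
    by (rule square_integrable_imp_integrable[OF _ \<mu>_sq]) simp
  have eq: "score \<omega> = R \<omega> * ?G (Y \<omega>, X \<omega>) + (\<mu> (X \<omega>) - \<theta>0)" for \<omega>
    by (simp add: dr_score_def)
  have "integrable Q (\<lambda>\<omega>. score \<omega> - (\<mu> (X \<omega>) - \<theta>0))" using score_int \<mu> by simp
  then have i: "integrable Q (\<lambda>\<omega>. R \<omega> * ?G (Y \<omega>, X \<omega>))" unfolding eq by simp
  have "(\<integral>\<omega>. score \<omega> \<partial>Q) = (\<integral>\<omega>. R \<omega> * ?G (Y \<omega>, X \<omega>) \<partial>Q) + ((\<integral>\<omega>. \<mu> (X \<omega>) \<partial>Q) - \<theta>0)"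
    unfolding eq using i \<mu> by (simp add: prob_space)
  also have "(\<integral>\<omega>. R \<omega> * ?G (Y \<omega>, X \<omega>) \<partial>Q) = (\<integral>\<omega>. \<pi> (X \<omega>) * ?G (Y \<omega>, X \<omega>) \<partial>Q)"
    by (rule integral_R(2)) simp
  also have "\<dots> = \<theta>0 - (\<integral>\<omega>. \<mu> (X \<omega>) \<partial>Q)"
    using assms
  proof
    assume ae: "AE x in PX. e x = \<pi> x"
    have "AE \<omega> in Q. \<pi> (X \<omega>) * ?G (Y \<omega>, X \<omega>) = Y \<omega> - \<mu> (X \<omega>)"
      using AE_PX_X[OF ae] AE_\<pi>_01 by eventually_elim auto
    then have "(\<integral>\<omega>. \<pi> (X \<omega>) * ?G (Y \<omega>, X \<omega>) \<partial>Q) = (\<integral>\<omega>. Y \<omega> - \<mu> (X \<omega>) \<partial>Q)"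
      by (intro integral_cong_AE) auto
    then show ?thesis using Y_int \<mu> by (simp add: \<theta>0)
  next
    assume ae: "AE x in PX. \<mu> x = m x"
    have "AE \<omega> in Q. \<pi> (X \<omega>) * ?G (Y \<omega>, X \<omega>) = \<pi> (X \<omega>) / e (X \<omega>) * (Y \<omega> - m (X \<omega>))"
      using AE_PX_X[OF ae] by eventually_elim auto
    then have "(\<integral>\<omega>. \<pi> (X \<omega>) * ?G (Y \<omega>, X \<omega>) \<partial>Q) = (\<integral>\<omega>. \<pi> (X \<omega>) / e (X \<omega>) * (Y \<omega> - m (X \<omega>)) \<partial>Q)"
      by (intro integral_cong_AE) auto
    also have "\<dots> = 0"
    proof (rule regression_orthogonal(2)[where h = "\<lambda>x. \<pi> x / e x"])
      show "integrable Q (\<lambda>\<omega>. (\<pi> (X \<omega>) / e (X \<omega>))\<^sup>2)"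
      proof (rule integrable_const_bound[where B = "C\<^sup>2"])
        show "AE \<omega> in Q. norm ((\<pi> (X \<omega>) / e (X \<omega>))\<^sup>2) \<le> C\<^sup>2"
          using ratio_X by eventually_elim (auto intro!: power_mono)
      qed simp
    qed simp
    also have "0 = \<theta>0 - (\<integral>\<omega>. \<mu> (X \<omega>) \<partial>Q)"
    proof -
      have "(\<integral>\<omega>. \<mu> (X \<omega>) \<partial>Q) = (\<integral>\<omega>. m (X \<omega>) \<partial>Q)"
        using AE_PX_X[OF ae] by (intro integral_cong_AE) auto
      then show ?thesis by (simp add: m_mean)
    qed
    finally show ?thesis .
  qed
  finally show ?thesis by simp
qed

lemma score_variance_upper:
  assumes "(AE x in PX. \<mu> x = m x) \<or> (AE x in PX. e x = \<pi> x)"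
  shows "variance score = (\<integral>\<omega>. (score \<omega>)\<^sup>2 \<partial>Q)" "variance score \<le> s2\<^sup>2 * (8 + 2 * C\<^sup>2) / a"
proof -
  show eq: "variance score = (\<integral>\<omega>. (score \<omega>)\<^sup>2 \<partial>Q)" by (simp add: score_mean[OF assms])
  have "ennreal (\<integral>\<omega>. (score \<omega>)\<^sup>2 \<partial>Q) \<le> ennreal (s2\<^sup>2 * (8 + 2 * C\<^sup>2) / a)"
    using score_second_moment by (subst nn_integral_eq_integral[symmetric]) (auto simp: score_sq)
  then show "variance score \<le> s2\<^sup>2 * (8 + 2 * C\<^sup>2) / a"
    using a_inverse(2) unfolding eq by (subst (asm) ennreal_le_iff) auto
qed

text \<open>With both limits correct the score is the sum of the uncorrelated variables
  \<open>m(X) - \<theta>0\<close> and the weighted residual. The first only adds variance; the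
  second has second moment at least \<open>s1\<^sup>2\<close> times the mean of
  \<open>1 / \<pi>\<close>.\<close>

lemma score_variance_lower:
  assumes \<mu>m: "AE x in PX. \<mu> x = m x" and e\<pi>: "AE x in PX. e x = \<pi> x"
  shows "s1\<^sup>2 / a \<le> variance score"
proof -
  let ?G1 = "\<lambda>(y, x). (m x - \<theta>0) * ((y - m x) / \<pi> x)" and ?G2 = "\<lambda>(y, x). ((y - m x) / \<pi> x)\<^sup>2"
  let ?s = "\<lambda>\<omega>. (m (X \<omega>) - \<theta>0) + R \<omega> * ((Y \<omega> - m (X \<omega>)) / \<pi> (X \<omega>))"
  have ae: "AE \<omega> in Q. (score \<omega>)\<^sup>2 = (?s \<omega>)\<^sup>2"
    using AE_PX_X[OF \<mu>m] AE_PX_X[OF e\<pi>] by eventually_elim (simp add: dr_score_def algebra_simps)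
  have s_int: "integrable Q (\<lambda>\<omega>. (?s \<omega>)\<^sup>2)"
    using score_sq by (rule integrable_cong_AE_imp) (use ae in auto)
  have m\<theta>: "integrable Q (\<lambda>\<omega>. (m (X \<omega>) - \<theta>0)\<^sup>2)"
    by (rule integrable_diff_square[OF _ _ m_sq]) auto
  have G1: "integrable Q (\<lambda>\<omega>. R \<omega> * ?G1 (Y \<omega>, X \<omega>))" "(\<integral>\<omega>. R \<omega> * ?G1 (Y \<omega>, X \<omega>) \<partial>Q) = 0"
  proof -
    have ae: "AE \<omega> in Q. \<pi> (X \<omega>) * ?G1 (Y \<omega>, X \<omega>) = (m (X \<omega>) - \<theta>0) * (Y \<omega> - m (X \<omega>))"
      using AE_\<pi>_01 by eventually_elim auto
    have o: "integrable Q (\<lambda>\<omega>. (m (X \<omega>) - \<theta>0) * (Y \<omega> - m (X \<omega>)))"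
      "(\<integral>\<omega>. (m (X \<omega>) - \<theta>0) * (Y \<omega> - m (X \<omega>)) \<partial>Q) = 0"
      by (rule regression_orthogonal[where h = "\<lambda>x. m x - \<theta>0"], simp, rule m\<theta>)+
    have "integrable Q (\<lambda>\<omega>. \<pi> (X \<omega>) * ?G1 (Y \<omega>, X \<omega>))"
      using o(1) by (rule integrable_cong_AE_imp) (use ae in auto)
    then show "integrable Q (\<lambda>\<omega>. R \<omega> * ?G1 (Y \<omega>, X \<omega>))" by (subst integral_R(1)) auto
    have "(\<integral>\<omega>. R \<omega> * ?G1 (Y \<omega>, X \<omega>) \<partial>Q) = (\<integral>\<omega>. \<pi> (X \<omega>) * ?G1 (Y \<omega>, X \<omega>) \<partial>Q)"
      by (rule integral_R(2)) simp
    also have "\<dots> = 0" unfolding o(2)[symmetric] by (rule integral_cong_AE) (use ae in auto)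
    finally show "(\<integral>\<omega>. R \<omega> * ?G1 (Y \<omega>, X \<omega>) \<partial>Q) = 0" .
  qed
  have expand: "(?s \<omega>)\<^sup>2 = ((m (X \<omega>) - \<theta>0)\<^sup>2 + 2 * (R \<omega> * ?G1 (Y \<omega>, X \<omega>))) + R \<omega> * ?G2 (Y \<omega>, X \<omega>)"
    if "\<omega> \<in> space Q" for \<omega>
    using R_cases[OF that] by (auto simp: power2_sum)
  \<comment> \<open>The square of the weighted residual is what remains of the square of the score
    after the two other terms are removed, so its integrability comes from theirs.\<close>
  have "integrable Q (\<lambda>\<omega>. (?s \<omega>)\<^sup>2 - ((m (X \<omega>) - \<theta>0)\<^sup>2 + 2 * (R \<omega> * ?G1 (Y \<omega>, X \<omega>))))"
    by (intro Bochner_Integration.integrable_diff Bochner_Integration.integrable_add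
        integrable_mult_right s_int m\<theta> G1(1))
  then have G2: "integrable Q (\<lambda>\<omega>. R \<omega> * ?G2 (Y \<omega>, X \<omega>))"
    by (rule Bochner_Integration.integrable_cong[THEN iffD1, rotated -1]) (use expand in auto)
  have "ennreal (s1\<^sup>2) * ennreal (1 / a) = ennreal (s1\<^sup>2) * (\<integral>\<^sup>+\<omega>. ennreal (1 / \<pi> (X \<omega>)) \<partial>Q)"
    by (simp add: a_inverse(1)[symmetric] nn_integral_PX)
  also have "\<dots> \<le> (\<integral>\<^sup>+\<omega>. ennreal (1 / \<pi> (X \<omega>)) * ennreal ((Y \<omega> - m (X \<omega>))\<^sup>2) \<partial>Q)"
    by (rule second_moment_m_lower) simp
  also have "\<dots> = (\<integral>\<^sup>+\<omega>. ennreal (\<pi> (X \<omega>)) * (case (Y \<omega>, X \<omega>) of (y, x) \<Rightarrow> ennreal (((y - m x) / \<pi> x)\<^sup>2)) \<partial>Q)"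
  proof (rule nn_integral_cong_AE)
    show "AE \<omega> in Q. ennreal (1 / \<pi> (X \<omega>)) * ennreal ((Y \<omega> - m (X \<omega>))\<^sup>2)
        = ennreal (\<pi> (X \<omega>)) * (case (Y \<omega>, X \<omega>) of (y, x) \<Rightarrow> ennreal (((y - m x) / \<pi> x)\<^sup>2))"
      using AE_\<pi>_01
    proof eventually_elim
      case (elim \<omega>)
      then show ?case by (simp add: ennreal_mult'[symmetric] power2_eq_square)
    qed
  qed
  also have "\<dots> = (\<integral>\<^sup>+\<omega>. ennreal (R \<omega>) * (case (Y \<omega>, X \<omega>) of (y, x) \<Rightarrow> ennreal (((y - m x) / \<pi> x)\<^sup>2)) \<partial>Q)"
    by (rule nn_integral_R[symmetric]) simp
  also have "\<dots> = (\<integral>\<^sup>+\<omega>. ennreal (R \<omega> * ?G2 (Y \<omega>, X \<omega>)) \<partial>Q)"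
    by (intro nn_integral_cong) (use R_cases in fastforce)
  also have "\<dots> = ennreal (\<integral>\<omega>. R \<omega> * ?G2 (Y \<omega>, X \<omega>) \<partial>Q)"
  proof (rule nn_integral_eq_integral[OF G2], rule AE_I2)
    fix \<omega> assume "\<omega> \<in> space Q"
    then show "0 \<le> R \<omega> * ?G2 (Y \<omega>, X \<omega>)" using R_cases by fastforce
  qed
  finally have "ennreal (s1\<^sup>2 / a) \<le> ennreal (\<integral>\<omega>. R \<omega> * ?G2 (Y \<omega>, X \<omega>) \<partial>Q)"
    by (simp add: ennreal_mult'[symmetric])
  moreover have "0 \<le> (\<integral>\<omega>. R \<omega> * ?G2 (Y \<omega>, X \<omega>) \<partial>Q)"
    by (intro Bochner_Integration.integral_nonneg_AE AE_I2) (use R_cases in fastforce)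
  ultimately have "s1\<^sup>2 / a \<le> (\<integral>\<omega>. R \<omega> * ?G2 (Y \<omega>, X \<omega>) \<partial>Q)"
    by (simp add: ennreal_le_iff)
  also have "\<dots> \<le> (\<integral>\<omega>. (m (X \<omega>) - \<theta>0)\<^sup>2 \<partial>Q) + (\<integral>\<omega>. R \<omega> * ?G2 (Y \<omega>, X \<omega>) \<partial>Q)"
    by simp
  also have "\<dots> = (\<integral>\<omega>. ((m (X \<omega>) - \<theta>0)\<^sup>2 + 2 * (R \<omega> * ?G1 (Y \<omega>, X \<omega>))) + R \<omega> * ?G2 (Y \<omega>, X \<omega>) \<partial>Q)"
  proof -
    have "(\<integral>\<omega>. ((m (X \<omega>) - \<theta>0)\<^sup>2 + 2 * (R \<omega> * ?G1 (Y \<omega>, X \<omega>))) + R \<omega> * ?G2 (Y \<omega>, X \<omega>) \<partial>Q)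
        = (\<integral>\<omega>. (m (X \<omega>) - \<theta>0)\<^sup>2 + 2 * (R \<omega> * ?G1 (Y \<omega>, X \<omega>)) \<partial>Q) + (\<integral>\<omega>. R \<omega> * ?G2 (Y \<omega>, X \<omega>) \<partial>Q)"
      by (intro Bochner_Integration.integral_add Bochner_Integration.integrable_add
          integrable_mult_right m\<theta> G1(1) G2)
    also have "(\<integral>\<omega>. (m (X \<omega>) - \<theta>0)\<^sup>2 + 2 * (R \<omega> * ?G1 (Y \<omega>, X \<omega>)) \<partial>Q)
        = (\<integral>\<omega>. (m (X \<omega>) - \<theta>0)\<^sup>2 \<partial>Q) + (\<integral>\<omega>. 2 * (R \<omega> * ?G1 (Y \<omega>, X \<omega>)) \<partial>Q)"
      by (intro Bochner_Integration.integral_add integrable_mult_right m\<theta> G1(1))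
    also have "(\<integral>\<omega>. 2 * (R \<omega> * ?G1 (Y \<omega>, X \<omega>)) \<partial>Q) = 0"
      by (simp only: integral_mult_right_zero G1(2) mult_zero_right)
    finally show ?thesis by simp
  qed
  also have "\<dots> = (\<integral>\<omega>. (?s \<omega>)\<^sup>2 \<partial>Q)"
    by (intro Bochner_Integration.integral_cong refl) (simp only: expand)
  also have "\<dots> = (\<integral>\<omega>. (score \<omega>)\<^sup>2 \<partial>Q)"
    by (intro integral_cong_AE) (use ae in auto)
  also have "\<dots> = variance score"
    using \<mu>m by (intro score_variance_upper(1)[symmetric]) simp
  finally show ?thesis .
qed

end

end

section \<open>The doubly robust estimator\<close>

lemma Lr_norm_2_less:
  assumes "Lr_norm 2 M f < ennreal C"
  shows "(\<integral>\<^sup>+x. ennreal ((f x)\<^sup>2) \<partial>M) \<le> ennreal (C\<^sup>2)"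
proof -
  define I where "I = (\<integral>\<^sup>+x. ennreal ((f x)\<^sup>2) \<partial>M)"
  have Lr: "Lr_norm 2 M f = (if I = \<infinity> then \<infinity> else ennreal (sqrt (enn2real I)))"
    by (simp add: Lr_norm_def Let_def I_def[symmetric] powr_half_sqrt)
  have "I \<noteq> \<infinity>" using assms unfolding Lr by auto
  then have "ennreal (sqrt (enn2real I)) < ennreal C" using assms unfolding Lr by simp
  then have "sqrt (enn2real I) < C" by (simp add: ennreal_less_iff)
  then have "(sqrt (enn2real I))\<^sup>2 \<le> C\<^sup>2" by (intro power_mono) auto
  then have "enn2real I \<le> C\<^sup>2" by simp
  then have "ennreal (enn2real I) \<le> ennreal (C\<^sup>2)" by (rule ennreal_leI)
  moreover have "I = ennreal (enn2real I)" using \<open>I \<noteq> \<infinity>\<close> by (simp add: top.not_eq_extremum)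
  ultimately show ?thesis by (simp only: I_def)
qed

lemma nn_integral_abs_product_square:
  assumes [measurable]: "f \<in> borel_measurable M" "h \<in> borel_measurable M"
  shows "(\<integral>\<^sup>+x. ennreal (\<bar>f x\<bar> * \<bar>h x\<bar>) \<partial>M)\<^sup>2
    \<le> (\<integral>\<^sup>+x. ennreal ((f x)\<^sup>2) \<partial>M) * (\<integral>\<^sup>+x. ennreal ((h x)\<^sup>2) \<partial>M)"
  using Cauchy_Schwarz_nn_integral[of "\<lambda>x. ennreal \<bar>f x\<bar>" M "\<lambda>x. ennreal \<bar>h x\<bar>"]
  by (simp add: ennreal_mult ennreal_power)

section \<open>The estimator as a cross-fitted average\<close>

locale drss =
  fixes Q :: "nat \<Rightarrow> 'q measure" and P :: "nat \<Rightarrow> 'w measure"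
    and p :: "nat \<Rightarrow> nat"
    and R Y :: "nat \<Rightarrow> 'q \<Rightarrow> real" and X :: "nat \<Rightarrow> 'q \<Rightarrow> covariate"
    and Rs Ys :: "nat \<Rightarrow> nat \<Rightarrow> 'w \<Rightarrow> real" and Xs :: "nat \<Rightarrow> nat \<Rightarrow> 'w \<Rightarrow> covariate"
    and Zs :: "nat \<Rightarrow> nat \<Rightarrow> 'w \<Rightarrow> observation"
    and PX :: "nat \<Rightarrow> covariate measure"
    and m \<pi> \<mu> e :: "nat \<Rightarrow> covariate \<Rightarrow> real"
    and \<theta>0 a :: "nat \<Rightarrow> real"
    and K :: nat and g :: "nat \<Rightarrow> nat \<Rightarrow> 'w \<Rightarrow> nat"
    and mhat pihat :: "nat \<Rightarrow> estimator"
    and mfit pifit :: "nat \<Rightarrow> nat \<Rightarrow> 'w \<Rightarrow> covariate \<Rightarrow> real"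
    and s1 s2 :: real
    and c\<mu> ce r\<mu> re :: "nat \<Rightarrow> real"
    and \<theta>hat \<psi>mean \<Delta> :: "nat \<Rightarrow> 'w \<Rightarrow> real"
  assumes prob_Q: "\<And>N. prob_space (Q N)"
    and R_rv: "\<And>N. R N \<in> borel_measurable (Q N)"
    and R_01: "\<And>N \<omega>. \<omega> \<in> space (Q N) \<Longrightarrow> R N \<omega> \<in> {0, 1}"
    and Y_rv: "\<And>N. Y N \<in> borel_measurable (Q N)"
    and X_rv: "\<And>N. X N \<in> Q N \<rightarrow>\<^sub>M covariate_space (p N)"
    and PX: "\<And>N. PX N = distr (Q N) (covariate_space (p N)) (X N)"
    and \<theta>0: "\<And>N. \<theta>0 N = (\<integral>\<omega>. Y N \<omega> \<partial>Q N)"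
    and m: "\<And>N. cond_exp_version (Q N) (covariate_space (p N)) (X N) (Y N) (m N)"
    and \<pi>: "\<And>N. cond_exp_version (Q N) (covariate_space (p N)) (X N)
                    (\<lambda>\<omega>. indicator {1} (R N \<omega>)) (\<pi> N)"
    and \<pi>_inv: "\<And>N. (\<integral>\<^sup>+x. 1 / ennreal (\<pi> N x) \<partial>PX N) < \<infinity>"
    and a: "\<And>N. a N = 1 / (\<integral>x. 1 / \<pi> N x \<partial>PX N)"
    and \<mu>_meas: "\<And>N. \<mu> N \<in> borel_measurable (covariate_space (p N))"
    and e_meas: "\<And>N. e N \<in> borel_measurable (covariate_space (p N))"
    and prob_P: "\<And>N. prob_space (P N)"
    and Zs: "\<And>N i \<omega>. Zs N i \<omega> = (Rs N i \<omega>, Rs N i \<omega> * Ys N i \<omega>, Xs N i \<omega>)"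
    and iid: "\<And>N. iid_sample (P N) N (observation_space (p N)) (Zs N)
                (distr (Q N) (observation_space (p N)) (\<lambda>\<omega>. (R N \<omega>, R N \<omega> * Y N \<omega>, X N \<omega>)))"
    and folds: "\<And>N. independent_folds (P N) N K (observation_space (p N)) (Zs N) (g N)"
    and mhat_meas: "\<And>N. measurable_estimator N (p N) (mhat N)"
    and pihat_meas: "\<And>N. measurable_estimator N (p N) (pihat N)"
    and mfit: "\<And>N. mfit N = fold_fit N (g N) (Zs N) (mhat N)"
    and pifit: "\<And>N. pifit N = fold_fit N (g N) (Zs N) (pihat N)"
    and ignorability: "\<And>N. cond_indep_given (Q N) (covariate_space (p N)) (X N) (R N) (Y N)"
    and s_pos: "s1 > 0" "s2 > 0"
    and basic: "\<And>N. basic_assumption (Q N) (p N) (R N) (Y N) (X N) (m N) (\<mu> N) s1 s2"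
    and rates_nonneg: "\<And>N. 0 \<le> c\<mu> N" "\<And>N. 0 \<le> ce N" "\<And>N. 0 \<le> r\<mu> N" "\<And>N. 0 \<le> re N"
    and rate_c\<mu>: "\<And>k. k \<in> {1..K} \<Longrightarrow>
          Op_nn P (\<lambda>N \<omega>. \<integral>\<^sup>+x. ennreal (a N / \<pi> N x * (mfit N k \<omega> x - \<mu> N x)\<^sup>2) \<partial>PX N)
            (\<lambda>N. (c\<mu> N)\<^sup>2)"
    and rate_ce: "\<And>k. k \<in> {1..K} \<Longrightarrow>
          Op_nn P (\<lambda>N \<omega>. \<integral>\<^sup>+x. ennreal (a N / \<pi> N x * (1 - e N x / pifit N k \<omega> x)\<^sup>2) \<partial>PX N)
            (\<lambda>N. (ce N)\<^sup>2)"
    and rate_r\<mu>: "\<And>k. k \<in> {1..K} \<Longrightarrow>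
          Op_nn P (\<lambda>N \<omega>. \<integral>\<^sup>+x. ennreal ((mfit N k \<omega> x - \<mu> N x)\<^sup>2) \<partial>PX N) (\<lambda>N. (r\<mu> N)\<^sup>2)"
    and rate_re: "\<And>k. k \<in> {1..K} \<Longrightarrow>
          Op_nn P (\<lambda>N \<omega>. \<integral>\<^sup>+x. ennreal ((1 - e N x / pifit N k \<omega> x)\<^sup>2) \<partial>PX N)
            (\<lambda>N. (re N)\<^sup>2)"
    and \<theta>hat: "\<And>N \<omega>. \<theta>hat N \<omega> =
          (1 / real N) * (\<Sum>i=1..N. mfit N (g N i \<omega>) \<omega> (Xs N i \<omega>)) +
          (1 / real N) * (\<Sum>i=1..N. Rs N i \<omega> / pifit N (g N i \<omega>) \<omega> (Xs N i \<omega>) *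
             (Ys N i \<omega> - mfit N (g N i \<omega>) \<omega> (Xs N i \<omega>)))"
    and \<psi>mean: "\<And>N \<omega>. \<psi>mean N \<omega> = (1 / real N) *
          (\<Sum>i=1..N. dr_score (\<mu> N) (e N) (\<theta>0 N) (Rs N i \<omega>) (Ys N i \<omega>) (Xs N i \<omega>))"
    and \<Delta>: "\<And>N \<omega>. \<Delta> N \<omega> =
          (if AE x in PX N. e N x = \<pi> N x then
             (1 / real N) * (\<Sum>i=1..N.
               (Rs N i \<omega> / \<pi> N (Xs N i \<omega>) - Rs N i \<omega> / pifit N (g N i \<omega>) \<omega> (Xs N i \<omega>)) *
               (\<mu> N (Xs N i \<omega>) - m N (Xs N i \<omega>)))
           else
             (1 / real N) * (\<Sum>i=1..N.
               (Rs N i \<omega> / \<pi> N (Xs N i \<omega>) - Rs N i \<omega> / e N (Xs N i \<omega>)) *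
               (mfit N (g N i \<omega>) \<omega> (Xs N i \<omega>) - m N (Xs N i \<omega>))))"
begin

sublocale M: dr_model "Q N" "p N" "R N" "Y N" "X N" "PX N" "m N" "\<pi> N" "\<mu> N" "\<theta>0 N" "a N" s1 s2 for N
  by (intro dr_model.intro dr_model_axioms.intro prob_Q R_rv R_01 Y_rv X_rv PX \<theta>0 m \<pi> \<pi>_inv a \<mu>_meas
      ignorability s_pos basic)

sublocale CS: crossfit_seq P K "\<lambda>N. observation_space (p N)" "\<lambda>N. M.law N" Zs g
  by (intro crossfit_seq.intro prob_seq.intro crossfit_seq_axioms.intro crossfit.intro crossfit_axioms.intro
      prob_P M.prob_law M.sets_law iid[folded M.law_def] folds)

lemmas [measurable] = e_meas
lemmas a_pos = M.a_inverse(2)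

definition e_correct :: "nat \<Rightarrow> bool" where "e_correct N \<longleftrightarrow> (AE x in PX N. e N x = \<pi> N x)"
definition \<mu>_correct :: "nat \<Rightarrow> bool" where "\<mu>_correct N \<longleftrightarrow> (AE x in PX N. \<mu> N x = m N x)"

lemma mfit_eq: "mfit N k \<omega> = mhat N (CS.CF.training N k \<omega>) (CS.CF.training_data N k \<omega>)"
  by (simp add: mfit fold_fit_def CS.CF.training_data_def)

lemma pifit_eq: "pifit N k \<omega> = pihat N (CS.CF.training N k \<omega>) (CS.CF.training_data N k \<omega>)"
  by (simp add: pifit fold_fit_def CS.CF.training_data_def)

abbreviation data_space :: "nat \<Rightarrow> nat set \<Rightarrow> (nat \<Rightarrow> observation) measure" where
  "data_space N J \<equiv> Pi\<^sub>M J (\<lambda>_. observation_space (p N))"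

context
  fixes N :: nat and J :: "nat set" assumes J: "J \<subseteq> {1..N}"
begin

lemma mhat_pair[measurable]:
  "(\<lambda>w. mhat N J (fst w) (snd w)) \<in> borel_measurable (data_space N J \<Otimes>\<^sub>M covariate_space (p N))"
  using mhat_meas[of N] J by (auto simp: measurable_estimator_def split_beta')

lemma pihat_pair[measurable]:
  "(\<lambda>w. pihat N J (fst w) (snd w)) \<in> borel_measurable (data_space N J \<Otimes>\<^sub>M covariate_space (p N))"
  using pihat_meas[of N] J by (auto simp: measurable_estimator_def split_beta')

lemma covariate_of_pair:
  "(\<lambda>w. (fst w, snd (snd (snd w)))) \<in>
    data_space N J \<Otimes>\<^sub>M observation_space (p N) \<rightarrow>\<^sub>M data_space N J \<Otimes>\<^sub>M covariate_space (p N)"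
  by measurable

lemma mhat_obs[measurable]:
  "(\<lambda>w. mhat N J (fst w) (snd (snd (snd w)))) \<in> borel_measurable (data_space N J \<Otimes>\<^sub>M observation_space (p N))"
  using measurable_compose[OF covariate_of_pair mhat_pair] by simp

lemma pihat_obs[measurable]:
  "(\<lambda>w. pihat N J (fst w) (snd (snd (snd w)))) \<in> borel_measurable (data_space N J \<Otimes>\<^sub>M observation_space (p N))"
  using measurable_compose[OF covariate_of_pair pihat_pair] by simp

lemma mhat_section: "z \<in> space (data_space N J) \<Longrightarrow> mhat N J z \<in> borel_measurable (covariate_space (p N))"
  using measurable_compose[OF measurable_Pair1' mhat_pair] by simp

lemma pihat_section: "z \<in> space (data_space N J) \<Longrightarrow> pihat N J z \<in> borel_measurable (covariate_space (p N))"
  using measurable_compose[OF measurable_Pair1' pihat_pair] by simp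

lemma nn_integral_PX_measurable:
  assumes "(\<lambda>w. f (fst w) (snd w)) \<in> borel_measurable (data_space N J \<Otimes>\<^sub>M covariate_space (p N))"
  shows "(\<lambda>z. \<integral>\<^sup>+x. f z x \<partial>PX N) \<in> borel_measurable (data_space N J)"
proof -
  interpret prob_space "PX N" by (rule M.prob_PX)
  have "sets (data_space N J \<Otimes>\<^sub>M PX N) = sets (data_space N J \<Otimes>\<^sub>M covariate_space (p N))"
    by (intro sets_pair_measure_cong refl M.sets_PX)
  then have "case_prod f \<in> borel_measurable (data_space N J \<Otimes>\<^sub>M PX N)"
    using assms measurable_cong_sets by (auto simp: split_beta')
  then show ?thesis by (rule borel_measurable_nn_integral)
qed

end

text \<open>These errors are functions of a training set and its data, not of the outcome, as the
  conditional bounds require; inserting the random training data gives back the quantities of the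
  rate hypotheses.\<close>

definition err_c\<mu> where "err_c\<mu> N J z = M.weighted_sq N (\<lambda>x. mhat N J z x - \<mu> N x)"
definition err_ce where "err_ce N J z = M.weighted_sq N (\<lambda>x. 1 - e N x / pihat N J z x)"
definition err_r\<mu> where "err_r\<mu> N J z = (\<integral>\<^sup>+x. ennreal ((mhat N J z x - \<mu> N x)\<^sup>2) \<partial>PX N)"
definition err_re where "err_re N J z = (\<integral>\<^sup>+x. ennreal ((1 - e N x / pihat N J z x)\<^sup>2) \<partial>PX N)"
definition err_prod where "err_prod N J z =
  (\<integral>\<^sup>+x. ennreal (\<bar>1 - e N x / pihat N J z x\<bar> * \<bar>mhat N J z x - \<mu> N x\<bar>) \<partial>PX N)"

lemma err_measurable:
  assumes J: "J \<subseteq> {1..N}"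
  shows "err_c\<mu> N J \<in> borel_measurable (data_space N J)" "err_ce N J \<in> borel_measurable (data_space N J)"
    "err_r\<mu> N J \<in> borel_measurable (data_space N J)" "err_re N J \<in> borel_measurable (data_space N J)"
    "err_prod N J \<in> borel_measurable (data_space N J)"
proof -
  note [measurable] = mhat_pair[OF J] pihat_pair[OF J]
  show "err_c\<mu> N J \<in> borel_measurable (data_space N J)"
    unfolding err_c\<mu>_def[abs_def] M.weighted_sq_def by (rule nn_integral_PX_measurable[OF J]) measurable
  show "err_ce N J \<in> borel_measurable (data_space N J)"
    unfolding err_ce_def[abs_def] M.weighted_sq_def by (rule nn_integral_PX_measurable[OF J]) measurable
  show "err_r\<mu> N J \<in> borel_measurable (data_space N J)"
    unfolding err_r\<mu>_def[abs_def] by (rule nn_integral_PX_measurable[OF J]) measurable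
  show "err_re N J \<in> borel_measurable (data_space N J)"
    unfolding err_re_def[abs_def] by (rule nn_integral_PX_measurable[OF J]) measurable
  show "err_prod N J \<in> borel_measurable (data_space N J)"
    unfolding err_prod_def[abs_def] by (rule nn_integral_PX_measurable[OF J]) measurable
qed

abbreviation at_fold where
  "at_fold V k N \<omega> \<equiv> V N (CS.CF.training N k \<omega>) (CS.CF.training_data N k \<omega>)"

lemma err_Op_nn:
  assumes k: "k \<in> {1..K}"
  shows "Op_nn P (at_fold err_c\<mu> k) (\<lambda>N. (c\<mu> N)\<^sup>2)" "Op_nn P (at_fold err_ce k) (\<lambda>N. (ce N)\<^sup>2)"
    "Op_nn P (at_fold err_r\<mu> k) (\<lambda>N. (r\<mu> N)\<^sup>2)" "Op_nn P (at_fold err_re k) (\<lambda>N. (re N)\<^sup>2)"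
  using rate_c\<mu>[OF k] rate_ce[OF k] rate_r\<mu>[OF k] rate_re[OF k]
  by (simp_all add: err_c\<mu>_def err_ce_def err_r\<mu>_def err_re_def M.weighted_sq_def mfit_eq pifit_eq)

lemma at_fold_measurable:
  assumes "\<And>J. J \<subseteq> {1..N} \<Longrightarrow> W N J \<in> borel_measurable (data_space N J)"
  shows "(\<lambda>\<omega>. at_fold W k N \<omega>) \<in> borel_measurable (P N)"
  by (rule CS.CF.training_data_measurable) (rule assms)

text \<open>
  The arguments \<open>(r, w, x)\<close> below are an observation \<open>(R, R Y, X)\<close>.  The unobserved \<open>Y\<close> never occurs
  alone: \<open>R (Y - f(X)) = w - r f(x)\<close>.
\<close>

definition H_imp :: "nat \<Rightarrow> nat set \<Rightarrow> (nat \<Rightarrow> observation) \<Rightarrow> observation \<Rightarrow> real" where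
  "H_imp N J z = (\<lambda>(r, w, x). (1 - r / \<pi> N x) * (mhat N J z x - \<mu> N x))"

definition H_wt :: "nat \<Rightarrow> nat set \<Rightarrow> (nat \<Rightarrow> observation) \<Rightarrow> observation \<Rightarrow> real" where
  "H_wt N J z = (\<lambda>(r, w, x). (1 / pihat N J z x - 1 / e N x) * (w - r * m N x))"

definition H_prod :: "nat \<Rightarrow> nat set \<Rightarrow> (nat \<Rightarrow> observation) \<Rightarrow> observation \<Rightarrow> real" where
  "H_prod N J z = (\<lambda>(r, w, x). (r / pihat N J z x - r / e N x) * (mhat N J z x - \<mu> N x))"

definition H_\<Delta> :: "nat \<Rightarrow> nat set \<Rightarrow> (nat \<Rightarrow> observation) \<Rightarrow> observation \<Rightarrow> real" where
  "H_\<Delta> N J z = (\<lambda>(r, w, x).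
     if e_correct N then (r / \<pi> N x - r / pihat N J z x) * (\<mu> N x - m N x)
     else (r / \<pi> N x - r / e N x) * (mhat N J z x - m N x))"

definition obs_score :: "nat \<Rightarrow> observation \<Rightarrow> real" where
  "obs_score N = (\<lambda>(r, w, x). \<mu> N x + (w - r * \<mu> N x) / e N x - \<theta>0 N)"

definition H_\<theta> :: "nat \<Rightarrow> nat set \<Rightarrow> (nat \<Rightarrow> observation) \<Rightarrow> observation \<Rightarrow> real" where
  "H_\<theta> N J z = (\<lambda>(r, w, x). mhat N J z x + (w - r * mhat N J z x) / pihat N J z x)"

lemma obs_score_measurable[measurable]: "obs_score N \<in> borel_measurable (observation_space (p N))"
  unfolding obs_score_def split_beta' by measurable

lemma obs_score_Q: "obs_score N (R N \<omega>, R N \<omega> * Y N \<omega>, X N \<omega>)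
    = dr_score (\<mu> N) (e N) (\<theta>0 N) (R N \<omega>) (Y N \<omega>) (X N \<omega>)"
  by (simp add: obs_score_def dr_score_def diff_divide_distrib algebra_simps)

lemma H_measurable:
  assumes J: "J \<subseteq> {1..N}"
  shows "(\<lambda>(z, x). H_imp N J z x) \<in> borel_measurable (data_space N J \<Otimes>\<^sub>M observation_space (p N))"
    "(\<lambda>(z, x). H_wt N J z x) \<in> borel_measurable (data_space N J \<Otimes>\<^sub>M observation_space (p N))"
    "(\<lambda>(z, x). H_prod N J z x) \<in> borel_measurable (data_space N J \<Otimes>\<^sub>M observation_space (p N))"
    "(\<lambda>(z, x). H_\<Delta> N J z x) \<in> borel_measurable (data_space N J \<Otimes>\<^sub>M observation_space (p N))"
    "(\<lambda>(z, x). H_\<theta> N J z x) \<in> borel_measurable (data_space N J \<Otimes>\<^sub>M observation_space (p N))"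
    "(\<lambda>(z, x). obs_score N x) \<in> borel_measurable (data_space N J \<Otimes>\<^sub>M observation_space (p N))"
proof -
  note [measurable] = mhat_obs[OF J] pihat_obs[OF J]
  show "(\<lambda>(z, x). H_imp N J z x) \<in> borel_measurable (data_space N J \<Otimes>\<^sub>M observation_space (p N))"
    unfolding H_imp_def split_beta' by measurable
  show "(\<lambda>(z, x). H_wt N J z x) \<in> borel_measurable (data_space N J \<Otimes>\<^sub>M observation_space (p N))"
    unfolding H_wt_def split_beta' by measurable
  show "(\<lambda>(z, x). H_prod N J z x) \<in> borel_measurable (data_space N J \<Otimes>\<^sub>M observation_space (p N))"
    unfolding H_prod_def split_beta' by measurable
  show "(\<lambda>(z, x). H_\<Delta> N J z x) \<in> borel_measurable (data_space N J \<Otimes>\<^sub>M observation_space (p N))"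
    unfolding H_\<Delta>_def split_beta' by measurable
  show "(\<lambda>(z, x). H_\<theta> N J z x) \<in> borel_measurable (data_space N J \<Otimes>\<^sub>M observation_space (p N))"
    unfolding H_\<theta>_def split_beta' by measurable
  show "(\<lambda>(z, x). obs_score N x) \<in> borel_measurable (data_space N J \<Otimes>\<^sub>M observation_space (p N))"
    unfolding split_beta' by measurable
qed

abbreviation "T_imp N \<equiv> CS.CF.total_mean N (H_imp N)"
abbreviation "T_wt N \<equiv> CS.CF.total_mean N (H_wt N)"
abbreviation "T_prod N \<equiv> CS.CF.total_mean N (H_prod N)"

lemma T_measurable[measurable]:
  "T_imp N \<in> borel_measurable (P N)" "T_wt N \<in> borel_measurable (P N)" "T_prod N \<in> borel_measurable (P N)"
  by (intro CS.CF.total_mean_measurable H_measurable, assumption)+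

lemma \<theta>hat_eq: "\<theta>hat N = CS.CF.total_mean N (H_\<theta> N)"
  by (simp add: fun_eq_iff \<theta>hat CS.CF.total_mean_def H_\<theta>_def Zs mfit_eq pifit_eq sum.distrib
      sum_subtractf diff_divide_distrib add_divide_distrib algebra_simps)

lemma \<psi>mean_eq: "\<psi>mean N = CS.CF.total_mean N (\<lambda>_ _. obs_score N)"
  by (simp add: fun_eq_iff \<psi>mean CS.CF.total_mean_def obs_score_def Zs dr_score_def
      diff_divide_distrib algebra_simps)

lemma \<Delta>_eq: "\<Delta> N = CS.CF.total_mean N (H_\<Delta> N)"
  by (simp add: fun_eq_iff \<Delta> CS.CF.total_mean_def H_\<Delta>_def Zs mfit_eq pifit_eq e_correct_def)

lemma estimators_measurable[measurable]:
  "\<theta>hat N \<in> borel_measurable (P N)" "\<psi>mean N \<in> borel_measurable (P N)" "\<Delta> N \<in> borel_measurable (P N)"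
  unfolding \<theta>hat_eq \<psi>mean_eq \<Delta>_eq by (intro CS.CF.total_mean_measurable H_measurable, assumption)+

text \<open>\<open>PX N\<close> is the covariate marginal of the common law of the observations, and
  only finitely many indices occur.\<close>

lemma AE_sample_X:
  assumes "AE x in PX N. T x"
  shows "AE \<omega> in P N. \<forall>i\<in>{1..N}. T (Xs N i \<omega>)"
proof -
  have "AE \<omega> in P N. T (Xs N i \<omega>)" if i: "i \<in> {1..N}" for i
  proof -
    have eq: "PX N = distr (M.law N) (covariate_space (p N)) (\<lambda>z. snd (snd z))"
      unfolding M.law_def PX by (subst distr_distr) (auto simp: comp_def)
    have "(\<lambda>z. snd (snd z)) \<in> M.law N \<rightarrow>\<^sub>M covariate_space (p N)"
      by (simp add: measurable_cong_sets[OF M.sets_law refl])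
    then have ae: "AE z in M.law N. T (snd (snd z))"
      by (rule AE_distrD) (rule assms[unfolded eq])
    have law: "M.law N = distr (P N) (observation_space (p N)) (Zs N i)"
      using CS.CF.iid[of N] i by (simp add: iid_sample_def)
    have "AE z in distr (P N) (observation_space (p N)) (Zs N i). T (snd (snd z))"
      using ae by (rule subst[OF law, of "\<lambda>M. AE z in M. T (snd (snd z))"])
    then have "AE \<omega> in P N. T (snd (snd (Zs N i \<omega>)))"
      by (rule AE_distrD[OF CS.CF.Z_measurable[OF i]])
    then show ?thesis by (simp add: Zs)
  qed
  then show ?thesis by (intro AE_finite_allI) auto
qed

text \<open>Per observation, and before \<Delta> is subtracted, the sides differ by \<open>R (1 /
  pihat - 1 / e) (m - \<mu>) + R (1 / \<pi> - 1 / e) (mhat - \<mu>)\<close>. A correct \<mu> removes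
  the first summand and a correct \<open>e\<close> the second; what is left is the summand of
  \<Delta>.\<close>

lemma decomposition:
  assumes N: "N > 0" and correct: "\<mu>_correct N \<or> e_correct N"
  shows "AE \<omega> in P N. \<theta>hat N \<omega> - \<theta>0 N - \<psi>mean N \<omega> - \<Delta> N \<omega> = T_imp N \<omega> + T_wt N \<omega> - T_prod N \<omega>"
proof -
  \<comment> \<open>The choice follows the branches of \<Delta>, in which a correct propensity limit
    takes precedence.\<close>
  let ?T = "\<lambda>x. if e_correct N then e N x = \<pi> N x else \<mu> N x = m N x"
  have "AE x in PX N. ?T x" using correct by (auto simp: e_correct_def \<mu>_correct_def)
  from AE_sample_X[OF this] show ?thesis
  proof eventually_elim
    case (elim \<omega>)
    define D where "D i = CS.CF.training N (g N i \<omega>) \<omega>" for i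
    define Z where "Z i = CS.CF.training_data N (g N i \<omega>) \<omega>" for i
    have pt: "H_\<theta> N (D i) (Z i) (Zs N i \<omega>) - \<theta>0 N - obs_score N (Zs N i \<omega>) - H_\<Delta> N (D i) (Z i) (Zs N i \<omega>)
        = H_imp N (D i) (Z i) (Zs N i \<omega>) + H_wt N (D i) (Z i) (Zs N i \<omega>) - H_prod N (D i) (Z i) (Zs N i \<omega>)"
      if "i \<in> {1..N}" for i
    proof -
      have "?T (Xs N i \<omega>)" using elim that by blast
      then show ?thesis
        by (auto simp: H_\<theta>_def obs_score_def H_\<Delta>_def H_imp_def H_wt_def H_prod_def Zs
            diff_divide_distrib algebra_simps split: if_splits)
    qed
    have "\<theta>0 N = (1 / real N) * (\<Sum>i=1..N. \<theta>0 N)" using N by simp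
    then have "\<theta>hat N \<omega> - \<theta>0 N - \<psi>mean N \<omega> - \<Delta> N \<omega> = (1 / real N) *
        (\<Sum>i=1..N. H_\<theta> N (D i) (Z i) (Zs N i \<omega>) - \<theta>0 N - obs_score N (Zs N i \<omega>) - H_\<Delta> N (D i) (Z i) (Zs N i \<omega>))"
      unfolding \<theta>hat_eq \<psi>mean_eq \<Delta>_eq CS.CF.total_mean_def D_def[symmetric] Z_def[symmetric]
      by (simp only: sum_subtractf right_diff_distrib)
    also have "\<dots> = (1 / real N) * (\<Sum>i=1..N. H_imp N (D i) (Z i) (Zs N i \<omega>) +
        H_wt N (D i) (Z i) (Zs N i \<omega>) - H_prod N (D i) (Z i) (Zs N i \<omega>))"
      by (intro arg_cong2[where f = "(*)"] refl sum.cong pt)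
    also have "\<dots> = T_imp N \<omega> + T_wt N \<omega> - T_prod N \<omega>"
      unfolding CS.CF.total_mean_def D_def[symmetric] Z_def[symmetric]
      by (simp only: sum_subtractf sum.distrib right_diff_distrib distrib_left)
    finally show ?case .
  qed
qed

section \<open>Orders of the remainder terms\<close>

abbreviation "root_Na N \<equiv> sqrt (real N * a N)"

lemma sqrt_rate: "0 \<le> c \<Longrightarrow> 0 \<le> \<kappa> \<Longrightarrow> sqrt (\<kappa> / a N * c\<^sup>2 / real N) = sqrt \<kappa> * (c / root_Na N)"
  by (simp add: real_sqrt_divide real_sqrt_mult)

lemma Op_T_imp: "Op P T_imp (\<lambda>N. c\<mu> N / root_Na N)"
proof -
  have "Op P T_imp (\<lambda>N. sqrt (2 / a N * (c\<mu> N)\<^sup>2 / real N))"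
  proof (rule CS.Op_total_mean_centred[where W = "\<lambda>N J z. ennreal (2 / a N) * err_c\<mu> N J z"])
    fix N J z assume J: "J \<subseteq> {1..N}" and z: "z \<in> space (data_space N J)"
    note [measurable] = mhat_section[OF J z]
    have f: "(\<lambda>x. mhat N J z x - \<mu> N x) \<in> borel_measurable (covariate_space (p N))" by measurable
    have H[measurable]: "H_imp N J z \<in> borel_measurable (observation_space (p N))"
      unfolding H_imp_def split_beta' by measurable
    show "(\<integral>\<^sup>+x. ennreal ((H_imp N J z x)\<^sup>2) \<partial>M.law N) \<le> ennreal (2 / a N) * err_c\<mu> N J z"
      using M.imputation_second_moment[OF f] by (subst M.nn_integral_law) (auto simp: H_imp_def err_c\<mu>_def)
    assume "ennreal (2 / a N) * err_c\<mu> N J z < \<infinity>"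
    then have "err_c\<mu> N J z < \<infinity>" using a_pos[of N] by (auto simp: ennreal_mult_less_top ennreal_eq_0_iff)
    then show "(\<integral>x. H_imp N J z x \<partial>M.law N) = 0"
      using M.imputation_mean[OF f] by (subst M.integral_law) (auto simp: H_imp_def err_c\<mu>_def)
  next
    fix k assume k: "k \<in> {1..K}"
    show "Op_nn P (\<lambda>N \<omega>. ennreal (2 / a N) * at_fold err_c\<mu> k N \<omega>) (\<lambda>N. 2 / a N * (c\<mu> N)\<^sup>2)"
      by (rule CS.Op_nn_scale[OF err_Op_nn(1)[OF k]])
         (use a_pos in \<open>auto intro: at_fold_measurable err_measurable less_imp_le\<close>)
  next
    show "0 \<le> 2 / a N * (c\<mu> N)\<^sup>2" for N using a_pos[of N] by simp
  qed (assumption | rule H_measurable borel_measurable_times_ennreal borel_measurable_const err_measurable)+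
  then show ?thesis
    by (rule CS.Op_rate_mono[where \<kappa> = "sqrt 2"]) (use sqrt_rate rates_nonneg in auto)
qed

context
  fixes C :: real
  assumes C: "1 \<le> C" and ratio: "\<And>N. AE x in PX N. 0 < e N x \<and> \<pi> N x / e N x \<le> C"
begin

lemma Op_T_wt: "Op P T_wt (\<lambda>N. ce N / root_Na N)"
proof -
  define \<kappa> where "\<kappa> = s2\<^sup>2 * C\<^sup>2"
  have \<kappa>: "0 < \<kappa>" using C s_pos by (simp add: \<kappa>_def)
  have "Op P T_wt (\<lambda>N. sqrt (\<kappa> / a N * (ce N)\<^sup>2 / real N))"
  proof (rule CS.Op_total_mean_centred[where W = "\<lambda>N J z. ennreal (\<kappa> / a N) * err_ce N J z"])
    fix N J z assume J: "J \<subseteq> {1..N}" and z: "z \<in> space (data_space N J)"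
    note t[measurable] = pihat_section[OF J z]
    have H[measurable]: "H_wt N J z \<in> borel_measurable (observation_space (p N))"
      unfolding H_wt_def split_beta' by measurable
    show "(\<integral>\<^sup>+x. ennreal ((H_wt N J z x)\<^sup>2) \<partial>M.law N) \<le> ennreal (\<kappa> / a N) * err_ce N J z"
      using M.weighting_second_moment[OF e_meas C ratio t]
      by (subst M.nn_integral_law) (auto simp: H_wt_def err_ce_def \<kappa>_def)
    assume "ennreal (\<kappa> / a N) * err_ce N J z < \<infinity>"
    \<comment> \<open>In \<open>ennreal\<close> the product of 0 and infinity is 0, so the error can
      be inferred to be finite only after the factor is known to be nonzero.\<close>
    moreover have "ennreal (\<kappa> / a N) \<noteq> 0"
      using a_pos[of N] \<kappa> by (simp add: ennreal_eq_0_iff not_le)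
    ultimately have "err_ce N J z < \<infinity>" by (simp only: ennreal_mult_less_top infinity_ennreal_def) auto
    then show "(\<integral>x. H_wt N J z x \<partial>M.law N) = 0"
      using M.weighting_mean[OF e_meas C ratio t] by (subst M.integral_law) (auto simp: H_wt_def err_ce_def)
  next
    fix k assume k: "k \<in> {1..K}"
    show "Op_nn P (\<lambda>N \<omega>. ennreal (\<kappa> / a N) * at_fold err_ce k N \<omega>) (\<lambda>N. \<kappa> / a N * (ce N)\<^sup>2)"
      by (rule CS.Op_nn_scale[OF err_Op_nn(2)[OF k]])
         (use a_pos \<kappa> in \<open>auto intro: at_fold_measurable err_measurable less_imp_le\<close>)
  next
    show "0 \<le> \<kappa> / a N * (ce N)\<^sup>2" for N using a_pos[of N] \<kappa> by simp
  qed (assumption | rule H_measurable borel_measurable_times_ennreal borel_measurable_const err_measurable)+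
  then show ?thesis
    by (rule CS.Op_rate_mono[where \<kappa> = "sqrt \<kappa>"]) (use sqrt_rate rates_nonneg \<kappa> in auto)
qed

lemma Op_T_prod: "Op P T_prod (\<lambda>N. r\<mu> N * re N)"
proof -
  have "Op P T_prod (\<lambda>N. C * (re N * r\<mu> N))"
  proof (rule CS.Op_total_mean_L1[where W = "\<lambda>N J z. ennreal C * err_prod N J z"])
    fix N J z assume J: "J \<subseteq> {1..N}" and z: "z \<in> space (data_space N J)"
    note t[measurable] = pihat_section[OF J z] mhat_section[OF J z]
    have f: "(\<lambda>x. mhat N J z x - \<mu> N x) \<in> borel_measurable (covariate_space (p N))" by measurable
    have H[measurable]: "H_prod N J z \<in> borel_measurable (observation_space (p N))"
      unfolding H_prod_def split_beta' by measurable
    show "(\<integral>\<^sup>+x. ennreal \<bar>H_prod N J z x\<bar> \<partial>M.law N) \<le> ennreal C * err_prod N J z"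
      using M.product_first_moment[OF e_meas C ratio t(1) f]
      by (subst M.nn_integral_law) (auto simp: H_prod_def err_prod_def)
  next
    fix k assume k: "k \<in> {1..K}"
    have "Op_nn P (at_fold err_prod k) (\<lambda>N. re N * r\<mu> N)"
    \<comment> \<open>The Cauchy--Schwarz inequality is applied to the integral over the fresh
      covariate, for each realization of the training data.\<close>
    proof (rule CS.Op_nn_Cauchy_Schwarz[OF err_Op_nn(4)[OF k] err_Op_nn(3)[OF k]])
      fix N \<omega> assume \<omega>: "\<omega> \<in> space (P N)"
      let ?J = "CS.CF.training N k \<omega>" and ?z = "CS.CF.training_data N k \<omega>"
      have J: "?J \<subseteq> {1..N}" by (auto simp: training_indices_def)
      have z: "?z \<in> space (data_space N ?J)"
        using measurable_space[OF CS.CF.Z_measurable[of _ N] \<omega>] J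
        by (auto simp: CS.CF.training_data_def space_PiM)
      note [measurable] = pihat_section[OF J z] mhat_section[OF J z]
      show "(at_fold err_prod k N \<omega>)\<^sup>2 \<le> at_fold err_re k N \<omega> * at_fold err_r\<mu> k N \<omega>"
        unfolding err_prod_def err_re_def err_r\<mu>_def
        by (rule nn_integral_abs_product_square) (auto simp: measurable_cong_sets[OF M.sets_PX refl])
    qed (use rates_nonneg in \<open>auto intro: at_fold_measurable err_measurable\<close>)
    then show "Op_nn P (\<lambda>N \<omega>. ennreal C * at_fold err_prod k N \<omega>) (\<lambda>N. C * (re N * r\<mu> N))"
      by (rule CS.Op_nn_scale) (use C rates_nonneg in \<open>auto intro: at_fold_measurable err_measurable\<close>)
  next
    show "0 \<le> C * (re N * r\<mu> N)" for N using C rates_nonneg by simp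
  qed (assumption | rule H_measurable borel_measurable_times_ennreal borel_measurable_const err_measurable)+
  then show ?thesis
    by (rule CS.Op_rate_mono[where \<kappa> = C]) (use C in \<open>auto simp: mult.commute\<close>)
qed

context
  assumes correct: "\<And>N. \<mu>_correct N \<or> e_correct N"
begin

lemma Op_remainder: "Op P (\<lambda>N \<omega>. \<theta>hat N \<omega> - \<theta>0 N - \<psi>mean N \<omega> - \<Delta> N \<omega>)
  (\<lambda>N. c\<mu> N / root_Na N + ce N / root_Na N + r\<mu> N * re N)"
proof (rule CS.Op_AE_le)
  show "Op P (\<lambda>N \<omega>. T_imp N \<omega> + T_wt N \<omega> - T_prod N \<omega>)
      (\<lambda>N. c\<mu> N / root_Na N + ce N / root_Na N + r\<mu> N * re N)"
    using rates_nonneg a_pos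
    by (intro CS.Op_diff CS.Op_add Op_T_imp Op_T_wt Op_T_prod) (auto intro!: add_nonneg_nonneg divide_nonneg_nonneg mult_nonneg_nonneg simp: less_imp_le)
  show "\<forall>\<^sub>F N in sequentially. AE \<omega> in P N.
      \<bar>\<theta>hat N \<omega> - \<theta>0 N - \<psi>mean N \<omega> - \<Delta> N \<omega>\<bar> \<le> \<bar>T_imp N \<omega> + T_wt N \<omega> - T_prod N \<omega>\<bar>"
    using eventually_gt_at_top[of 0]
  proof eventually_elim
    case (elim N)
    show ?case using decomposition[OF elim correct] by eventually_elim simp
  qed
qed simp

lemma correct_AE: "(AE x in PX N. \<mu> N x = m N x) \<or> (AE x in PX N. e N x = \<pi> N x)"
  using correct[of N] by (simp add: \<mu>_correct_def e_correct_def)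

text \<open>The score ignores the training data, so its mean is a cross-fitted average with a
  constant error bound; the factor \<open>1\<^sup>2\<close> casts the rate into the form of
  \<open>sqrt_rate\<close>.\<close>

lemma Op_\<psi>mean: "Op P \<psi>mean (\<lambda>N. 1 / root_Na N)"
proof -
  define \<kappa> where "\<kappa> = s2\<^sup>2 * (8 + 2 * C\<^sup>2)"
  have \<kappa>: "0 < \<kappa>" using s_pos by (auto simp: \<kappa>_def intro!: mult_pos_pos add_pos_nonneg)
  have "Op P (\<lambda>N. CS.CF.total_mean N (\<lambda>_ _. obs_score N)) (\<lambda>N. sqrt (\<kappa> / a N * 1\<^sup>2 / real N))"
  proof (rule CS.Op_total_mean_centred[where W = "\<lambda>N J z. ennreal (\<kappa> / a N)"])
    fix N
    show "(\<integral>\<^sup>+x. ennreal ((obs_score N x)\<^sup>2) \<partial>M.law N) \<le> ennreal (\<kappa> / a N)"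
      using M.score_second_moment[OF e_meas C ratio]
      by (subst M.nn_integral_law) (auto simp: obs_score_Q \<kappa>_def)
    show "(\<integral>x. obs_score N x \<partial>M.law N) = 0"
      using M.score_mean[OF e_meas C ratio correct_AE]
      by (subst M.integral_law) (auto simp: obs_score_Q)
  next
    show "Op_nn P (\<lambda>N \<omega>. ennreal (\<kappa> / a N)) (\<lambda>N. \<kappa> / a N * 1\<^sup>2)"
      by (rule CS.Op_nn_const[where \<kappa> = 1]) auto
  next
    show "0 \<le> \<kappa> / a N * 1\<^sup>2" for N using a_pos[of N] \<kappa> by simp
  qed (assumption | rule H_measurable borel_measurable_const)+
  then have "Op P \<psi>mean (\<lambda>N. sqrt (\<kappa> / a N * 1\<^sup>2 / real N))" unfolding \<psi>mean_eq[abs_def, symmetric] .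
  then show ?thesis
    by (rule CS.Op_rate_mono[where \<kappa> = "sqrt \<kappa>"]) (use sqrt_rate[of 1] \<kappa> in auto)
qed

text \<open>A separate branch with value 0 when both limits are correct: the rate claimed for
  \<Delta> is 0 at such \<open>N\<close>.\<close>

definition W_\<Delta> :: "nat \<Rightarrow> nat set \<Rightarrow> (nat \<Rightarrow> observation) \<Rightarrow> ennreal" where
  "W_\<Delta> N J z =
    (if e_correct N then
       if \<mu>_correct N then 0
       else ennreal C * (\<integral>\<^sup>+x. ennreal (\<bar>1 - e N x / pihat N J z x\<bar> * \<bar>\<mu> N x - m N x\<bar>) \<partial>PX N)
     else (\<integral>\<^sup>+x. ennreal (\<bar>1 - \<pi> N x / e N x\<bar> * \<bar>mhat N J z x - m N x\<bar>) \<partial>PX N))"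

lemma W_\<Delta>_measurable: "J \<subseteq> {1..N} \<Longrightarrow> W_\<Delta> N J \<in> borel_measurable (data_space N J)"
proof -
  assume J: "J \<subseteq> {1..N}"
  note [measurable] = mhat_pair[OF J] pihat_pair[OF J]
  have [measurable]:
    "(\<lambda>z. \<integral>\<^sup>+x. ennreal (\<bar>1 - e N x / pihat N J z x\<bar> * \<bar>\<mu> N x - m N x\<bar>) \<partial>PX N) \<in> borel_measurable (data_space N J)"
    "(\<lambda>z. \<integral>\<^sup>+x. ennreal (\<bar>1 - \<pi> N x / e N x\<bar> * \<bar>mhat N J z x - m N x\<bar>) \<partial>PX N) \<in> borel_measurable (data_space N J)"
    by (rule nn_integral_PX_measurable[OF J], measurable)+
  show ?thesis unfolding W_\<Delta>_def[abs_def] by measurable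
qed

lemma H_\<Delta>_first_moment:
  assumes J: "J \<subseteq> {1..N}" and z: "z \<in> space (data_space N J)"
  shows "(\<integral>\<^sup>+x. ennreal \<bar>H_\<Delta> N J z x\<bar> \<partial>M.law N) \<le> W_\<Delta> N J z"
proof -
  note t[measurable] = pihat_section[OF J z] mhat_section[OF J z]
  have H[measurable]: "H_\<Delta> N J z \<in> borel_measurable (observation_space (p N))"
    unfolding H_\<Delta>_def split_beta' by measurable
  have law: "(\<integral>\<^sup>+x. ennreal \<bar>H_\<Delta> N J z x\<bar> \<partial>M.law N)
      = (\<integral>\<^sup>+\<omega>. ennreal \<bar>H_\<Delta> N J z (R N \<omega>, R N \<omega> * Y N \<omega>, X N \<omega>)\<bar> \<partial>Q N)"
    by (subst M.nn_integral_law) auto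
  show ?thesis
  proof (cases "e_correct N")
    case e: True
    then have ae: "AE \<omega> in Q N. e N (X N \<omega>) = \<pi> N (X N \<omega>)"
      unfolding e_correct_def by (rule M.AE_PX_X)
    show ?thesis
    proof (cases "\<mu>_correct N")
      case True
      then have "AE \<omega> in Q N. \<mu> N (X N \<omega>) = m N (X N \<omega>)"
        unfolding \<mu>_correct_def by (rule M.AE_PX_X)
      then have "AE \<omega> in Q N. ennreal \<bar>H_\<Delta> N J z (R N \<omega>, R N \<omega> * Y N \<omega>, X N \<omega>)\<bar> = 0"
        by eventually_elim (simp add: H_\<Delta>_def e)
      then have "(\<integral>\<^sup>+\<omega>. ennreal \<bar>H_\<Delta> N J z (R N \<omega>, R N \<omega> * Y N \<omega>, X N \<omega>)\<bar> \<partial>Q N) = (\<integral>\<^sup>+\<omega>. 0 \<partial>Q N)"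
        by (rule nn_integral_cong_AE)
      then show ?thesis by (simp add: law)
    next
      case False
      have f: "(\<lambda>x. \<mu> N x - m N x) \<in> borel_measurable (covariate_space (p N))" by measurable
      have "(\<integral>\<^sup>+\<omega>. ennreal \<bar>H_\<Delta> N J z (R N \<omega>, R N \<omega> * Y N \<omega>, X N \<omega>)\<bar> \<partial>Q N)
          = (\<integral>\<^sup>+\<omega>. ennreal \<bar>(R N \<omega> / pihat N J z (X N \<omega>) - R N \<omega> / e N (X N \<omega>)) * (\<mu> N (X N \<omega>) - m N (X N \<omega>))\<bar> \<partial>Q N)"
      proof (rule nn_integral_cong_AE)
        show "AE \<omega> in Q N. ennreal \<bar>H_\<Delta> N J z (R N \<omega>, R N \<omega> * Y N \<omega>, X N \<omega>)\<bar>
          = ennreal \<bar>(R N \<omega> / pihat N J z (X N \<omega>) - R N \<omega> / e N (X N \<omega>)) * (\<mu> N (X N \<omega>) - m N (X N \<omega>))\<bar>"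
          using ae by eventually_elim (simp add: H_\<Delta>_def e abs_mult abs_minus_commute)
      qed
      also have "\<dots> \<le> W_\<Delta> N J z"
        using M.product_first_moment[OF e_meas C ratio t(1) f] e False by (simp add: W_\<Delta>_def)
      finally show ?thesis by (simp add: law)
    qed
  next
    case False
    have f: "(\<lambda>x. mhat N J z x - m N x) \<in> borel_measurable (covariate_space (p N))" by measurable
    show ?thesis
      unfolding law using M.misspecified_first_moment[OF e_meas C ratio f] False
      by (simp add: W_\<Delta>_def H_\<Delta>_def)
  qed
qed

text \<open>In each case a bounded misspecification error is paired with the vanishing estimation
  error of the other nuisance function: a wrong \<mu> leaves the rate \<open>re\<close> of the
  propensity, a wrong \<open>e\<close> the rate \<open>r\<mu>\<close> of the regression.\<close>

lemma Op_\<Delta>: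
  assumes C': "0 \<le> C'"
    and \<mu>_bound: "\<And>N. e_correct N \<Longrightarrow> (\<integral>\<^sup>+x. ennreal ((m N x - \<mu> N x)\<^sup>2) \<partial>PX N) \<le> ennreal (C'\<^sup>2)"
    and e_bound: "\<And>N. \<mu>_correct N \<Longrightarrow> (\<integral>\<^sup>+x. ennreal ((1 - \<pi> N x / e N x)\<^sup>2) \<partial>PX N) \<le> ennreal (C'\<^sup>2)"
  shows "Op P \<Delta> (\<lambda>N. re N * of_bool (\<not> \<mu>_correct N) + r\<mu> N * of_bool (\<not> e_correct N))"
    (is "Op P \<Delta> ?b")
proof -
  have b: "0 \<le> ?b N" for N using rates_nonneg by (simp add: add_nonneg_nonneg)
  \<comment> \<open>One expression for both cases. At most one limit is wrong at each
    \<open>N\<close>, so at most one indicator is 1.\<close>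
  define V where "V N J z = ennreal (of_bool (\<not> \<mu>_correct N)) * err_re N J z +
    ennreal (of_bool (\<not> e_correct N)) * err_r\<mu> N J z" for N J z
  have V_meas: "V N J \<in> borel_measurable (data_space N J)" if "J \<subseteq> {1..N}" for N J
    unfolding V_def[abs_def] using err_measurable[OF that] by measurable
  have "Op P (\<lambda>N. CS.CF.total_mean N (H_\<Delta> N)) (\<lambda>N. ?b N * 1)"
  proof (rule CS.Op_total_mean_L1[where W = W_\<Delta>])
    fix k assume k: "k \<in> {1..K}"
    have V_Op: "Op_nn P (at_fold V k) (\<lambda>N. (?b N)\<^sup>2)"
    proof -
      have "Op_nn P (at_fold V k) (\<lambda>N. of_bool (\<not> \<mu>_correct N) * (re N)\<^sup>2 + of_bool (\<not> e_correct N) * (r\<mu> N)\<^sup>2)"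
        unfolding V_def
        by (intro CS.Op_nn_add CS.Op_nn_scale err_Op_nn k)
           (auto intro!: at_fold_measurable[where W = "\<lambda>N J z. ennreal (of_bool (\<not> \<mu>_correct N)) * err_re N J z"]
              at_fold_measurable[where W = "\<lambda>N J z. ennreal (of_bool (\<not> e_correct N)) * err_r\<mu> N J z"]
              at_fold_measurable borel_measurable_times_ennreal err_measurable)
      moreover have "of_bool (\<not> \<mu>_correct N) * (re N)\<^sup>2 + of_bool (\<not> e_correct N) * (r\<mu> N)\<^sup>2 = (?b N)\<^sup>2" for N
        using correct[of N] by auto
      ultimately show ?thesis by simp
    qed
    \<comment> \<open>The bounded factor enters as an error of rate 1. The same constant serves both
      cases since \<open>C\<close> is at least 1, and adding 1 keeps it positive when
      \<open>C'\<close> is 0.\<close>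
    have const: "Op_nn P (\<lambda>N \<omega>. ennreal ((C * C')\<^sup>2)) (\<lambda>N. 1\<^sup>2)"
      by (rule CS.Op_nn_const[where \<kappa> = "(C * C')\<^sup>2 + 1"]) (auto intro!: ennreal_leI add_nonneg_pos)
    show "Op_nn P (at_fold W_\<Delta> k) (\<lambda>N. ?b N * 1)"
    proof (rule CS.Op_nn_Cauchy_Schwarz[OF V_Op const])
      fix N \<omega> assume \<omega>: "\<omega> \<in> space (P N)"
      let ?J = "CS.CF.training N k \<omega>" and ?z = "CS.CF.training_data N k \<omega>"
      have J: "?J \<subseteq> {1..N}" by (auto simp: training_indices_def)
      have z: "?z \<in> space (data_space N ?J)"
        using measurable_space[OF CS.CF.Z_measurable[of _ N] \<omega>] J
        by (auto simp: CS.CF.training_data_def space_PiM)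
      note [measurable] = pihat_section[OF J z] mhat_section[OF J z]
      note PXm = measurable_cong_sets[OF M.sets_PX refl]
      show "(at_fold W_\<Delta> k N \<omega>)\<^sup>2 \<le> at_fold V k N \<omega> * ennreal ((C * C')\<^sup>2)"
      proof (cases "e_correct N")
        case e: True
        show ?thesis
        proof (cases "\<mu>_correct N")
          case True
          then show ?thesis using e by (simp add: W_\<Delta>_def)
        next
          case False
          let ?I = "\<integral>\<^sup>+x. ennreal (\<bar>1 - e N x / pihat N ?J ?z x\<bar> * \<bar>\<mu> N x - m N x\<bar>) \<partial>PX N"
          have "?I\<^sup>2 \<le> err_re N ?J ?z * (\<integral>\<^sup>+x. ennreal ((\<mu> N x - m N x)\<^sup>2) \<partial>PX N)"
            unfolding err_re_def by (rule nn_integral_abs_product_square) (auto simp: PXm)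
          also have "\<dots> \<le> err_re N ?J ?z * ennreal (C'\<^sup>2)"
            using \<mu>_bound[OF e] by (intro mult_left_mono) (auto simp: power2_commute)
          finally have "ennreal C ^ 2 * ?I\<^sup>2 \<le> ennreal C ^ 2 * (err_re N ?J ?z * ennreal (C'\<^sup>2))"
            by (rule mult_left_mono) simp
          also have "\<dots> = err_re N ?J ?z * ennreal ((C * C')\<^sup>2)"
            using C C' by (simp add: power_mult_distrib ennreal_mult ennreal_power ac_simps)
          finally show ?thesis
            using e False by (simp add: W_\<Delta>_def V_def power_mult_distrib)
        qed
      next
        case False
        then have \<mu>: "\<mu>_correct N" using correct[of N] by simp
        let ?I = "\<integral>\<^sup>+x. ennreal (\<bar>1 - \<pi> N x / e N x\<bar> * \<bar>mhat N ?J ?z x - m N x\<bar>) \<partial>PX N"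
        have "?I\<^sup>2 \<le> (\<integral>\<^sup>+x. ennreal ((1 - \<pi> N x / e N x)\<^sup>2) \<partial>PX N) *
            (\<integral>\<^sup>+x. ennreal ((mhat N ?J ?z x - m N x)\<^sup>2) \<partial>PX N)"
          by (rule nn_integral_abs_product_square) (auto simp: PXm)
        also have "(\<integral>\<^sup>+x. ennreal ((mhat N ?J ?z x - m N x)\<^sup>2) \<partial>PX N) = err_r\<mu> N ?J ?z"
          unfolding err_r\<mu>_def using \<mu> unfolding \<mu>_correct_def
          by (intro nn_integral_cong_AE, eventually_elim) simp
        also have "(\<integral>\<^sup>+x. ennreal ((1 - \<pi> N x / e N x)\<^sup>2) \<partial>PX N) * err_r\<mu> N ?J ?z
            \<le> ennreal ((C * C')\<^sup>2) * err_r\<mu> N ?J ?z"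
        proof (intro mult_right_mono order_trans[OF e_bound[OF \<mu>]] ennreal_leI power_mono)
          show "C' \<le> C * C'" using mult_right_mono[OF C C'] by simp
        qed (use C' in auto)
        finally show ?thesis using False \<mu> by (simp add: W_\<Delta>_def V_def mult.commute)
      qed
    qed (use b in \<open>auto intro: at_fold_measurable V_meas\<close>)
  next
    show "0 \<le> ?b N * 1" for N using b[of N] by simp
  qed (assumption | rule H_measurable W_\<Delta>_measurable H_\<Delta>_first_moment)+
  then show ?thesis unfolding \<Delta>_eq[abs_def, symmetric] by simp
qed

lemma Op_error:
  assumes "0 \<le> C'"
    and "\<And>N. e_correct N \<Longrightarrow> (\<integral>\<^sup>+x. ennreal ((m N x - \<mu> N x)\<^sup>2) \<partial>PX N) \<le> ennreal (C'\<^sup>2)"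
    and "\<And>N. \<mu>_correct N \<Longrightarrow> (\<integral>\<^sup>+x. ennreal ((1 - \<pi> N x / e N x)\<^sup>2) \<partial>PX N) \<le> ennreal (C'\<^sup>2)"
  shows "Op P (\<lambda>N \<omega>. \<theta>hat N \<omega> - \<theta>0 N)
    (\<lambda>N. (1 + c\<mu> N + ce N) / root_Na N + r\<mu> N * re N +
       re N * of_bool (\<not> \<mu>_correct N) + r\<mu> N * of_bool (\<not> e_correct N))"
proof -
  have nn: "0 \<le> root_Na N" for N using a_pos[of N] by simp
  have "Op P (\<lambda>N \<omega>. (\<theta>hat N \<omega> - \<theta>0 N - \<psi>mean N \<omega> - \<Delta> N \<omega>) + \<psi>mean N \<omega> + \<Delta> N \<omega>)
    (\<lambda>N. (c\<mu> N / root_Na N + ce N / root_Na N + r\<mu> N * re N) + 1 / root_Na N +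
      (re N * of_bool (\<not> \<mu>_correct N) + r\<mu> N * of_bool (\<not> e_correct N)))"
    using rates_nonneg nn
    by (intro CS.Op_add Op_remainder Op_\<psi>mean Op_\<Delta>[OF assms])
       (auto intro!: add_nonneg_nonneg divide_nonneg_nonneg mult_nonneg_nonneg)
  moreover have "(c\<mu> N / root_Na N + ce N / root_Na N + r\<mu> N * re N) + 1 / root_Na N +
      (re N * of_bool (\<not> \<mu>_correct N) + r\<mu> N * of_bool (\<not> e_correct N))
    = (1 + c\<mu> N + ce N) / root_Na N + r\<mu> N * re N +
       re N * of_bool (\<not> \<mu>_correct N) + r\<mu> N * of_bool (\<not> e_correct N)" for N
    by (simp add: add_divide_distrib)
  ultimately show ?thesis by simp
qed

end

end

end

section \<open>Both limits correct: variance, linearization and normality\<close>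

context drss
begin

context
  fixes V :: "nat \<Rightarrow> real"
  assumes both: "\<And>N. \<mu>_correct N \<and> e_correct N"
    and V: "\<And>N. V N = prob_space.variance (Q N)
          (\<lambda>\<omega>. dr_score (\<mu> N) (e N) (\<theta>0 N) (R N \<omega>) (Y N \<omega>) (X N \<omega>))"
begin

lemma correct_AEs: "AE x in PX N. \<mu> N x = m N x" "AE x in PX N. e N x = \<pi> N x"
  using both[of N] by (auto simp: \<mu>_correct_def e_correct_def)

lemma ratio_1: "AE x in PX N. 0 < e N x \<and> \<pi> N x / e N x \<le> 1"
  using correct_AEs(2)[of N] M.\<pi>_pos[of N] by eventually_elim auto

lemma correct_either: "\<mu>_correct N \<or> e_correct N"
  using both by blast

text \<open>With e = \<pi> the ratio bound is \<open>C = 1\<close>, which turns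
  \<open>8 + 2 * C\<^sup>2\<close> into 10.\<close>

lemma V_bounds: "s1\<^sup>2 / a N \<le> V N" "V N \<le> s2\<^sup>2 * 10 / a N"
  using M.score_variance_lower[OF e_meas order_refl ratio_1 correct_AEs]
    M.score_variance_upper(2)[OF e_meas order_refl ratio_1 disjI1, OF correct_AEs(1), of N]
  by (simp_all add: V)

lemma V_pos: "0 < V N"
proof -
  have "0 < s1\<^sup>2 / a N" using s_pos a_pos[of N] by simp
  then show ?thesis using V_bounds(1)[of N] by linarith
qed

lemma same_order_V: "same_order V (\<lambda>N. 1 / a N)"
proof -
  \<comment> \<open>\<open>same_order\<close> asks for strict inequalities, so the lower constant is
    halved and the upper one enlarged by 1.\<close>
  have "s1\<^sup>2 / 2 * (1 / a N) < V N \<and> V N < (s2\<^sup>2 * 10 + 1) * (1 / a N)" for N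
  proof
    have "s1\<^sup>2 / 2 * (1 / a N) < s1\<^sup>2 / a N"
      using s_pos a_pos[of N] by (simp add: field_simps)
    then show "s1\<^sup>2 / 2 * (1 / a N) < V N" using V_bounds(1)[of N] by linarith
    show "V N < (s2\<^sup>2 * 10 + 1) * (1 / a N)"
      using V_bounds(2)[of N] a_pos[of N] by (simp add: field_simps)
  qed
  then have "\<forall>\<^sub>F N in sequentially.
      s1\<^sup>2 / 2 * (1 / a N) < V N \<and> V N < (s2\<^sup>2 * 10 + 1) * (1 / a N)"
    by (intro always_eventually) blast
  moreover have "0 < s1\<^sup>2 / 2" "0 < s2\<^sup>2 * 10 + 1" using s_pos by (auto intro: add_nonneg_pos)
  ultimately show ?thesis unfolding same_order_def by blast
qed

abbreviation "rate N \<equiv> c\<mu> N / root_Na N + ce N / root_Na N + r\<mu> N * re N"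

lemma \<Delta>_null:
  shows "AE \<omega> in P N. \<Delta> N \<omega> = 0"
  using AE_sample_X[OF correct_AEs(1)]
proof eventually_elim
  case (elim \<omega>)
  have "e_correct N" using both by blast
  then show ?case using elim by (simp add: \<Delta> e_correct_def[symmetric])
qed

lemma Op_linearization: "Op P (\<lambda>N \<omega>. \<theta>hat N \<omega> - \<theta>0 N - \<psi>mean N \<omega>) rate"
proof (rule CS.Op_AE_le[OF Op_remainder[OF order_refl ratio_1 correct_either]])
  show "\<forall>\<^sub>F N in sequentially. AE \<omega> in P N. \<bar>\<theta>hat N \<omega> - \<theta>0 N - \<psi>mean N \<omega>\<bar>
      \<le> \<bar>\<theta>hat N \<omega> - \<theta>0 N - \<psi>mean N \<omega> - \<Delta> N \<omega>\<bar>"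
  proof (rule always_eventually, rule allI)
    fix N show "AE \<omega> in P N. \<bar>\<theta>hat N \<omega> - \<theta>0 N - \<psi>mean N \<omega>\<bar>
      \<le> \<bar>\<theta>hat N \<omega> - \<theta>0 N - \<psi>mean N \<omega> - \<Delta> N \<omega>\<bar>"
      using \<Delta>_null[of N] by eventually_elim simp
  qed
qed simp

context
  assumes c0: "c\<mu> \<longlonglongrightarrow> 0" "ce \<longlonglongrightarrow> 0"
    and r0: "(\<lambda>N. root_Na N * (r\<mu> N * re N)) \<longlonglongrightarrow> 0"
begin

lemma scaled_rate_tendsto: "(\<lambda>N. root_Na N * rate N) \<longlonglongrightarrow> 0"
proof (rule Lim_transform_eventually)
  show "(\<lambda>N. c\<mu> N + ce N + root_Na N * (r\<mu> N * re N)) \<longlonglongrightarrow> 0"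
    using tendsto_add[OF tendsto_add[OF c0] r0] by simp
  \<comment> \<open>The identity cancels \<open>root_Na N\<close>, which is 0 at
    \<open>N = 0\<close>; hence only eventually.\<close>
  show "\<forall>\<^sub>F N in sequentially. c\<mu> N + ce N + root_Na N * (r\<mu> N * re N) = root_Na N * rate N"
    using eventually_gt_at_top[of 0]
  proof eventually_elim
    case (elim N)
    then have "root_Na N \<noteq> 0" using a_pos[of N] by simp
    then show ?case by (simp add: distrib_left)
  qed
qed

lemma Op_root_Na: "Op P (\<lambda>N \<omega>. root_Na N * (\<theta>hat N \<omega> - \<theta>0 N)) (\<lambda>_. 1)"
proof -
  have nn: "0 \<le> root_Na N" for N using a_pos[of N] by simp
  have rate_nn: "0 \<le> rate N" for N
    using rates_nonneg nn by (intro add_nonneg_nonneg divide_nonneg_nonneg mult_nonneg_nonneg)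
  have "Op P (\<lambda>N \<omega>. (\<theta>hat N \<omega> - \<theta>0 N - \<psi>mean N \<omega>) + \<psi>mean N \<omega>) (\<lambda>N. rate N + 1 / root_Na N)"
    using nn by (intro CS.Op_add Op_linearization Op_\<psi>mean[OF order_refl ratio_1 correct_either] rate_nn) auto
  then have "Op P (\<lambda>N \<omega>. \<theta>hat N \<omega> - \<theta>0 N) (\<lambda>N. rate N + 1 / root_Na N)" by simp
  then have "Op P (\<lambda>N \<omega>. root_Na N * (\<theta>hat N \<omega> - \<theta>0 N)) (\<lambda>N. root_Na N * (rate N + 1 / root_Na N))"
    by (rule CS.Op_scale) (use nn in auto)
  then show ?thesis
  proof (rule CS.Op_rate_mono[where \<kappa> = 2])
    have "\<forall>\<^sub>F N in sequentially. root_Na N * rate N < 1"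
      using scaled_rate_tendsto by (rule order_tendstoD) simp
    then show "\<forall>\<^sub>F N in sequentially. root_Na N * (rate N + 1 / root_Na N) \<le> 2 * 1"
    proof eventually_elim
      case (elim N)
      \<comment> \<open>An inequality, so that it also covers a vanishing \<open>root_Na N\<close>,
        where the product is 0.\<close>
      have "root_Na N * (1 / root_Na N) \<le> 1" by simp
      then show ?case using elim by (simp only: distrib_left)
    qed
  qed auto
qed

abbreviation "\<nu> N \<equiv> distr (M.law N) borel (obs_score N)"

lemma law_measurable: "f \<in> observation_space (p N) \<rightarrow>\<^sub>M M' \<Longrightarrow> f \<in> M.law N \<rightarrow>\<^sub>M M'"
  using measurable_cong_sets[OF M.sets_law refl] by blast

lemma integral_\<nu>:
  fixes f :: "real \<Rightarrow> real"
  assumes [measurable]: "f \<in> borel_measurable borel"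
  shows "(\<integral>x. f x \<partial>\<nu> N) = (\<integral>\<omega>. f (dr_score (\<mu> N) (e N) (\<theta>0 N) (R N \<omega>) (Y N \<omega>) (X N \<omega>)) \<partial>Q N)"
proof -
  have "(\<integral>x. f x \<partial>\<nu> N) = (\<integral>z. f (obs_score N z) \<partial>M.law N)"
    by (rule integral_distr) (auto intro: law_measurable)
  also have "\<dots> = (\<integral>\<omega>. f (obs_score N (R N \<omega>, R N \<omega> * Y N \<omega>, X N \<omega>)) \<partial>Q N)"
    by (rule M.integral_law) simp
  finally show ?thesis by (simp only: obs_score_Q)
qed

lemma integrable_\<nu>_sq: "integrable (\<nu> N) (\<lambda>x. x\<^sup>2)"
proof -
  have "integrable (M.law N) (\<lambda>z. (obs_score N z)\<^sup>2)"
    unfolding M.law_def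
    by (subst integrable_distr_eq) (use M.score_sq[OF e_meas order_refl ratio_1, of N] in \<open>auto simp: obs_score_Q\<close>)
  then show ?thesis
    by (subst integrable_distr_eq) (auto intro: law_measurable)
qed

lemma char_\<psi>mean_tendsto:
  assumes tail: "\<And>c. c > 0 \<Longrightarrow> (\<lambda>N. (1 / a N) *
             (\<integral>\<omega>. (dr_score (\<mu> N) (\<pi> N) (\<theta>0 N) (R N \<omega>) (Y N \<omega>) (X N \<omega>))\<^sup>2 *
                of_bool (\<bar>dr_score (\<mu> N) (\<pi> N) (\<theta>0 N) (R N \<omega>) (Y N \<omega>) (X N \<omega>)\<bar>
                           > c * sqrt (real N / a N)) \<partial>Q N)) \<longlonglongrightarrow> 0"
  shows "(\<lambda>N. char (distr (P N) borel (\<lambda>\<omega>. sqrt (real N) / sqrt (V N) * \<psi>mean N \<omega>)) t)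
    \<longlonglongrightarrow> char std_normal_distribution t"
proof -
  have norm: "sqrt (real N) / sqrt (V N) * \<psi>mean N \<omega>
      = (\<Sum>i=1..N. obs_score N (Zs N i \<omega>)) / sqrt (real N * V N)" for N \<omega>
  proof -
    have "sqrt (real N) / sqrt (V N) * \<psi>mean N \<omega>
        = (sqrt (real N) / real N) * (\<Sum>i=1..N. obs_score N (Zs N i \<omega>)) / sqrt (V N)"
      by (simp add: \<psi>mean_eq CS.CF.total_mean_def)
    also have "sqrt (real N) / real N = inverse (sqrt (real N))"
      by (rule sqrt_divide_self_eq) simp
    finally show ?thesis by (simp add: real_sqrt_mult divide_inverse ac_simps)
  qed
  have "(\<lambda>N. char (distr (P N) borel (\<lambda>\<omega>. (\<Sum>i=1..N. obs_score N (Zs N i \<omega>)) / sqrt (real N * V N))) t)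
    \<longlonglongrightarrow> char std_normal_distribution t"
  proof (rule char_row_iid_tendsto[where \<nu> = \<nu>])
    fix N
    show "prob_space (P N)" by (rule prob_P)
    show "prob_space.indep_vars (P N) (\<lambda>_. borel) (\<lambda>i \<omega>. obs_score N (Zs N i \<omega>)) {1..N}"
      by (rule CS.CF.indep_vars_compose2[where M' = "\<lambda>_. observation_space (p N)"])
         (use CS.CF.iid[of N] in \<open>auto simp: iid_sample_def\<close>)
    show "distr (P N) borel (\<lambda>\<omega>. obs_score N (Zs N i \<omega>)) = \<nu> N" if i: "i \<in> {1..N}" for i
    proof -
      have "M.law N = distr (P N) (observation_space (p N)) (Zs N i)"
        using CS.CF.iid[of N] i by (simp add: iid_sample_def)
      then show ?thesis
        using CS.CF.Z_measurable[OF i] by (simp only:) (subst distr_distr, auto simp: comp_def)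
    qed
    show "real_distribution (\<nu> N)"
      by (rule prob_space.real_distribution_distr[OF M.prob_law]) (auto intro: law_measurable)
    show "integrable (\<nu> N) (\<lambda>x. x\<^sup>2)" by (rule integrable_\<nu>_sq)
    show "(\<integral>x. x \<partial>\<nu> N) = 0"
      using M.score_mean[OF e_meas order_refl ratio_1 disjI1, OF correct_AEs(1), of N]
      by (subst integral_\<nu>) auto
    show "V N = (\<integral>x. x\<^sup>2 \<partial>\<nu> N)"
      using M.score_variance_upper(1)[OF e_meas order_refl ratio_1 disjI1, OF correct_AEs(1), of N]
      by (subst integral_\<nu>) (auto simp: V)
  next
    show "\<forall>\<^sub>F N in sequentially. 0 < V N" by (simp add: V_pos)
  next
    fix c :: real assume c: "c > 0"
    \<comment> \<open>The tail condition is taken at the constant \<open>c * s1\<close>: the lower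
      bound \<open>s1\<^sup>2 / a\<close> on the variance puts Lindeberg's truncation level above
      this one, so Lindeberg's integral is over a smaller set.\<close>
    let ?tail = "\<lambda>N. (1 / a N) *
             (\<integral>\<omega>. (dr_score (\<mu> N) (\<pi> N) (\<theta>0 N) (R N \<omega>) (Y N \<omega>) (X N \<omega>))\<^sup>2 *
                of_bool (\<bar>dr_score (\<mu> N) (\<pi> N) (\<theta>0 N) (R N \<omega>) (Y N \<omega>) (X N \<omega>)\<bar>
                           > c * s1 * sqrt (real N / a N)) \<partial>Q N)"
    let ?lind = "\<lambda>N. (1 / V N) * (\<integral>x. x\<^sup>2 * of_bool (\<bar>x\<bar> > c * sqrt (real N * V N)) \<partial>\<nu> N)"
    show "?lind \<longlonglongrightarrow> 0"
    proof (rule tendsto_sandwich[where f = "\<lambda>_. 0" and h = "\<lambda>N. (1 / s1\<^sup>2) * ?tail N"])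
      show "\<forall>\<^sub>F N in sequentially. 0 \<le> ?lind N"
        using V_pos by (intro always_eventually allI mult_nonneg_nonneg Bochner_Integration.integral_nonneg)
          (auto simp: less_imp_le)
      show "(\<lambda>N. (1 / s1\<^sup>2) * ?tail N) \<longlonglongrightarrow> 0"
        using tail[of "c * s1"] c s_pos by (intro tendsto_mult_right_zero) auto
      show "\<forall>\<^sub>F N in sequentially. ?lind N \<le> (1 / s1\<^sup>2) * ?tail N"
      proof (intro always_eventually allI)
        fix N
        let ?s = "\<lambda>\<omega>. dr_score (\<mu> N) (e N) (\<theta>0 N) (R N \<omega>) (Y N \<omega>) (X N \<omega>)"
        let ?s' = "\<lambda>\<omega>. dr_score (\<mu> N) (\<pi> N) (\<theta>0 N) (R N \<omega>) (Y N \<omega>) (X N \<omega>)"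
        have eq: "AE \<omega> in Q N. ?s \<omega> = ?s' \<omega>"
          using M.AE_PX_X[OF correct_AEs(2)] by eventually_elim (simp add: dr_score_def)
        have [measurable]: "?s \<in> borel_measurable (Q N)" "?s' \<in> borel_measurable (Q N)"
          unfolding dr_score_def by measurable
        have sq: "integrable (Q N) (\<lambda>\<omega>. (?s \<omega>)\<^sup>2)"
          by (rule M.score_sq[OF e_meas order_refl ratio_1])
        then have sq': "integrable (Q N) (\<lambda>\<omega>. (?s' \<omega>)\<^sup>2)"
          by (rule integrable_cong_AE_imp) (use eq in auto)
        have root: "s1 * sqrt (real N / a N) \<le> sqrt (real N * V N)"
        proof -
          have "s1 * sqrt (real N / a N) = sqrt (real N * (s1\<^sup>2 / a N))"
            using s_pos by (simp add: real_sqrt_mult real_sqrt_divide)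
          also have "\<dots> \<le> sqrt (real N * V N)"
            using V_bounds(1)[of N] by (intro real_sqrt_le_mono mult_left_mono) auto
          finally show ?thesis .
        qed
        then have croot: "c * s1 * sqrt (real N / a N) \<le> c * sqrt (real N * V N)"
          using c by (simp add: mult.assoc)
        have "(\<integral>x. x\<^sup>2 * of_bool (\<bar>x\<bar> > c * sqrt (real N * V N)) \<partial>\<nu> N)
            = (\<integral>\<omega>. (?s \<omega>)\<^sup>2 * of_bool (\<bar>?s \<omega>\<bar> > c * sqrt (real N * V N)) \<partial>Q N)"
          by (rule integral_\<nu>) simp
        also have "\<dots> \<le> (\<integral>\<omega>. (?s' \<omega>)\<^sup>2 * of_bool (\<bar>?s' \<omega>\<bar> > c * s1 * sqrt (real N / a N)) \<partial>Q N)"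
        proof (rule integral_mono_AE)
          show "integrable (Q N) (\<lambda>\<omega>. (?s \<omega>)\<^sup>2 * of_bool (\<bar>?s \<omega>\<bar> > c * sqrt (real N * V N)))"
            by (rule Bochner_Integration.integrable_bound[OF sq]) auto
          show "integrable (Q N) (\<lambda>\<omega>. (?s' \<omega>)\<^sup>2 * of_bool (\<bar>?s' \<omega>\<bar> > c * s1 * sqrt (real N / a N)))"
            by (rule Bochner_Integration.integrable_bound[OF sq']) auto
          show "AE \<omega> in Q N. (?s \<omega>)\<^sup>2 * of_bool (\<bar>?s \<omega>\<bar> > c * sqrt (real N * V N))
              \<le> (?s' \<omega>)\<^sup>2 * of_bool (\<bar>?s' \<omega>\<bar> > c * s1 * sqrt (real N / a N))"
            using eq
          proof eventually_elim
            case (elim \<omega>)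
            then show ?case using croot by (cases "\<bar>?s' \<omega>\<bar> > c * sqrt (real N * V N)") auto
          qed
        qed
        finally have int_le: "(\<integral>x. x\<^sup>2 * of_bool (\<bar>x\<bar> > c * sqrt (real N * V N)) \<partial>\<nu> N)
          \<le> (\<integral>\<omega>. (?s' \<omega>)\<^sup>2 * of_bool (\<bar>?s' \<omega>\<bar> > c * s1 * sqrt (real N / a N)) \<partial>Q N)" .
        \<comment> \<open>The Lindeberg quotient carries 1 / V and the tail condition 1 / a. The
          variance bound gives a multiple of \<open>a\<close>, and \<open>a \<le> 1\<close> yields
          \<open>a \<le> 1 / a\<close>.\<close>
        have "1 / V N \<le> a N / s1\<^sup>2"
          using V_bounds(1)[of N] V_pos[of N] a_pos[of N] s_pos by (simp add: field_simps)
        also have "\<dots> \<le> 1 / s1\<^sup>2 * (1 / a N)"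
        proof -
          have "a N * a N \<le> 1 * 1" using M.a_inverse(2,3)[of N] by (intro mult_mono) auto
          then show ?thesis using a_pos[of N] s_pos by (simp add: field_simps)
        qed
        finally have "1 / V N \<le> 1 / s1\<^sup>2 * (1 / a N)" .
        then have "?lind N \<le> (1 / s1\<^sup>2 * (1 / a N)) *
            (\<integral>\<omega>. (?s' \<omega>)\<^sup>2 * of_bool (\<bar>?s' \<omega>\<bar> > c * s1 * sqrt (real N / a N)) \<partial>Q N)"
          using a_pos[of N]
          by (intro mult_mono int_le) (auto intro!: Bochner_Integration.integral_nonneg simp: less_imp_le)
        then show "?lind N \<le> (1 / s1\<^sup>2) * ?tail N" by (simp only: mult.assoc)
      qed
    qed simp
  qed
  then show ?thesis by (simp only: norm)
qed

lemma asymptotic_normality: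
  assumes tail: "\<And>c. c > 0 \<Longrightarrow> (\<lambda>N. (1 / a N) *
             (\<integral>\<omega>. (dr_score (\<mu> N) (\<pi> N) (\<theta>0 N) (R N \<omega>) (Y N \<omega>) (X N \<omega>))\<^sup>2 *
                of_bool (\<bar>dr_score (\<mu> N) (\<pi> N) (\<theta>0 N) (R N \<omega>) (Y N \<omega>) (X N \<omega>)\<bar>
                           > c * sqrt (real N / a N)) \<partial>Q N)) \<longlonglongrightarrow> 0"
  shows "weak_conv_m
           (\<lambda>N. distr (P N) borel (\<lambda>\<omega>. sqrt (real N) / sqrt (V N) * (\<theta>hat N \<omega> - \<theta>0 N)))
           std_normal_distribution"
proof (rule weak_conv_m_perturb[where V = "\<lambda>N \<omega>. sqrt (real N) / sqrt (V N) * \<psi>mean N \<omega>"])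
  fix \<delta> :: real assume \<delta>: "\<delta> > 0"
  let ?s = "\<lambda>N. sqrt (real N) / sqrt (V N)"
  have s: "0 \<le> ?s N" for N using V_pos[of N] by simp
  have rate_nn: "0 \<le> rate N" for N
    using rates_nonneg a_pos[of N] by (intro add_nonneg_nonneg divide_nonneg_nonneg mult_nonneg_nonneg) auto
  \<comment> \<open>The lower variance bound dominates the standardizing factor by a multiple of
    \<open>root_Na N\<close>, at which scale the remainder is already known to vanish.\<close>
  have s_le: "?s N \<le> (1 / s1) * root_Na N" for N
  proof -
    have "1 / V N \<le> a N / s1\<^sup>2"
      using V_bounds(1)[of N] V_pos[of N] a_pos[of N] s_pos by (simp add: field_simps)
    then have "sqrt (real N * (1 / V N)) \<le> sqrt (real N * (a N / s1\<^sup>2))"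
      by (intro real_sqrt_le_mono mult_left_mono) auto
    then show ?thesis using s_pos by (simp add: real_sqrt_mult real_sqrt_divide)
  qed
  have "(\<lambda>N. ?s N * rate N) \<longlonglongrightarrow> 0"
  proof (rule tendsto_sandwich[where f = "\<lambda>_. 0" and h = "\<lambda>N. (1 / s1) * (root_Na N * rate N)"])
    show "(\<lambda>N. (1 / s1) * (root_Na N * rate N)) \<longlonglongrightarrow> 0"
      using scaled_rate_tendsto by (rule tendsto_mult_right_zero)
    show "\<forall>\<^sub>F N in sequentially. 0 \<le> ?s N * rate N"
      by (intro always_eventually allI mult_nonneg_nonneg s rate_nn)
    show "\<forall>\<^sub>F N in sequentially. ?s N * rate N \<le> (1 / s1) * (root_Na N * rate N)"
    proof (intro always_eventually allI)
      fix N show "?s N * rate N \<le> (1 / s1) * (root_Na N * rate N)"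
        using mult_right_mono[OF s_le rate_nn, of N N] by (simp only: mult.assoc)
    qed
  qed simp
  then have "(\<lambda>N. \<P>(\<omega> in P N. \<bar>?s N * (\<theta>hat N \<omega> - \<theta>0 N - \<psi>mean N \<omega>)\<bar> > \<delta>)) \<longlonglongrightarrow> 0"
    by (intro CS.Op_null_rate_tendsto[OF CS.Op_scale[OF Op_linearization s]] \<delta>) auto
  then show "(\<lambda>N. \<P>(\<omega> in P N. \<bar>?s N * (\<theta>hat N \<omega> - \<theta>0 N) - ?s N * \<psi>mean N \<omega>\<bar> > \<delta>)) \<longlonglongrightarrow> 0"
    by (simp only: right_diff_distrib)
qed (use char_\<psi>mean_tendsto[OF tail] in \<open>auto intro: prob_P real_dist_normal_dist\<close>)

end

end

end

theorem theorem3p2: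
  fixes Q :: "nat \<Rightarrow> 'q measure" and P :: "nat \<Rightarrow> 'w measure"
    and p :: "nat \<Rightarrow> nat"
    and R Y :: "nat \<Rightarrow> 'q \<Rightarrow> real" and X :: "nat \<Rightarrow> 'q \<Rightarrow> covariate"
    and Rs Ys :: "nat \<Rightarrow> nat \<Rightarrow> 'w \<Rightarrow> real" and Xs :: "nat \<Rightarrow> nat \<Rightarrow> 'w \<Rightarrow> covariate"
    and Zs :: "nat \<Rightarrow> nat \<Rightarrow> 'w \<Rightarrow> observation"
    and PX :: "nat \<Rightarrow> covariate measure"
    and m \<pi> \<mu> e :: "nat \<Rightarrow> covariate \<Rightarrow> real"
    and \<theta>0 a :: "nat \<Rightarrow> real"
    and K :: nat and g :: "nat \<Rightarrow> nat \<Rightarrow> 'w \<Rightarrow> nat"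
    and mhat pihat :: "nat \<Rightarrow> estimator"
    and mfit pifit :: "nat \<Rightarrow> nat \<Rightarrow> 'w \<Rightarrow> covariate \<Rightarrow> real"
    and s1 s2 :: real
    and c\<mu> ce r\<mu> re :: "nat \<Rightarrow> real"
    and \<theta>hat \<psi>mean \<Delta> :: "nat \<Rightarrow> 'w \<Rightarrow> real" and V :: "nat \<Rightarrow> real"
  assumes prob_Q: "\<And>N. prob_space (Q N)"
    and R_rv: "\<And>N. R N \<in> borel_measurable (Q N)"
    and R_01: "\<And>N \<omega>. \<omega> \<in> space (Q N) \<Longrightarrow> R N \<omega> \<in> {0, 1}"
    and Y_rv: "\<And>N. Y N \<in> borel_measurable (Q N)"
    and X_rv: "\<And>N. X N \<in> Q N \<rightarrow>\<^sub>M covariate_space (p N)"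
    and PX: "\<And>N. PX N = distr (Q N) (covariate_space (p N)) (X N)"
    and \<theta>0: "\<And>N. \<theta>0 N = (\<integral>\<omega>. Y N \<omega> \<partial>Q N)"
    and m: "\<And>N. cond_exp_version (Q N) (covariate_space (p N)) (X N) (Y N) (m N)"
    and \<pi>: "\<And>N. cond_exp_version (Q N) (covariate_space (p N)) (X N)
                    (\<lambda>\<omega>. indicator {1} (R N \<omega>)) (\<pi> N)"
    and \<pi>_inv: "\<And>N. (\<integral>\<^sup>+x. 1 / ennreal (\<pi> N x) \<partial>PX N) < \<infinity>"
    and a: "\<And>N. a N = 1 / (\<integral>x. 1 / \<pi> N x \<partial>PX N)"
    and \<mu>_meas: "\<And>N. \<mu> N \<in> borel_measurable (covariate_space (p N))"
    and e_meas: "\<And>N. e N \<in> borel_measurable (covariate_space (p N))"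
    and prob_P: "\<And>N. prob_space (P N)"
    and Zs: "\<And>N i \<omega>. Zs N i \<omega> = (Rs N i \<omega>, Rs N i \<omega> * Ys N i \<omega>, Xs N i \<omega>)"
    and iid: "\<And>N. iid_sample (P N) N (observation_space (p N)) (Zs N)
                (distr (Q N) (observation_space (p N)) (\<lambda>\<omega>. (R N \<omega>, R N \<omega> * Y N \<omega>, X N \<omega>)))"
    and K: "K \<ge> 2"
    and folds: "\<And>N. independent_folds (P N) N K (observation_space (p N)) (Zs N) (g N)"
    and mhat_meas: "\<And>N. measurable_estimator N (p N) (mhat N)"
    and pihat_meas: "\<And>N. measurable_estimator N (p N) (pihat N)"
    and mfit: "\<And>N. mfit N = fold_fit N (g N) (Zs N) (mhat N)"
    and pifit: "\<And>N. pifit N = fold_fit N (g N) (Zs N) (pihat N)"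
    and ignorability: "\<And>N. cond_indep_given (Q N) (covariate_space (p N)) (X N) (R N) (Y N)"
    and s_pos: "s1 > 0" "s2 > 0"
    and basic: "\<And>N. basic_assumption (Q N) (p N) (R N) (Y N) (X N) (m N) (\<mu> N) s1 s2"
    and Na: "filterlim (\<lambda>N. real N * a N) at_top sequentially"
    and rates_nonneg: "\<And>N. 0 \<le> c\<mu> N" "\<And>N. 0 \<le> ce N" "\<And>N. 0 \<le> r\<mu> N" "\<And>N. 0 \<le> re N"
    and rates_o1: "c\<mu> \<longlonglongrightarrow> 0" "ce \<longlonglongrightarrow> 0" "r\<mu> \<longlonglongrightarrow> 0" "re \<longlonglongrightarrow> 0"
    and rate_c\<mu>: "\<And>k. k \<in> {1..K} \<Longrightarrow>
          Op_nn P (\<lambda>N \<omega>. \<integral>\<^sup>+x. ennreal (a N / \<pi> N x * (mfit N k \<omega> x - \<mu> N x)\<^sup>2) \<partial>PX N)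
            (\<lambda>N. (c\<mu> N)\<^sup>2)"
    and rate_ce: "\<And>k. k \<in> {1..K} \<Longrightarrow>
          Op_nn P (\<lambda>N \<omega>. \<integral>\<^sup>+x. ennreal (a N / \<pi> N x * (1 - e N x / pifit N k \<omega> x)\<^sup>2) \<partial>PX N)
            (\<lambda>N. (ce N)\<^sup>2)"
    and rate_r\<mu>: "\<And>k. k \<in> {1..K} \<Longrightarrow>
          Op_nn P (\<lambda>N \<omega>. \<integral>\<^sup>+x. ennreal ((mfit N k \<omega> x - \<mu> N x)\<^sup>2) \<partial>PX N) (\<lambda>N. (r\<mu> N)\<^sup>2)"
    and rate_re: "\<And>k. k \<in> {1..K} \<Longrightarrow>
          Op_nn P (\<lambda>N \<omega>. \<integral>\<^sup>+x. ennreal ((1 - e N x / pifit N k \<omega> x)\<^sup>2) \<partial>PX N)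
            (\<lambda>N. (re N)\<^sup>2)"
  \<comment> \<open>\<open>\<Delta>\<close>: if both nuisance limits are correct at \<open>N\<close>, both formulas vanish almost surely\<close>
    and \<theta>hat: "\<And>N \<omega>. \<theta>hat N \<omega> =
          (1 / real N) * (\<Sum>i=1..N. mfit N (g N i \<omega>) \<omega> (Xs N i \<omega>)) +
          (1 / real N) * (\<Sum>i=1..N. Rs N i \<omega> / pifit N (g N i \<omega>) \<omega> (Xs N i \<omega>) *
             (Ys N i \<omega> - mfit N (g N i \<omega>) \<omega> (Xs N i \<omega>)))"
    and \<psi>mean: "\<And>N \<omega>. \<psi>mean N \<omega> = (1 / real N) *
          (\<Sum>i=1..N. dr_score (\<mu> N) (e N) (\<theta>0 N) (Rs N i \<omega>) (Ys N i \<omega>) (Xs N i \<omega>))"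
    and V: "\<And>N. V N = prob_space.variance (Q N)
          (\<lambda>\<omega>. dr_score (\<mu> N) (e N) (\<theta>0 N) (R N \<omega>) (Y N \<omega>) (X N \<omega>))"
    and \<Delta>: "\<And>N \<omega>. \<Delta> N \<omega> =
          (if AE x in PX N. e N x = \<pi> N x then
             (1 / real N) * (\<Sum>i=1..N.
               (Rs N i \<omega> / \<pi> N (Xs N i \<omega>) - Rs N i \<omega> / pifit N (g N i \<omega>) \<omega> (Xs N i \<omega>)) *
               (\<mu> N (Xs N i \<omega>) - m N (Xs N i \<omega>)))
           else
             (1 / real N) * (\<Sum>i=1..N.
               (Rs N i \<omega> / \<pi> N (Xs N i \<omega>) - Rs N i \<omega> / e N (Xs N i \<omega>)) *
               (mfit N (g N i \<omega>) \<omega> (Xs N i \<omega>) - m N (Xs N i \<omega>))))"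
  shows
    "((\<forall>N. (AE x in PX N. \<mu> N x = m N x) \<and> (AE x in PX N. e N x = \<pi> N x)) \<longrightarrow>
        Op P (\<lambda>N \<omega>. \<theta>hat N \<omega> - \<theta>0 N - \<psi>mean N \<omega>)
          (\<lambda>N. c\<mu> N / sqrt (real N * a N) + ce N / sqrt (real N * a N) + r\<mu> N * re N) \<and>
        same_order V (\<lambda>N. 1 / a N) \<and>
        ((\<lambda>N. r\<mu> N * re N) \<in> o(\<lambda>N. 1 / sqrt (real N * a N)) \<and>
         (\<forall>c>0. (\<lambda>N. (1 / a N) *
             (\<integral>\<omega>. (dr_score (\<mu> N) (\<pi> N) (\<theta>0 N) (R N \<omega>) (Y N \<omega>) (X N \<omega>))\<^sup>2 *
                of_bool (\<bar>dr_score (\<mu> N) (\<pi> N) (\<theta>0 N) (R N \<omega>) (Y N \<omega>) (X N \<omega>)\<bar>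
                           > c * sqrt (real N / a N)) \<partial>Q N)) \<longlonglongrightarrow> 0) \<longrightarrow>
         Op P (\<lambda>N \<omega>. sqrt (real N * a N) * (\<theta>hat N \<omega> - \<theta>0 N)) (\<lambda>_. 1) \<and>
         weak_conv_m
           (\<lambda>N. distr (P N) borel (\<lambda>\<omega>. sqrt (real N) / sqrt (V N) * (\<theta>hat N \<omega> - \<theta>0 N)))
           std_normal_distribution))
     \<and>
     ((\<forall>N. (AE x in PX N. \<mu> N x = m N x) \<or> (AE x in PX N. e N x = \<pi> N x)) \<and>
      (\<exists>c>0. \<exists>C>0. \<forall>N. \<not> (AE x in PX N. e N x = \<pi> N x) \<longrightarrow>
          (AE x in PX N. c \<le> \<pi> N x / e N x \<and> \<pi> N x / e N x \<le> C)) \<longrightarrow>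
        Op P (\<lambda>N \<omega>. \<theta>hat N \<omega> - \<theta>0 N - \<psi>mean N \<omega> - \<Delta> N \<omega>)
          (\<lambda>N. c\<mu> N / sqrt (real N * a N) + ce N / sqrt (real N * a N) + r\<mu> N * re N) \<and>
        ((\<exists>C::real. \<forall>N.
            ((AE x in PX N. e N x = \<pi> N x) \<longrightarrow>
               Lr_norm 2 (PX N) (\<lambda>x. m N x - \<mu> N x) < ennreal C) \<and>
            ((AE x in PX N. \<mu> N x = m N x) \<longrightarrow>
               Lr_norm 2 (PX N) (\<lambda>x. 1 - \<pi> N x / e N x) < ennreal C)) \<longrightarrow>
         Op P (\<lambda>N \<omega>. \<theta>hat N \<omega> - \<theta>0 N)
           (\<lambda>N. (1 + c\<mu> N + ce N) / sqrt (real N * a N) + r\<mu> N * re N +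
                re N * of_bool (\<not> (AE x in PX N. \<mu> N x = m N x)) +
                r\<mu> N * of_bool (\<not> (AE x in PX N. e N x = \<pi> N x)))))"
proof -
  interpret D: drss Q P p R Y X Rs Ys Xs Zs PX m \<pi> \<mu> e \<theta>0 a K g mhat pihat mfit pifit s1 s2
      c\<mu> ce r\<mu> re \<theta>hat \<psi>mean \<Delta>
    by (rule drss.intro) (fact assms)+
  show ?thesis
  proof (intro conjI impI)
    assume "\<forall>N. (AE x in PX N. \<mu> N x = m N x) \<and> (AE x in PX N. e N x = \<pi> N x)"
    then have both: "D.\<mu>_correct N \<and> D.e_correct N" for N
      by (simp add: D.\<mu>_correct_def D.e_correct_def)
    show "Op P (\<lambda>N \<omega>. \<theta>hat N \<omega> - \<theta>0 N - \<psi>mean N \<omega>)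
          (\<lambda>N. c\<mu> N / sqrt (real N * a N) + ce N / sqrt (real N * a N) + r\<mu> N * re N)"
      by (rule D.Op_linearization[OF both V])
    show "same_order V (\<lambda>N. 1 / a N)"
      by (rule D.same_order_V[OF both V])
    assume asm: "(\<lambda>N. r\<mu> N * re N) \<in> o(\<lambda>N. 1 / sqrt (real N * a N)) \<and>
         (\<forall>c>0. (\<lambda>N. (1 / a N) *
             (\<integral>\<omega>. (dr_score (\<mu> N) (\<pi> N) (\<theta>0 N) (R N \<omega>) (Y N \<omega>) (X N \<omega>))\<^sup>2 *
                of_bool (\<bar>dr_score (\<mu> N) (\<pi> N) (\<theta>0 N) (R N \<omega>) (Y N \<omega>) (X N \<omega>)\<bar>
                           > c * sqrt (real N / a N)) \<partial>Q N)) \<longlonglongrightarrow> 0)"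
    have r0: "(\<lambda>N. sqrt (real N * a N) * (r\<mu> N * re N)) \<longlonglongrightarrow> 0"
      using smalloD_tendsto[OF conjunct1[OF asm]] by (simp add: mult.commute)
    show "Op P (\<lambda>N \<omega>. sqrt (real N * a N) * (\<theta>hat N \<omega> - \<theta>0 N)) (\<lambda>_. 1)"
      by (rule D.Op_root_Na[OF both V rates_o1(1,2) r0])
    show "weak_conv_m
           (\<lambda>N. distr (P N) borel (\<lambda>\<omega>. sqrt (real N) / sqrt (V N) * (\<theta>hat N \<omega> - \<theta>0 N)))
           std_normal_distribution"
      by (rule D.asymptotic_normality[OF both V rates_o1(1,2) r0]) (use asm in blast)
  next
    assume asm: "(\<forall>N. (AE x in PX N. \<mu> N x = m N x) \<or> (AE x in PX N. e N x = \<pi> N x)) \<and>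
      (\<exists>c>0. \<exists>C>0. \<forall>N. \<not> (AE x in PX N. e N x = \<pi> N x) \<longrightarrow>
          (AE x in PX N. c \<le> \<pi> N x / e N x \<and> \<pi> N x / e N x \<le> C))"
    then have correct: "D.\<mu>_correct N \<or> D.e_correct N" for N
      by (simp add: D.\<mu>_correct_def D.e_correct_def)
    obtain c C' where c: "c > 0" and cC: "\<And>N. \<not> D.e_correct N \<Longrightarrow>
        (AE x in PX N. c \<le> \<pi> N x / e N x \<and> \<pi> N x / e N x \<le> C')"
      using asm unfolding D.e_correct_def by blast
    \<comment> \<open>One ratio bound for all \<open>N\<close>: the value 1 serves those with e =
      \<pi>, and \<open>C'\<close> the others.\<close>
    define C where "C = max 1 C'"
    have C: "1 \<le> C" by (simp add: C_def)
    have ratio: "AE x in PX N. 0 < e N x \<and> \<pi> N x / e N x \<le> C" for N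
    proof (cases "D.e_correct N")
      case True
      then have "AE x in PX N. e N x = \<pi> N x" by (simp add: D.e_correct_def)
      then show ?thesis using D.M.\<pi>_pos[of N] by eventually_elim (use C in auto)
    next
      case False
      from cC[OF False] D.M.\<pi>_pos[of N] show ?thesis
      proof eventually_elim
        case (elim x)
        \<comment> \<open>The positive lower bound on the ratio gives \<open>e\<close> the sign of
          \<pi> and excludes a zero denominator, for which the quotient would be 0.\<close>
        then have "0 < \<pi> N x / e N x" using c by linarith
        then show ?case using elim by (auto simp: C_def zero_less_divide_iff)
      qed
    qed
    show "Op P (\<lambda>N \<omega>. \<theta>hat N \<omega> - \<theta>0 N - \<psi>mean N \<omega> - \<Delta> N \<omega>)
          (\<lambda>N. c\<mu> N / sqrt (real N * a N) + ce N / sqrt (real N * a N) + r\<mu> N * re N)"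
      by (rule D.Op_remainder[OF C ratio correct])
    assume "\<exists>C::real. \<forall>N.
            ((AE x in PX N. e N x = \<pi> N x) \<longrightarrow>
               Lr_norm 2 (PX N) (\<lambda>x. m N x - \<mu> N x) < ennreal C) \<and>
            ((AE x in PX N. \<mu> N x = m N x) \<longrightarrow>
               Lr_norm 2 (PX N) (\<lambda>x. 1 - \<pi> N x / e N x) < ennreal C)"
    then obtain B where B: "\<And>N. D.e_correct N \<Longrightarrow> Lr_norm 2 (PX N) (\<lambda>x. m N x - \<mu> N x) < ennreal B"
      "\<And>N. D.\<mu>_correct N \<Longrightarrow> Lr_norm 2 (PX N) (\<lambda>x. 1 - \<pi> N x / e N x) < ennreal B"
      unfolding D.e_correct_def D.\<mu>_correct_def by blast
    have "Op P (\<lambda>N \<omega>. \<theta>hat N \<omega> - \<theta>0 N)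
      (\<lambda>N. (1 + c\<mu> N + ce N) / sqrt (real N * a N) + r\<mu> N * re N +
         re N * of_bool (\<not> D.\<mu>_correct N) + r\<mu> N * of_bool (\<not> D.e_correct N))"
    \<comment> \<open>The given bound has no assumed sign; its absolute value is nonnegative and has
      the same square.\<close>
    proof (rule D.Op_error[OF C ratio correct, of "\<bar>B\<bar>"])
      show "(\<integral>\<^sup>+x. ennreal ((m N x - \<mu> N x)\<^sup>2) \<partial>PX N) \<le> ennreal (\<bar>B\<bar>\<^sup>2)" if "D.e_correct N" for N
        using Lr_norm_2_less[OF B(1)[OF that]] by simp
      show "(\<integral>\<^sup>+x. ennreal ((1 - \<pi> N x / e N x)\<^sup>2) \<partial>PX N) \<le> ennreal (\<bar>B\<bar>\<^sup>2)" if "D.\<mu>_correct N" for N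
        using Lr_norm_2_less[OF B(2)[OF that]] by simp
    qed simp
    then show "Op P (\<lambda>N \<omega>. \<theta>hat N \<omega> - \<theta>0 N)
           (\<lambda>N. (1 + c\<mu> N + ce N) / sqrt (real N * a N) + r\<mu> N * re N +
                re N * of_bool (\<not> (AE x in PX N. \<mu> N x = m N x)) +
                r\<mu> N * of_bool (\<not> (AE x in PX N. e N x = \<pi> N x)))"
      by (simp only: D.e_correct_def D.\<mu>_correct_def)
  qed
qed

end
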